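(* Let $T$ be a tree, let $H\leqslant\operatorname{Aut}(T)$ be a subgroup, and let $\Gamma_1,\Gamma_2\leqslant H$ be free uniform lattices in $\operatorname{Aut}(T)$. Then for all $R\in\mathbb{N}$ there exists $g\in\mathscr{S}_R(H)$ such that the conjugate $\Gamma_1^g$ is commensurable to $\Gamma_2$ in $\operatorname{Aut}(T)$.
   Context: A graph $G$ consists of a vertex set $V(G)$, an edge set $E(G)$ (of oriented edges), maps $\partial_0,\partial_1:E(G)\to V(G)$ (initial and terminal vertex), and an involution $e\mapsto\overline{e}$ on $E(G)$ with $e\neq\overline{e}$, $\partial_0 e=\partial_1\overline{e}$ and $\partial_0\overline{e}=\partial_1 e$ for all $e$. Graph morphisms are pairs of maps on vertices and edges preserving $\partial_0,\partial_1$ and edge inversion; an automorphism of a graph is a morphism from the graph to itself that is bijective on vertices and on edges, and $\operatorname{Aut}(G)$ denotes the group of automorphisms. A tree is a (connected) graph whose topological realisation is simply connected. For a tree $T$, a subgroup $\Gamma\leqslant\operatorname{Aut}(T)$ is a free uniform lattice in $\operatorname{Aut}(T)$ (with the compact-open topology) if it acts freely and cocompactly on $T$ (freely on the topological realisation, so no non-trivial element fixes a vertex or inverts an edge); equivalently, $\Gamma$ is the group of deck transformations of a covering $T\to G$ of a finite graph $G$. For $v\in V(T)$, $B_R(v)$ denotes the $R$-ball in $T$ centred at $v$, and for $g\in\operatorname{Aut}(T)$, $g_v:B_R(v)\to B_R(gv)$ denotes the restriction of $g$ to $B_R(v)$. The $R$-symmetry-restricted closure of $H\leqslant\operatorname{Aut}(T)$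 is $$\mathscr{S}_R(H):=\{g\in\operatorname{Aut}(T)\mid \forall v\in V(T),\ \exists h\in H \text{ such that } h_v=g_v:B_R(v)\to B_R(gv)\}.$$ $\Gamma_1^g=g\Gamma_1g^{-1}$. Two subgroups of a group are commensurable in that group if their intersection has finite index in each of them. *)

theory Defs
  imports
    "HOL-Analysis.Analysis"
    "HOL-Algebra.Group_Action"
    "Graph_Theory.Bidirected_Digraph"
    "Graph_Theory.Arc_Walk"
begin

text \<open>
  A graph with oriented edges and edge inversion is a pair of a
  \<^typ>\<open>('v, 'e) pre_digraph\<close> \<open>T\<close> and a map \<open>bar\<close> such that
  \<^term>\<open>bidirected_digraph T bar\<close>: \<^const>\<open>tail\<close> and \<^const>\<open>head\<close> are the maps
  \<open>\<partial>\<^sub>0\<close> and \<open>\<partial>\<^sub>1\<close>, and \<open>bar\<close> is a fixed point free involution of the set of arcs exchanging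
  them, extended by the identity outside the arcs. Loops, multiple edges and infinite graphs
  are allowed.
\<close>


subsection \<open>Topological realisation\<close>

definition quotient_topology :: "'a topology \<Rightarrow> ('a \<Rightarrow> 'b) \<Rightarrow> 'b topology" where
  "quotient_topology X q =
     topology (\<lambda>U. U \<subseteq> q ` topspace X \<and> openin X {x \<in> topspace X. q x \<in> U})"

lemma istopology_quotient:
  "istopology (\<lambda>U. U \<subseteq> q ` topspace X \<and> openin X {x \<in> topspace X. q x \<in> U})"
proof -
  have int: "{x \<in> topspace X. q x \<in> S \<inter> T} =
      {x \<in> topspace X. q x \<in> S} \<inter> {x \<in> topspace X. q x \<in> T}" for S T
    by auto
  have un: "{x \<in> topspace X. q x \<in> \<Union>K} = (\<Union>S\<in>K. {x \<in> topspace X. q x \<in> S})" for K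
    by auto
  show ?thesis
    unfolding istopology_def int un by (auto intro!: openin_Int openin_Union)
qed

lemma openin_quotient_topology:
  "openin (quotient_topology X q) U \<longleftrightarrow>
     U \<subseteq> q ` topspace X \<and> openin X {x \<in> topspace X. q x \<in> U}"
  by (simp add: quotient_topology_def istopology_quotient)

lemma topspace_quotient_topology [simp]: "topspace (quotient_topology X q) = q ` topspace X"
proof -
  have "{x \<in> topspace X. q x \<in> q ` topspace X} = topspace X"
    by auto
  then have "openin (quotient_topology X q) (q ` topspace X)"
    by (simp add: openin_quotient_topology)
  then show ?thesis
    by (metis openin_quotient_topology openin_subset openin_topspace subset_antisym)
qed

lemma quotient_map_quotient_topology: "quotient_map X (quotient_topology X q) q"
  by (auto simp: quotient_map_def openin_quotient_topology)

text \<open>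
  The disjoint union of a point \<open>(Inl v, 0)\<close> for every vertex \<open>v\<close> and an interval
  \<open>{(Inr e, t) | t \<in> [0,1]}\<close> for every oriented edge \<open>e\<close>.
\<close>

definition cell_space :: "('v, 'e) pre_digraph \<Rightarrow> (('v + 'e) \<times> real) topology" where
  "cell_space T =
     sum_topology (case_sum (\<lambda>v. top_of_set {0}) (\<lambda>e. top_of_set {0..1})) (verts T <+> arcs T)"

inductive glue ::
    "('v, 'e) pre_digraph \<Rightarrow> ('e \<Rightarrow> 'e) \<Rightarrow> ('v + 'e) \<times> real \<Rightarrow> ('v + 'e) \<times> real \<Rightarrow> bool"
  for T bar where
    glue_tail: "e \<in> arcs T \<Longrightarrow> glue T bar (Inr e, 0) (Inl (tail T e), 0)"
  | glue_head: "e \<in> arcs T \<Longrightarrow> glue T bar (Inr e, 1) (Inl (head T e), 0)"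
  | glue_bar: "e \<in> arcs T \<Longrightarrow> t \<in> {0..1} \<Longrightarrow> glue T bar (Inr e, t) (Inr (bar e), 1 - t)"

definition realisation ::
    "('v, 'e) pre_digraph \<Rightarrow> ('e \<Rightarrow> 'e) \<Rightarrow> (('v + 'e) \<times> real) set topology" where
  "realisation T bar = quotient_topology (cell_space T) (\<lambda>x. {y. equivclp (glue T bar) x y})"

text \<open>
  The library's \<^const>\<open>simply_connected\<close> is about subsets of topological spaces given by a type
  class; this is the notion for an abstract topology. The null homotopies are relative to
  the base point.
\<close>

definition simply_connected_space :: "'a topology \<Rightarrow> bool" where
  "simply_connected_space X \<longleftrightarrow>
     topspace X \<noteq> {} \<and> path_connected_space X \<and>
     (\<forall>p. pathin X p \<and> p 0 = p 1 \<longrightarrow>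
        homotopic_with (\<lambda>r. r 0 = p 0 \<and> r 1 = p 0) (top_of_set {0..1}) X p (\<lambda>t. p 0))"

definition is_tree :: "('v, 'e) pre_digraph \<Rightarrow> ('e \<Rightarrow> 'e) \<Rightarrow> bool" where
  "is_tree T bar \<longleftrightarrow> bidirected_digraph T bar \<and> simply_connected_space (realisation T bar)"


subsection \<open>Automorphisms\<close>

text \<open>
  Both components of an automorphism are extensional, so that equality of automorphisms is
  equality of their values on vertices and edges.
\<close>

definition AutG ::
    "('v, 'e) pre_digraph \<Rightarrow> ('e \<Rightarrow> 'e) \<Rightarrow> (('v \<Rightarrow> 'v) \<times> ('e \<Rightarrow> 'e)) monoid" where
  "AutG T bar = (BijGroup (verts T) \<times>\<times> BijGroup (arcs T))
     \<lparr>carrier := {(p, q). p \<in> Bij (verts T) \<and> q \<in> Bij (arcs T) \<and>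
        (\<forall>e \<in> arcs T. tail T (q e) = p (tail T e) \<and> head T (q e) = p (head T e) \<and>
                      q (bar e) = bar (q e))}\<rparr>"

text \<open>
  The homeomorphism of the realisation induced by an automorphism; the points of the
  realisation are equivalence classes, which are mapped to equivalence classes.
\<close>

definition act ::
    "('v \<Rightarrow> 'v) \<times> ('e \<Rightarrow> 'e) \<Rightarrow> (('v + 'e) \<times> real) set \<Rightarrow> (('v + 'e) \<times> real) set" where
  "act g x = map_prod (map_sum (fst g) (snd g)) id ` x"

definition acts_freely ::
    "('v, 'e) pre_digraph \<Rightarrow> ('e \<Rightarrow> 'e) \<Rightarrow> (('v \<Rightarrow> 'v) \<times> ('e \<Rightarrow> 'e)) set \<Rightarrow> bool" where
  "acts_freely T bar \<Gamma> \<longleftrightarrow>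
     (\<forall>x \<in> topspace (realisation T bar).
        stabilizer (AutG T bar\<lparr>carrier := \<Gamma>\<rparr>) act x = {\<one>\<^bsub>AutG T bar\<^esub>})"

definition acts_cocompactly ::
    "('v, 'e) pre_digraph \<Rightarrow> ('e \<Rightarrow> 'e) \<Rightarrow> (('v \<Rightarrow> 'v) \<times> ('e \<Rightarrow> 'e)) set \<Rightarrow> bool" where
  "acts_cocompactly T bar \<Gamma> \<longleftrightarrow>
     compact_space (quotient_topology (realisation T bar)
       (Group_Action.orbit (AutG T bar\<lparr>carrier := \<Gamma>\<rparr>) act))"

definition free_uniform_lattice ::
    "('v, 'e) pre_digraph \<Rightarrow> ('e \<Rightarrow> 'e) \<Rightarrow> (('v \<Rightarrow> 'v) \<times> ('e \<Rightarrow> 'e)) set \<Rightarrow> bool" where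
  "free_uniform_lattice T bar \<Gamma> \<longleftrightarrow>
     subgroup \<Gamma> (AutG T bar) \<and> acts_freely T bar \<Gamma> \<and> acts_cocompactly T bar \<Gamma>"


subsection \<open>Symmetry-restricted closure\<close>

definition ball_verts :: "('v, 'e) pre_digraph \<Rightarrow> nat \<Rightarrow> 'v \<Rightarrow> 'v set" where
  "ball_verts T R v = {u. \<exists>p. pre_digraph.awalk T v p u \<and> length p \<le> R}"

text \<open>
  In a tree the endpoints of an edge lie at distances from \<open>v\<close> that differ by one, so the
  induced subgraph is the same as the metric ball of radius \<open>R\<close>.
\<close>

definition ball_arcs :: "('v, 'e) pre_digraph \<Rightarrow> nat \<Rightarrow> 'v \<Rightarrow> 'e set" where
  "ball_arcs T R v =
     {e \<in> arcs T. tail T e \<in> ball_verts T R v \<and> head T e \<in> ball_verts T R v}"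

text \<open>
  The restriction \<open>g\<^sub>v\<close> of \<open>g\<close> to the ball \<open>B\<^sub>R(v)\<close>. Since \<open>v\<close> lies in its ball, equal
  restrictions of \<open>g\<close> and \<open>h\<close> have the same target ball around \<open>g v = h v\<close>.
\<close>

definition ball_restrict ::
    "('v, 'e) pre_digraph \<Rightarrow> nat \<Rightarrow> 'v \<Rightarrow> ('v \<Rightarrow> 'v) \<times> ('e \<Rightarrow> 'e) \<Rightarrow> ('v \<Rightarrow> 'v) \<times> ('e \<Rightarrow> 'e)" where
  "ball_restrict T R v g =
     (restrict (fst g) (ball_verts T R v), restrict (snd g) (ball_arcs T R v))"

definition symmetry_restricted_closure ::
    "('v, 'e) pre_digraph \<Rightarrow> ('e \<Rightarrow> 'e) \<Rightarrow> nat \<Rightarrow>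
     (('v \<Rightarrow> 'v) \<times> ('e \<Rightarrow> 'e)) set \<Rightarrow> (('v \<Rightarrow> 'v) \<times> ('e \<Rightarrow> 'e)) set" where
  "symmetry_restricted_closure T bar R H =
     {g \<in> carrier (AutG T bar).
        \<forall>v \<in> verts T. \<exists>h \<in> H. ball_restrict T R v h = ball_restrict T R v g}"


subsection \<open>Commensurability\<close>

definition has_finite_index :: "('a, 'b) monoid_scheme \<Rightarrow> 'a set \<Rightarrow> 'a set \<Rightarrow> bool" where
  "has_finite_index G K L \<longleftrightarrow> finite (rcosets\<^bsub>G\<lparr>carrier := L\<rparr>\<^esub> K)"

definition commensurable :: "('a, 'b) monoid_scheme \<Rightarrow> 'a set \<Rightarrow> 'a set \<Rightarrow> bool" where
  "commensurable G K L \<longleftrightarrow>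
     subgroup K G \<and> subgroup L G \<and>
     has_finite_index G (K \<inter> L) K \<and> has_finite_index G (K \<inter> L) L"

definition conjugate :: "('a, 'b) monoid_scheme \<Rightarrow> 'a set \<Rightarrow> 'a \<Rightarrow> 'a set" where
  "conjugate G K g = g <#\<^bsub>G\<^esub> K #>\<^bsub>G\<^esub> inv\<^bsub>G\<^esub> g"

end

theory Submission
  imports Defs "HOL-Complex_Analysis.Winding_Numbers"
begin

text \<open>
  This is a form of Leighton's theorem on common finite coverings, in which the deck groups are
  conjugated by an automorphism that looks like an element of \<open>H\<close> on every ball of radius \<open>R\<close>.

  Let \<open>B v\<close> be the ball of radius \<open>R + 1\<close> around \<open>v\<close>, and call the restriction of an element of
  \<open>H\<close> to \<open>B v\<close> a germ at \<open>v\<close>. For an arc \<open>e\<close> from \<open>u\<close> to \<open>w\<close>, the restriction to \<open>B u \<inter> B w\<close> is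
  a germ at \<open>e\<close>. If a germ is chosen at every vertex in such a way that the germs at the ends
  of every arc agree on the overlap of their balls, then the germs glue to one map \<open>g\<close> of the
  tree. It maps the star of each vertex bijectively to a star, hence is an automorphism
  (\<open>glue_automorphisms\<close>), and it agrees with an element of \<open>H\<close> on each ball. So everything is
  about choosing germs that agree along the arcs, and choosing them periodically enough for \<open>g\<close>
  to conjugate a subgroup of finite index of \<open>\<Gamma>\<^sub>1\<close> to one of \<open>\<Gamma>\<^sub>2\<close>.

  The group \<open>\<Gamma>\<^sub>1 \<times> \<Gamma>\<^sub>2\<close> acts on germs by \<open>(\<gamma>, \<delta>) c = \<delta> c \<gamma>\<inverse>\<close>, with finitely many orbits. A germ
  at \<open>e\<close> can have different numbers of extensions to germs at \<open>u\<close> and at \<open>w\<close>, so germs at \<open>u\<close>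
  and at \<open>w\<close> cannot simply be matched with one another. The remedy is to take several copies of
  each germ. Let \<open>N(v)\<close> and \<open>N(e)\<close> be the numbers of \<open>\<Gamma>\<^sub>1\<close>-orbits, under \<open>h \<mapsto> \<gamma> h\<close>, of the
  germs at \<open>v\<close> and at \<open>e\<close>. Because \<open>\<Gamma>\<^sub>1\<close> acts freely on the vertices, a germ at \<open>e\<close> has exactly
  \<open>N(u) / N(e)\<close> extensions to \<open>u\<close> (\<open>num_orbs_extensions\<close>). Hence with \<open>C / N(v)\<close> copies of
  every germ at \<open>v\<close>, where \<open>C\<close> is a common multiple of all \<open>N(v)\<close>, a germ at \<open>e\<close> has \<open>C / N(e)\<close>
  labelled extensions at both of its ends. The function \<open>N\<close> is constant on the orbits of \<open>\<Gamma>\<^sub>1\<close>;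
  this plays the role of the unimodularity of \<open>H\<close> in arguments with the Haar measure.

  As \<open>\<Gamma>\<^sub>1 \<times> \<Gamma>\<^sub>2\<close> acts freely on the germs at arcs, the labelled extensions can be matched by
  bijections that commute with this action (\<open>equivariant_labelling\<close>, \<open>linking\<close>). Transport
  along the arcs of the tree then extends any labelled germ to a unique flat section, and a
  flat section gives \<open>g\<close>. There are only finitely many orbits of labelled germs, and if \<open>(\<gamma>,
  \<delta>)\<close> maps the value of the section at one vertex to its value at another one, then by
  uniqueness it maps the whole section to itself, which means that \<open>g \<gamma> = \<delta> g\<close>
  (\<open>commensurating_automorphism\<close>). This gives the two finite indices.

  What is used about the tree and the lattices is combinatorial, and is extracted from the
  topological definitions by constructing continuous functions on the realisation: a function
  to a discrete space shows that the graph is connected, a map to the circle that winds once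
  around it along an arc shows that this arc is a bridge (\<open>bridge_if_simply_connected\<close>), and
  real functions, which must be bounded on the compact quotient, show that there are finitely
  many orbits of arcs (\<open>finite_arc_orbits\<close>).
\<close>

section \<open>Maps out of the topological realisation\<close>

definition cell_class :: "('v, 'e) pre_digraph \<Rightarrow> ('e \<Rightarrow> 'e) \<Rightarrow> ('v + 'e) \<times> real \<Rightarrow> (('v + 'e) \<times> real) set"
  where "cell_class T bar x = {y. equivclp (glue T bar) x y}"

lemma realisation_eq: "realisation T bar = quotient_topology (cell_space T) (cell_class T bar)"
  by (simp add: realisation_def cell_class_def[abs_def])

lemma cell_class_eq_iff: "cell_class T bar x = cell_class T bar y \<longleftrightarrow> equivclp (glue T bar) x y"
proof
  assume "cell_class T bar x = cell_class T bar y"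
  then have "y \<in> cell_class T bar x"
    by (simp add: cell_class_def)
  then show "equivclp (glue T bar) x y"
    by (simp add: cell_class_def)
next
  assume "equivclp (glue T bar) x y"
  then show "cell_class T bar x = cell_class T bar y"
    unfolding cell_class_def
    by (intro Collect_cong iffI) (erule equivclp_trans[OF equivclp_sym], assumption,
        erule equivclp_trans, assumption)
qed

lemma cell_class_eqI: "glue T bar x y \<Longrightarrow> cell_class T bar x = cell_class T bar y"
  by (auto simp: cell_class_eq_iff)

lemma topspace_cell_space:
  "topspace (cell_space T) = {(Inl v, 0) | v. v \<in> verts T} \<union> {(Inr e, t) | e t. e \<in> arcs T \<and> t \<in> {0..1}}"
  by (auto simp: cell_space_def topspace_sum_topology)

lemma topspace_realisation: "topspace (realisation T bar) = cell_class T bar ` topspace (cell_space T)"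
  by (simp add: realisation_eq)

lemma continuous_map_cell_space:
  assumes "\<And>v. v \<in> verts T \<Longrightarrow> F (Inl v, 0) \<in> topspace Y"
    and "\<And>e. e \<in> arcs T \<Longrightarrow> continuous_map (top_of_set {0..1}) Y (\<lambda>t. F (Inr e, t))"
  shows "continuous_map (cell_space T) Y F"
  unfolding continuous_map
proof (intro conjI allI impI)
  show "F ` topspace (cell_space T) \<subseteq> topspace Y"
    using assms(1) continuous_map_image_subset_topspace[OF assms(2)]
    by (fastforce simp: topspace_cell_space)
next
  fix U assume U: "openin Y U"
  show "openin (cell_space T) {x \<in> topspace (cell_space T). F x \<in> U}"
    unfolding cell_space_def openin_sum_topology
  proof (intro conjI ballI)
    fix i assume i: "i \<in> verts T <+> arcs T"
    show "openin (case i of Inl v \<Rightarrow> top_of_set {0} | Inr e \<Rightarrow> top_of_set {0..1})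
        {x. (i, x) \<in> {x \<in> topspace (sum_topology
           (case_sum (\<lambda>v. top_of_set {0}) (\<lambda>e. top_of_set {0..1})) (verts T <+> arcs T)). F x \<in> U}}"
    proof (cases i)
      case (Inl v)
      have "{x. x \<in> {0::real} \<and> F (Inl v, x) \<in> U} = {0} \<or> {x. x \<in> {0::real} \<and> F (Inl v, x) \<in> U} = {}"
        by auto
      then have "openin (top_of_set {0}) {x. x \<in> {0::real} \<and> F (Inl v, x) \<in> U}"
        by (elim disjE) (simp_all only: openin_empty openin_subtopology_self)
      then show ?thesis
        using Inl i by (auto simp: topspace_sum_topology)
    next
      case (Inr e)
      then have e: "e \<in> arcs T" using i by auto
      have "openin (top_of_set {0..1}) {x \<in> {0..1}. F (Inr e, x) \<in> U}"
        using openin_continuous_map_preimage[OF assms(2)[OF e] U] by simp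
      moreover have "{x. (i, x) \<in> {x \<in> topspace (sum_topology
           (case_sum (\<lambda>v. top_of_set {0}) (\<lambda>e. top_of_set {0..1})) (verts T <+> arcs T)). F x \<in> U}}
           = {x \<in> {0..1}. F (Inr e, x) \<in> U}"
        using Inr e by (auto simp: topspace_sum_topology)
      ultimately show ?thesis using Inr by simp
    qed
  qed auto
qed

text \<open>
  The universal property of the realisation: a function on the cells that is compatible with
  the gluing descends to it.
\<close>

lemma realisation_map:
  assumes "\<And>v. v \<in> verts T \<Longrightarrow> F (Inl v, 0) \<in> topspace Y"
    and "\<And>e. e \<in> arcs T \<Longrightarrow> continuous_map (top_of_set {0..1}) Y (\<lambda>t. F (Inr e, t))"
    and glue: "\<And>x y. glue T bar x y \<Longrightarrow> F x = F y"
  obtains f where "continuous_map (realisation T bar) Y f" and "\<And>x. f (cell_class T bar x) = F x"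
proof
  define f where "f c = F (SOME x. c = cell_class T bar x)" for c
  have inv: "F x = F y" if "equivclp (glue T bar) x y" for x y
    using that by (induction rule: equivclp_induct) (use glue in metis)+
  show f: "f (cell_class T bar x) = F x" for x
  proof -
    have "cell_class T bar x = cell_class T bar (SOME y. cell_class T bar x = cell_class T bar y)"
      by (rule someI) (rule refl)
    then show ?thesis
      unfolding f_def cell_class_eq_iff by (rule inv[symmetric])
  qed
  have "continuous_map (cell_space T) Y (f \<circ> cell_class T bar)"
    using continuous_map_cell_space[OF assms(1,2)] by (simp add: comp_def f)
  then show "continuous_map (realisation T bar) Y f"
    unfolding realisation_eq
    by (rule continuous_compose_quotient_map[OF quotient_map_quotient_topology])
qed

lemma continuous_map_arc:
  assumes "e \<in> arcs T"
  shows "continuous_map (top_of_set {0..1}) (realisation T bar) (\<lambda>t. cell_class T bar (Inr e, t))"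
proof -
  have "continuous_map (top_of_set {0..1::real}) (cell_space T) (\<lambda>t. (Inr e, t))"
    using continuous_map_component_injection[of "Inr e" "verts T <+> arcs T"
        "case_sum (\<lambda>v. top_of_set {0}) (\<lambda>e. top_of_set {0..1})"] assms
    unfolding cell_space_def by (simp add: InrI)
  moreover have "continuous_map (cell_space T) (realisation T bar) (cell_class T bar)"
    by (simp add: quotient_imp_continuous_map quotient_map_quotient_topology realisation_eq)
  ultimately show ?thesis
    using continuous_map_compose by (fastforce simp: comp_def)
qed

text \<open>
  The points on cells that are joined to \<open>u\<close> by a walk form an open and closed set.
\<close>

lemma connected_if_realisation_connected:
  assumes "bidirected_digraph T bar" and conn: "path_connected_space (realisation T bar)"
    and "u \<in> verts T" "v \<in> verts T"
  shows "\<exists>p. pre_digraph.awalk T u p v"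
proof -
  interpret bidirected_digraph T bar by fact
  define C where "C = {w. \<exists>p. awalk u p w}"
  have step: "head T e \<in> C" if e: "e \<in> arcs T" "tail T e \<in> C" for e
  proof -
    obtain p where "awalk u p (tail T e)" using e unfolding C_def by blast
    then have "awalk u (p @ [e]) (head T e)"
      using arc_implies_awalk[OF e(1)] by (rule awalk_appendI)
    then show ?thesis unfolding C_def by blast
  qed
  have C_iff: "head T e \<in> C \<longleftrightarrow> tail T e \<in> C" if "e \<in> arcs T" for e
    using step[of e] step[of "bar e"] that by auto
  define F :: "('a + 'b) \<times> real \<Rightarrow> bool" where
    "F x = (case fst x of Inl w \<Rightarrow> w \<in> C | Inr e \<Rightarrow> tail T e \<in> C)" for x
  obtain f where f: "continuous_map (realisation T bar) (discrete_topology UNIV) f"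
    and fF: "\<And>x. f (cell_class T bar x) = F x"
  proof (rule realisation_map[of T F "discrete_topology UNIV" bar])
    show "F x = F y" if "glue T bar x y" for x y
      using that by cases (auto simp: F_def C_iff)
  qed (auto simp: F_def)
  have "connected_space (realisation T bar)"
    by (simp add: conn path_connected_imp_connected_space)
  then have "connectedin (discrete_topology UNIV) (f ` topspace (realisation T bar))"
    using connectedin_continuous_map_image f connectedin_topspace by blast
  then obtain a where a: "f ` topspace (realisation T bar) \<subseteq> {a}"
    by (auto simp: connectedin_discrete_topology)
  have "F (Inl w, 0) = a" if "w \<in> verts T" for w
  proof -
    have "cell_class T bar (Inl w, 0) \<in> topspace (realisation T bar)"
      using that by (auto simp: topspace_realisation topspace_cell_space)
    then show ?thesis using a fF by blast
  qed
  then have "F (Inl u, 0) = F (Inl v, 0)"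
    using assms by metis
  moreover have "u \<in> C" using assms awalk_Nil_iff unfolding C_def by blast
  ultimately have "v \<in> C" by (simp add: F_def)
  then show ?thesis by (simp add: C_def)
qed

section \<open>Arcs of a simply connected graph are bridges\<close>

text \<open>
  A loop that runs once around the circle and then rests has winding number 1.
\<close>

lemma circle_loop_not_nullhomotopic:
  fixes c :: "real \<Rightarrow> complex"
  assumes c: "\<And>t. t \<in> {0..1/2} \<Longrightarrow> c t = exp (2 * of_real pi * \<i> * of_real (2 * t))"
    and c': "\<And>t. t \<in> {1/2..1} \<Longrightarrow> c t = 1"
  shows "\<not> homotopic_with (\<lambda>r. r 0 = 1 \<and> r 1 = 1) (top_of_set {0..1}) (top_of_set (- {0})) c (\<lambda>t. 1)"
proof
  assume "homotopic_with (\<lambda>r. r 0 = 1 \<and> r 1 = 1) (top_of_set {0..1}) (top_of_set (- {0})) c (\<lambda>t. 1)"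
  then have "homotopic_with (\<lambda>r. pathfinish r = pathstart r) (top_of_set {0..1}) (top_of_set (- {0})) c (\<lambda>t. 1)"
    by (rule homotopic_with_mono) (simp add: pathstart_def pathfinish_def)
  moreover have "linepath 1 1 = (\<lambda>t. 1 :: complex)"
    by (simp add: linepath_def fun_eq_iff scaleR_conv_of_real flip: of_real_add)
  ultimately have "homotopic_loops (- {0}) c (linepath 1 1)"
    unfolding homotopic_loops_def by simp
  then have "winding_number c 0 = winding_number (linepath 1 1) 0"
    by (rule winding_number_homotopic_loops)
  then have w0: "winding_number c 0 = 0" by (simp add: winding_number_trivial)
  let ?d = "circlepath 0 1 +++ linepath 1 1"
  have "winding_number ?d 0 = winding_number (circlepath 0 1) 0 + winding_number (linepath 1 1) 0"
    by (rule winding_number_join) (auto simp: path_image_circlepath)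
  also have "\<dots> = 1"
    by (simp add: winding_number_trivial winding_number_circlepath)
  finally have w1: "winding_number ?d 0 = 1" .
  have dc: "?d t = c t" if "t \<in> {0..1}" for t
  proof (cases "t \<le> 1/2")
    case True
    then show ?thesis using that c[of t] by (simp add: joinpaths_def circlepath)
  next
    case False
    then show ?thesis using that c'[of t]
      by (simp add: joinpaths_def linepath_def scaleR_conv_of_real flip: of_real_add)
  qed
  have pd: "path ?d" by simp
  have "homotopic_paths (- {0}) ?d c"
  proof (rule homotopic_paths_eq)
    show "path_image ?d \<subseteq> - {0}"
      using path_image_circlepath[of 1 0] by (simp add: path_image_join)
  qed (use dc pd in simp_all)
  then have "winding_number ?d 0 = winding_number c 0"
    by (rule winding_number_homotopic_paths)
  then show False using w0 w1 by simp
qed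

text \<open>
  Wrap the arc \<open>e\<close> around the circle and send the rest of the realisation to the point 1. If
  the ends of \<open>e\<close> were joined by a walk that avoids \<open>e\<close> and its inverse, then \<open>e\<close> followed by
  this walk would be a loop whose image winds around the circle once; but the loop is null
  homotopic.
\<close>

lemma bridge_if_simply_connected:
  assumes "bidirected_digraph T bar" and sc: "simply_connected_space (realisation T bar)"
    and e: "e \<in> arcs T" and p: "pre_digraph.awalk T (head T e) p (tail T e)"
  shows "e \<in> set p \<or> bar e \<in> set p"
proof (rule ccontr)
  interpret bidirected_digraph T bar by fact
  assume "\<not> ?thesis"
  then have e_p: "e \<notin> set p" "bar e \<notin> set p" by auto
  define F :: "('a + 'b) \<times> real \<Rightarrow> complex" where
    "F x = (if fst x = Inr e then exp (2 * of_real pi * \<i> * of_real (snd x))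
            else if fst x = Inr (bar e) then exp (2 * of_real pi * \<i> * of_real (1 - snd x)) else 1)" for x
  have e_bar: "bar e \<noteq> e" "e \<noteq> bar e" using e arev_neq by metis+
  have F_simps: "F (Inl w, t) = 1" "F (Inr e, t) = exp (2 * of_real pi * \<i> * of_real t)"
     "F (Inr (bar e), t) = exp (2 * of_real pi * \<i> * of_real (1 - t))"
     "a \<noteq> e \<Longrightarrow> a \<noteq> bar e \<Longrightarrow> F (Inr a, t) = 1" for w t a
    using e_bar by (auto simp: F_def)
  have F01: "F (Inr a, 0) = 1" "F (Inr a, 1) = 1" for a
    using exp_two_pi_i by (cases "a = e"; cases "a = bar e"; simp add: F_simps mult_ac)+
  obtain f where f: "continuous_map (realisation T bar) (top_of_set (- {0})) f"
    and fF: "\<And>x. f (cell_class T bar x) = F x"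
  proof (rule realisation_map[of T F "top_of_set (- {0})" bar])
    show "continuous_map (top_of_set {0..1}) (top_of_set (- {0})) (\<lambda>t. F (Inr a, t))"
      if "a \<in> arcs T" for a
      unfolding F_def by (cases "a = e"; cases "a = bar e") (auto intro!: continuous_intros)
    show "F x = F y" if "glue T bar x y" for x y
      using that
    proof cases
      case (glue_bar a t)
      show ?thesis
        using arev_arev e_bar unfolding glue_bar
        by (cases "a = e"; cases "a = bar e"; simp add: F_simps) (metis F_simps(4) arev_arev)
    qed (auto simp: F_simps F01)
  qed (auto simp: F_simps)
  let ?c = "cell_class T bar"
  let ?Y = "subtopology (realisation T bar) {x. f x = 1}"
  have arc_path: "path_component_of ?Y (?c (Inl (tail T a), 0)) (?c (Inl (head T a), 0))"
    if a: "a \<in> arcs T" "a \<noteq> e" "a \<noteq> bar e" for a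
    unfolding path_component_of_def pathin_subtopology
  proof (intro exI conjI ballI)
    show "pathin (realisation T bar) (\<lambda>t. ?c (Inr a, t))"
      unfolding pathin_def by (rule continuous_map_arc[OF a(1)])
    show "?c (Inr a, 0) = ?c (Inl (tail T a), 0)"
      by (rule cell_class_eqI[OF glue_tail[OF a(1)]])
    show "?c (Inr a, 1) = ?c (Inl (head T a), 0)"
      by (rule cell_class_eqI[OF glue_head[OF a(1)]])
  qed (use a in \<open>auto simp: fF F_simps\<close>)
  have walk_path: "path_component_of ?Y (?c (Inl u, 0)) (?c (Inl v, 0))"
    if "awalk u p v" "e \<notin> set p" "bar e \<notin> set p" for u p v
    using that
  proof (induction p arbitrary: u)
    case Nil
    then have "u = v" "u \<in> verts T" by (auto simp: awalk_Nil_iff)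
    moreover have "?c (Inl u, 0) \<in> topspace ?Y" if "u \<in> verts T" for u
      using that by (auto simp: topspace_realisation topspace_cell_space fF F_simps)
    ultimately show ?case by (simp add: path_component_of_refl)
  next
    case (Cons a p)
    then have "a \<in> arcs T" "tail T a = u" "awalk (head T a) p v"
      by (auto simp: awalk_Cons_iff)
    then show ?case
      using Cons.IH[of "head T a"] Cons.prems arc_path[of a]
      by (auto intro: path_component_of_trans)
  qed
  obtain Q where Q: "pathin (realisation T bar) Q" "\<And>t. t \<in> {0..1} \<Longrightarrow> f (Q t) = 1"
    "Q 0 = ?c (Inl (head T e), 0)" "Q 1 = ?c (Inl (tail T e), 0)"
    using walk_path[OF p e_p] unfolding path_component_of_def pathin_subtopology by auto
  let ?T01 = "top_of_set {0..1::real}"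
  let ?g1 = "\<lambda>t. ?c (Inr e, t)"
  \<comment> \<open>The arc itself, followed by a path from its head back to its tail on which the map to the
    circle is constant.\<close>
  define P where "P t = (if t \<le> 1/2 then (?g1 \<circ> (\<lambda>t. 2 * t)) t else (Q \<circ> (\<lambda>t. 2 * t - 1)) t)" for t :: real
  have P: "continuous_map ?T01 (realisation T bar) P"
    unfolding P_def
  proof (intro continuous_map_cases_le continuous_map_compose, force, force)
    show "continuous_map (subtopology ?T01 {x \<in> topspace ?T01. x \<le> 1/2}) ?T01 ((*) 2)"
      by (auto simp: continuous_map_in_subtopology continuous_map_from_subtopology)
    have "continuous_map
           (subtopology (top_of_set {0..1}) {x. 0 \<le> x \<and> x \<le> 1 \<and> 1 \<le> x * 2})
           euclideanreal (\<lambda>t. 2 * t - 1)"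
      by (intro continuous_intros) (force intro: continuous_map_from_subtopology)
    then show "continuous_map (subtopology ?T01 {x \<in> topspace ?T01. 1/2 \<le> x}) ?T01 (\<lambda>t. 2 * t - 1)"
      by (force simp: continuous_map_in_subtopology)
    show "(?g1 \<circ> (*) 2) x = (Q \<circ> (\<lambda>t. 2 * t - 1)) x" if "x \<in> topspace ?T01" "x = 1/2" for x
      unfolding that(2) using Q(3) cell_class_eqI[OF glue_head[OF e], of bar] by simp
    show "continuous_map ?T01 (realisation T bar) Q" using Q(1) by (simp add: pathin_def)
  qed (rule continuous_map_arc[OF e])
  have P0: "P 0 = ?c (Inl (tail T e), 0)" and P1: "P 1 = ?c (Inl (tail T e), 0)"
    using Q(4) cell_class_eqI[OF glue_tail[OF e], of bar] by (auto simp: P_def)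
  have "homotopic_with (\<lambda>r. r 0 = P 0 \<and> r 1 = P 0) ?T01 (realisation T bar) P (\<lambda>t. P 0)"
    using sc P P0[folded P1] unfolding simply_connected_space_def pathin_def by blast
  then have "homotopic_with (\<lambda>r. r 0 = 1 \<and> r 1 = 1) ?T01 (top_of_set (- {0})) (f \<circ> P) (f \<circ> (\<lambda>t. P 0))"
    by (rule homotopic_with_compose_continuous_map_left[OF _ f]) (auto simp: P0 fF F_simps)
  moreover have "f \<circ> (\<lambda>t :: real. P 0) = (\<lambda>t. 1)" by (auto simp: P0 fF F_simps)
  ultimately have "homotopic_with (\<lambda>r. r 0 = 1 \<and> r 1 = 1) ?T01 (top_of_set (- {0})) (f \<circ> P) (\<lambda>t. 1)"
    by simp
  moreover have "(f \<circ> P) t = exp (2 * of_real pi * \<i> * of_real (2 * t))" if "t \<in> {0..1/2}" for t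
    using that by (simp add: P_def fF F_simps)
  moreover have "(f \<circ> P) t = 1" if "t \<in> {1/2..1}" for t
  proof (cases "t = 1/2")
    case True
    show ?thesis unfolding True using F01 by (simp add: P_def fF)
  next
    case False
    then show ?thesis using that by (simp add: P_def Q(2))
  qed
  ultimately show False
    using circle_loop_not_nullhomotopic[of "f \<circ> P"] by blast
qed

section \<open>Automorphisms of graphs\<close>

type_synonym ('v, 'e) aut = "('v \<Rightarrow> 'v) \<times> ('e \<Rightarrow> 'e)"

lemma AutG_carrier:
  "g \<in> carrier (AutG T bar) \<longleftrightarrow> fst g \<in> Bij (verts T) \<and> snd g \<in> Bij (arcs T) \<and>
     (\<forall>e \<in> arcs T. tail T (snd g e) = fst g (tail T e) \<and> head T (snd g e) = fst g (head T e) \<and>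
                   snd g (bar e) = bar (snd g e))"
  by (cases g) (simp add: AutG_def)

lemma AutG_mult:
  assumes "g \<in> carrier (AutG T bar)" "h \<in> carrier (AutG T bar)"
  shows "g \<otimes>\<^bsub>AutG T bar\<^esub> h = (compose (verts T) (fst g) (fst h), compose (arcs T) (snd g) (snd h))"
  using assms by (cases g, cases h) (simp add: AutG_def BijGroup_def)

lemma AutG_one: "\<one>\<^bsub>AutG T bar\<^esub> = (\<lambda>v\<in>verts T. v, \<lambda>e\<in>arcs T. e)"
  by (simp add: AutG_def BijGroup_def)

lemma Bij_apply: "f \<in> Bij S \<Longrightarrow> x \<in> S \<Longrightarrow> f x \<in> S"
  using Bij_imp_funcset by blast

lemma group_AutG:
  assumes "bidirected_digraph T bar"
  shows "group (AutG T bar)"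
proof (rule groupI)
  interpret bidirected_digraph T bar by fact
  let ?G = "AutG T bar"
  show "g \<otimes>\<^bsub>?G\<^esub> h \<in> carrier ?G" if "g \<in> carrier ?G" "h \<in> carrier ?G" for g h
    using that unfolding AutG_mult[OF that] unfolding AutG_carrier
    by (auto simp: compose_Bij compose_eq Bij_apply)
  show "\<one>\<^bsub>?G\<^esub> \<in> carrier ?G"
    by (auto simp: AutG_carrier AutG_one id_Bij)
  then show "\<one>\<^bsub>?G\<^esub> \<otimes>\<^bsub>?G\<^esub> g = g" if "g \<in> carrier ?G" for g
    using that by (cases g)
      (simp add: AutG_mult AutG_carrier, simp add: AutG_one Bij_imp_funcset Bij_imp_extensional)
  show "g \<otimes>\<^bsub>?G\<^esub> h \<otimes>\<^bsub>?G\<^esub> k = g \<otimes>\<^bsub>?G\<^esub> (h \<otimes>\<^bsub>?G\<^esub> k)"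
    if "g \<in> carrier ?G" "h \<in> carrier ?G" "k \<in> carrier ?G" for g h k
  proof -
    have "g \<otimes>\<^bsub>?G\<^esub> h \<in> carrier ?G" "h \<otimes>\<^bsub>?G\<^esub> k \<in> carrier ?G"
      using \<open>\<And>h g. g \<in> carrier ?G \<Longrightarrow> h \<in> carrier ?G \<Longrightarrow> g \<otimes>\<^bsub>?G\<^esub> h \<in> carrier ?G\<close> that by blast+
    then show ?thesis
      using that by (simp add: AutG_mult)
        (simp add: AutG_carrier compose_assoc[OF Bij_imp_funcset])
  qed
  show "\<exists>h\<in>carrier ?G. h \<otimes>\<^bsub>?G\<^esub> g = \<one>\<^bsub>?G\<^esub>" if g: "g \<in> carrier ?G" for g
  proof -
    define p where "p = restrict (inv_into (verts T) (fst g)) (verts T)"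
    define q where "q = restrict (inv_into (arcs T) (snd g)) (arcs T)"
    have gB: "fst g \<in> Bij (verts T)" "snd g \<in> Bij (arcs T)" using g by (auto simp: AutG_carrier)
    then have B: "p \<in> Bij (verts T)" "q \<in> Bij (arcs T)"
      unfolding p_def q_def by (auto intro: restrict_inv_into_Bij)
    have pg: "p (fst g v) = v" if "v \<in> verts T" for v
      using gB(1) that Bij_apply[OF gB(1) that] by (auto simp: p_def Bij_def bij_betw_def)
    have qg: "q (snd g e) = e" if "e \<in> arcs T" for e
      using gB(2) that Bij_apply[OF gB(2) that] by (auto simp: q_def Bij_def bij_betw_def)
    have "(p, q) \<in> carrier ?G"
      unfolding AutG_carrier
    proof (intro conjI ballI; simp add: B)
      fix e assume "e \<in> arcs T"
      then obtain a where a: "a \<in> arcs T" "e = snd g a"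
        using gB(2) by (auto simp: Bij_def bij_betw_def)
      show "tail T (q e) = p (tail T e)" "head T (q e) = p (head T e)"
        using g a by (auto simp: AutG_carrier qg pg)
      have "snd g (bar a) = bar (snd g a)" using g a by (auto simp: AutG_carrier)
      then show "q (bar e) = bar (q e)"
        using a qg[of "bar a"] qg[of a] by simp
    qed
    moreover have "(p, q) \<otimes>\<^bsub>?G\<^esub> g = \<one>\<^bsub>?G\<^esub>"
      unfolding AutG_mult[OF calculation g] AutG_one
      by (auto simp: compose_def restrict_def fun_eq_iff pg qg)
    ultimately show ?thesis by blast
  qed
qed

locale automorphisms = bidirected_digraph T bar for T :: "('v, 'e) pre_digraph" and bar
begin

sublocale group "AutG T bar" by (rule group_AutG) unfold_locales

lemma vert_closed [simp]: "g \<in> carrier (AutG T bar) \<Longrightarrow> v \<in> verts T \<Longrightarrow> fst g v \<in> verts T"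
  by (simp add: AutG_carrier Bij_apply)

lemma arc_closed [simp]: "g \<in> carrier (AutG T bar) \<Longrightarrow> e \<in> arcs T \<Longrightarrow> snd g e \<in> arcs T"
  by (simp add: AutG_carrier Bij_apply)

lemma aut_arc [simp]:
  assumes "g \<in> carrier (AutG T bar)" "e \<in> arcs T"
  shows "tail T (snd g e) = fst g (tail T e)" "head T (snd g e) = fst g (head T e)"
    "snd g (bar e) = bar (snd g e)"
  using assms by (auto simp: AutG_carrier)

lemma fst_mult [simp]:
  "g \<in> carrier (AutG T bar) \<Longrightarrow> h \<in> carrier (AutG T bar) \<Longrightarrow> v \<in> verts T \<Longrightarrow>
     fst (g \<otimes>\<^bsub>AutG T bar\<^esub> h) v = fst g (fst h v)"
  by (simp add: AutG_mult compose_eq)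

lemma snd_mult [simp]:
  "g \<in> carrier (AutG T bar) \<Longrightarrow> h \<in> carrier (AutG T bar) \<Longrightarrow> e \<in> arcs T \<Longrightarrow>
     snd (g \<otimes>\<^bsub>AutG T bar\<^esub> h) e = snd g (snd h e)"
  by (simp add: AutG_mult compose_eq)

lemma fst_one [simp]: "v \<in> verts T \<Longrightarrow> fst \<one>\<^bsub>AutG T bar\<^esub> v = v"
  and snd_one [simp]: "e \<in> arcs T \<Longrightarrow> snd \<one>\<^bsub>AutG T bar\<^esub> e = e"
  by (simp_all add: AutG_one)

lemma fst_inv [simp]:
  assumes "g \<in> carrier (AutG T bar)" "v \<in> verts T"
  shows "fst (inv\<^bsub>AutG T bar\<^esub> g) (fst g v) = v" "fst g (fst (inv\<^bsub>AutG T bar\<^esub> g) v) = v"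
  using assms fst_mult[of "inv\<^bsub>AutG T bar\<^esub> g" g v] fst_mult[of g "inv\<^bsub>AutG T bar\<^esub> g" v] by auto

lemma snd_inv [simp]:
  assumes "g \<in> carrier (AutG T bar)" "e \<in> arcs T"
  shows "snd (inv\<^bsub>AutG T bar\<^esub> g) (snd g e) = e" "snd g (snd (inv\<^bsub>AutG T bar\<^esub> g) e) = e"
  using assms snd_mult[of "inv\<^bsub>AutG T bar\<^esub> g" g e] snd_mult[of g "inv\<^bsub>AutG T bar\<^esub> g" e] by auto

lemma aut_inj [simp]:
  assumes "g \<in> carrier (AutG T bar)"
  shows "u \<in> verts T \<Longrightarrow> v \<in> verts T \<Longrightarrow> fst g u = fst g v \<longleftrightarrow> u = v"
    and "a \<in> arcs T \<Longrightarrow> e \<in> arcs T \<Longrightarrow> snd g a = snd g e \<longleftrightarrow> a = e"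
  using assms by (metis fst_inv(1), metis snd_inv(1))

lemma aut_eqI:
  assumes "g \<in> carrier (AutG T bar)" "h \<in> carrier (AutG T bar)"
    and "\<And>v. v \<in> verts T \<Longrightarrow> fst g v = fst h v" "\<And>e. e \<in> arcs T \<Longrightarrow> snd g e = snd h e"
  shows "g = h"
  using assms unfolding AutG_carrier
  by (intro prod_eqI) (auto intro: extensionalityI dest: Bij_imp_extensional)

end

section \<open>Combinatorial consequences of a free and cocompact action\<close>

text \<open>
  This turns boundedness of continuous functions on a compact quotient into finiteness of the
  set of orbits.
\<close>

lemma finite_if_nat_functions_bounded:
  assumes "\<And>N :: 'a \<Rightarrow> nat. \<exists>b :: real. \<forall>x \<in> S. real (N x) \<le> b"
  shows "finite S"
proof (rule ccontr)
  assume "infinite S"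
  then obtain f :: "nat \<Rightarrow> 'a" where f: "inj f" "range f \<subseteq> S"
    using infinite_countable_subset by blast
  obtain b where b: "\<And>x. x \<in> S \<Longrightarrow> real (inv_into UNIV f x) \<le> b"
    using assms[of "inv_into UNIV f"] by blast
  obtain n :: nat where "b < real n" using reals_Archimedean2 by blast
  moreover have "real n \<le> b" using b[of "f n"] f by auto
  ultimately show False by simp
qed

lemma equivclp_hom:
  assumes "\<And>x y. r x y \<Longrightarrow> s (f x) (f y)" and "equivclp r x y"
  shows "equivclp s (f x) (f y)"
  using assms(2)
  by (induction rule: equivclp_induct) (auto intro: equivclp_trans assms(1) equivclp_sym)

context automorphisms
begin

abbreviation cell_map :: "('v, 'e) aut \<Rightarrow> ('v + 'e) \<times> real \<Rightarrow> ('v + 'e) \<times> real"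
  where "cell_map g \<equiv> map_prod (map_sum (fst g) (snd g)) id"

lemma glue_in_cell_space:
  "glue T bar x y \<Longrightarrow> x \<in> topspace (cell_space T) \<and> y \<in> topspace (cell_space T)"
  by (erule glue.cases) (auto simp: topspace_cell_space)

lemma cell_class_in_cell_space:
  assumes "x \<in> topspace (cell_space T)"
  shows "cell_class T bar x \<subseteq> topspace (cell_space T)"
proof
  fix y assume "y \<in> cell_class T bar x"
  then have "equivclp (glue T bar) x y" by (simp add: cell_class_def)
  then show "y \<in> topspace (cell_space T)"
    by (induction rule: equivclp_induct) (use assms glue_in_cell_space in blast)+
qed

lemma glue_cell_map:
  assumes "g \<in> carrier (AutG T bar)" "glue T bar x y"
  shows "glue T bar (cell_map g x) (cell_map g y)"
  using assms(2)
proof cases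
  case (glue_tail e)
  then show ?thesis using glue.glue_tail[of "snd g e" T bar] assms(1) by simp
next
  case (glue_head e)
  then show ?thesis using glue.glue_head[of "snd g e" T bar] assms(1) by simp
next
  case (glue_bar e t)
  then show ?thesis using glue.glue_bar[of "snd g e" T t bar] assms(1) by simp
qed

lemma cell_map_in_cell_space:
  "g \<in> carrier (AutG T bar) \<Longrightarrow> x \<in> topspace (cell_space T) \<Longrightarrow> cell_map g x \<in> topspace (cell_space T)"
  by (auto simp: topspace_cell_space)

lemma cell_map_inv:
  assumes "g \<in> carrier (AutG T bar)" "x \<in> topspace (cell_space T)"
  shows "cell_map (inv\<^bsub>AutG T bar\<^esub> g) (cell_map g x) = x" "cell_map g (cell_map (inv\<^bsub>AutG T bar\<^esub> g) x) = x"
  using assms by (auto simp: topspace_cell_space)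

text \<open>
  Automorphisms respect the gluing, so the image of a class is contained in a class. That it is
  the whole class follows by applying this to the inverse automorphism.
\<close>

lemma act_cell_class:
  assumes g: "g \<in> carrier (AutG T bar)" and x: "x \<in> topspace (cell_space T)"
  shows "act g (cell_class T bar x) = cell_class T bar (cell_map g x)"
proof -
  have hom: "cell_map h y \<in> cell_class T bar (cell_map h x)"
    if "h \<in> carrier (AutG T bar)" "y \<in> cell_class T bar x" for h x y
    using that equivclp_hom[of "glue T bar" "glue T bar" "cell_map h" x y] glue_cell_map
    by (auto simp: cell_class_def)
  show ?thesis
    unfolding act_def
  proof (intro equalityI subsetI)
    fix z assume z: "z \<in> cell_class T bar (cell_map g x)"
    have "z \<in> topspace (cell_space T)"
      using z cell_class_in_cell_space cell_map_in_cell_space g x by blast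
    then have "z = cell_map g (cell_map (inv\<^bsub>AutG T bar\<^esub> g) z)"
      using cell_map_inv(2)[OF g] by simp
    moreover have "cell_map (inv\<^bsub>AutG T bar\<^esub> g) z \<in> cell_class T bar x"
      using hom[of "inv\<^bsub>AutG T bar\<^esub> g" z "cell_map g x"] z g cell_map_inv(1)[OF g x] by simp
    ultimately show "z \<in> cell_map g ` cell_class T bar x" by (rule image_eqI)
  next
    fix z assume "z \<in> cell_map g ` cell_class T bar x"
    then show "z \<in> cell_class T bar (cell_map g x)" using hom[OF g] by (elim imageE) simp
  qed
qed

lemma free_on_vertices:
  assumes "\<Gamma> \<subseteq> carrier (AutG T bar)" "acts_freely T bar \<Gamma>"
    and "\<gamma> \<in> \<Gamma>" "v \<in> verts T" "fst \<gamma> v = v"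
  shows "\<gamma> = \<one>\<^bsub>AutG T bar\<^esub>"
proof -
  let ?x = "cell_class T bar (Inl v, 0)"
  have v: "(Inl v, 0) \<in> topspace (cell_space T)"
    using assms by (auto simp: topspace_cell_space)
  then have "act \<gamma> ?x = ?x"
    using assms by (subst act_cell_class) auto
  then have "\<gamma> \<in> stabilizer (AutG T bar\<lparr>carrier := \<Gamma>\<rparr>) act ?x"
    using assms by (simp add: stabilizer_def)
  then show ?thesis
    using assms v unfolding acts_freely_def topspace_realisation by blast
qed

text \<open>
  Any function \<open>N\<close> from the set of orbits to the natural numbers extends to a continuous
  function on the quotient that takes a value proportional to \<open>N\<close> at some point of each arc, so
  \<open>N\<close> is bounded by compactness.
\<close>

lemma finite_arc_orbits:
  assumes \<Gamma>: "subgroup \<Gamma> (AutG T bar)" and cc: "acts_cocompactly T bar \<Gamma>"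
  shows "finite ((\<lambda>e. (\<lambda>\<gamma>. snd \<gamma> e) ` \<Gamma>) ` arcs T)"
proof (rule finite_if_nat_functions_bounded)
  fix N :: "'e set \<Rightarrow> nat"
  interpret \<Gamma>: subgroup \<Gamma> "AutG T bar" by fact
  define o_arc where "o_arc e = (\<lambda>\<gamma>. snd \<gamma> e) ` \<Gamma>" for e
  have o_arc: "o_arc (snd \<gamma> e) = o_arc e" if "\<gamma> \<in> \<Gamma>" "e \<in> arcs T" for \<gamma> e
  proof -
    have "snd \<delta> (snd \<gamma> e) \<in> o_arc e" if "\<delta> \<in> \<Gamma>" for \<delta>
      unfolding o_arc_def using that \<open>\<gamma> \<in> \<Gamma>\<close> \<open>e \<in> arcs T\<close> 
      by (intro image_eqI[of _ _ "\<delta> \<otimes>\<^bsub>AutG T bar\<^esub> \<gamma>"]) auto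
    moreover have "snd \<delta> e \<in> o_arc (snd \<gamma> e)" if "\<delta> \<in> \<Gamma>" for \<delta>
      unfolding o_arc_def using that \<open>\<gamma> \<in> \<Gamma>\<close> \<open>e \<in> arcs T\<close> 
      by (intro image_eqI[of _ _ "\<delta> \<otimes>\<^bsub>AutG T bar\<^esub> inv\<^bsub>AutG T bar\<^esub> \<gamma>"]) auto
    ultimately show ?thesis unfolding o_arc_def by blast
  qed
  \<comment> \<open>A bump on the second half of an arc, so that the bumps of an arc and of its inverse
    do not overlap and can carry independent heights.\<close>
  define b :: "real \<Rightarrow> real" where "b t = max 0 ((t - 1/2) * (1 - t))" for t
  have b: "b 0 = 0" "b 1 = 0" "b (3/4) = 1/16" "b (1/4) = 0"
    by (auto simp: b_def)
  define F :: "('v + 'e) \<times> real \<Rightarrow> real" where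
    "F x = (case fst x of Inl _ \<Rightarrow> 0
       | Inr e \<Rightarrow> N (o_arc e) * b (snd x) + N (o_arc (bar e)) * b (1 - snd x))" for x
  obtain f where f: "continuous_map (realisation T bar) euclideanreal f"
    and fF: "\<And>x. f (cell_class T bar x) = F x"
  proof (rule realisation_map[of T F euclideanreal bar])
    show "F x = F y" if "glue T bar x y" for x y
      using that by cases (auto simp: F_def b)
    show "continuous_map (top_of_set {0..1}) euclideanreal (\<lambda>t. F (Inr e, t))" for e
      by (auto simp: F_def b_def intro!: continuous_intros)
  qed (auto simp: F_def)
  have f_act: "f (act \<gamma> c) = f c" if \<gamma>: "\<gamma> \<in> \<Gamma>" and c: "c \<in> topspace (realisation T bar)" for \<gamma> c
  proof -
    obtain x where x: "x \<in> topspace (cell_space T)" "c = cell_class T bar x"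
      using c unfolding topspace_realisation by blast
    have "F (cell_map \<gamma> x) = F x"
      using x(1) \<gamma> by (auto simp: topspace_cell_space F_def o_arc simp flip: aut_arc)
    then show ?thesis
      using x \<gamma> by (simp add: act_cell_class fF)
  qed
  let ?orb = "Group_Action.orbit (AutG T bar\<lparr>carrier := \<Gamma>\<rparr>) act"
  let ?Q = "quotient_topology (realisation T bar) ?orb"
  define h where "h C = f (SOME c. c \<in> C)" for C
  have orb: "?orb c = (\<lambda>\<gamma>. act \<gamma> c) ` \<Gamma>" for c
  proof -
    have "carrier (AutG T bar\<lparr>carrier := \<Gamma>\<rparr>) = \<Gamma>" by simp
    then show ?thesis unfolding Group_Action.orbit_def by (simp only: Setcompr_eq_image)
  qed
  have h: "h (?orb c) = f c" if c: "c \<in> topspace (realisation T bar)" for c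
  proof -
    have "act \<one>\<^bsub>AutG T bar\<^esub> c \<in> ?orb c"
      unfolding orb by (rule imageI) (rule \<Gamma>.one_closed)
    then have "(SOME d. d \<in> ?orb c) \<in> ?orb c" by (rule someI)
    then obtain \<gamma> where "\<gamma> \<in> \<Gamma>" "(SOME d. d \<in> ?orb c) = act \<gamma> c"
      unfolding orb by (elim imageE)
    then show ?thesis
      unfolding h_def using f_act[OF _ c] by simp
  qed
  have "continuous_map (realisation T bar) euclideanreal (h \<circ> ?orb)"
    using f by (rule continuous_map_eq) (simp add: h)
  then have "continuous_map ?Q euclideanreal h"
    by (rule continuous_compose_quotient_map[OF quotient_map_quotient_topology])
  then have "compactin euclideanreal (h ` topspace ?Q)"
    using cc image_compactin unfolding acts_cocompactly_def compact_space_def by blast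
  then have "bounded (h ` topspace ?Q)"
    using compact_imp_bounded by auto
  then obtain B where B: "\<And>c. c \<in> topspace ?Q \<Longrightarrow> \<bar>h c\<bar> \<le> B"
    by (auto simp: bounded_iff)
  have "real (N (o_arc e)) \<le> 16 * B" if e: "e \<in> arcs T" for e
  proof -
    have c: "cell_class T bar (Inr e, 3/4) \<in> topspace (realisation T bar)"
      unfolding topspace_realisation using e
      by (intro imageI) (simp add: topspace_cell_space, intro exI[of _ "3/4"], simp)
    then have "\<bar>f (cell_class T bar (Inr e, 3/4))\<bar> \<le> B"
      using B[of "?orb (cell_class T bar (Inr e, 3/4))"] h[OF c] by simp
    then show ?thesis by (simp add: fF F_def b)
  qed
  then show "\<exists>B :: real. \<forall>Y \<in> (\<lambda>e. (\<lambda>\<gamma>. snd \<gamma> e) ` \<Gamma>) ` arcs T. real (N Y) \<le> B"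
    unfolding o_arc_def by blast
qed

end

section \<open>Distances in trees\<close>

text \<open>
  A combinatorial description of trees: a connected graph in which every walk between the ends
  of an arc uses the arc or its inverse.
\<close>

locale arc_tree = automorphisms T bar for T :: "('v, 'e) pre_digraph" and bar +
  assumes nonempty: "verts T \<noteq> {}"
    and connected: "u \<in> verts T \<Longrightarrow> v \<in> verts T \<Longrightarrow> \<exists>p. awalk u p v"
    and bridge: "e \<in> arcs T \<Longrightarrow> awalk (head T e) p (tail T e) \<Longrightarrow> e \<in> set p \<or> bar e \<in> set p"
begin

definition tree_dist :: "'v \<Rightarrow> 'v \<Rightarrow> nat" where
  "tree_dist u v = (LEAST n. \<exists>p. awalk u p v \<and> length p = n)"

lemma geodesic:
  assumes "u \<in> verts T" "v \<in> verts T"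
  obtains p where "awalk u p v" "length p = tree_dist u v"
  using LeastI_ex[of "\<lambda>n. \<exists>p. awalk u p v \<and> length p = n"] connected[OF assms]
  unfolding tree_dist_def by blast

lemma tree_dist_le: "awalk u p v \<Longrightarrow> tree_dist u v \<le> length p"
  unfolding tree_dist_def by (rule Least_le) blast

lemma tree_dist_self [simp]: "u \<in> verts T \<Longrightarrow> tree_dist u u = 0"
  using tree_dist_le[of u "[]" u] by (simp add: awalk_Nil_iff)

lemma tree_dist_eq_0: "u \<in> verts T \<Longrightarrow> v \<in> verts T \<Longrightarrow> tree_dist u v = 0 \<Longrightarrow> u = v"
  by (metis awalk_Nil_iff geodesic length_0_conv)

lemma tree_dist_head_le: "u \<in> verts T \<Longrightarrow> e \<in> arcs T \<Longrightarrow> tree_dist u (head T e) \<le> Suc (tree_dist u (tail T e))"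
  by (metis arc_implies_awalk awalk_appendI geodesic length_append_singleton tail_in_verts tree_dist_le)

lemma awalk_rev:
  assumes "awalk u p v"
  shows "awalk v (rev (map bar p)) u"
  using assms
proof (induction p arbitrary: u)
  case (Cons e p)
  then have e: "e \<in> arcs T" "tail T e = u" "awalk v (rev (map bar p)) (head T e)"
    by (auto simp: awalk_Cons_iff)
  then show ?case
    using awalk_appendI[OF e(3), of "[bar e]" u] arc_implies_awalk[of "bar e"] by simp
qed (simp add: awalk_Nil_iff)

text \<open>
  Otherwise a shorter walk to one of the ends of the arc would shorten the geodesic.
\<close>

lemma geodesic_arc:
  assumes "awalk u p v" "length p = tree_dist u v" "e \<in> set p"
  shows "tree_dist u (head T e) = Suc (tree_dist u (tail T e))" "tree_dist u (head T e) \<le> tree_dist u v"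
proof -
  obtain p1 p2 where p: "p = p1 @ e # p2" using assms(3) by (auto simp: in_set_conv_decomp)
  then have w: "awalk u p1 (tail T e)" "awalk (head T e) p2 v" "e \<in> arcs T"
    using assms(1) by (auto simp: awalk_Cons_iff)
  then have u: "u \<in> verts T" and v: "v \<in> verts T" using awalk_hd_in_verts awalk_last_in_verts by blast+
  have 1: "tree_dist u (tail T e) \<le> length p1" using w tree_dist_le by blast
  obtain q where q: "awalk u q (head T e)" "length q = tree_dist u (head T e)"
    using geodesic[of u "head T e"] u w by auto
  have "tree_dist u v \<le> length q + length p2"
    using tree_dist_le[OF awalk_appendI[OF q(1) w(2)]] by simp
  then have "Suc (length p1) \<le> tree_dist u (head T e)" using assms(2) p q by simp
  moreover have "tree_dist u (head T e) \<le> Suc (tree_dist u (tail T e))"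
    using tree_dist_head_le u w by blast
  ultimately show "tree_dist u (head T e) = Suc (tree_dist u (tail T e))" using 1 by simp
  have "tree_dist u (head T e) \<le> length (p1 @ [e])"
    using tree_dist_le[OF awalk_appendI[OF w(1) arc_implies_awalk[OF w(3)]]] .
  then show "tree_dist u (head T e) \<le> tree_dist u v" using assms(2) p by simp
qed

text \<open>
  Walking to a root \<open>r\<close> and away from it again uses only arcs that reach no farther from \<open>r\<close>
  than the two end points do. It is this walk that contradicts the bridge property in the two
  lemmas below.
\<close>

lemma walk_via_root:
  assumes "r \<in> verts T" "u \<in> verts T" "v \<in> verts T" 
  obtains p where "awalk u p v"
    "\<And>e. e \<in> set p \<Longrightarrow> (tree_dist r (head T e) = Suc (tree_dist r (tail T e)) \<and> tree_dist r (head T e) \<le> tree_dist r v)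
      \<or> (tree_dist r (tail T e) = Suc (tree_dist r (head T e)) \<and> tree_dist r (tail T e) \<le> tree_dist r u)"
proof -
  obtain p where p: "awalk r p u" "length p = tree_dist r u" using geodesic assms by blast
  obtain q where q: "awalk r q v" "length q = tree_dist r v" using geodesic assms by blast
  show thesis
  proof
    show "awalk u (rev (map bar p) @ q) v"
      using awalk_appendI awalk_rev p q by blast
    fix e assume "e \<in> set (rev (map bar p) @ q)"
    then consider "e \<in> set q" | a where "a \<in> set p" "e = bar a" by auto
    then show "(tree_dist r (head T e) = Suc (tree_dist r (tail T e)) \<and> tree_dist r (head T e) \<le> tree_dist r v)
      \<or> (tree_dist r (tail T e) = Suc (tree_dist r (head T e)) \<and> tree_dist r (tail T e) \<le> tree_dist r u)"
    proof cases
      case 1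
      then show ?thesis using geodesic_arc[OF q] by blast
    next
      case 2
      then have "a \<in> arcs T" using p by auto
      then show ?thesis using geodesic_arc[OF p 2(1)] 2 by simp
    qed
  qed
qed

lemma tree_dist_arc:
  assumes "r \<in> verts T" "e \<in> arcs T"
  shows "tree_dist r (head T e) = Suc (tree_dist r (tail T e)) \<or>
         tree_dist r (tail T e) = Suc (tree_dist r (head T e))"
proof (rule ccontr)
  assume neg: "\<not> ?thesis"
  obtain p where p: "awalk (head T e) p (tail T e)"
    "\<And>a. a \<in> set p \<Longrightarrow>
      (tree_dist r (head T a) = Suc (tree_dist r (tail T a)) \<and> tree_dist r (head T a) \<le> tree_dist r (tail T e))
      \<or> (tree_dist r (tail T a) = Suc (tree_dist r (head T a)) \<and> tree_dist r (tail T a) \<le> tree_dist r (head T e))"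
    by (rule walk_via_root[of r "head T e" "tail T e"]) (use assms in auto)
  have "e \<notin> set p" using p(2)[of e] neg by blast
  moreover have "bar e \<notin> set p" using p(2)[of "bar e"] neg assms by auto
  ultimately show False using bridge assms p by blast
qed

text \<open>
  Two different arcs towards \<open>r\<close> at the same vertex would close up, through \<open>r\<close>, to a walk
  between the ends of one of them that avoids it.
\<close>

lemma parent_arc_unique:
  assumes "r \<in> verts T" "e \<in> arcs T" "a \<in> arcs T" "head T e = head T a"
    and "tree_dist r (head T e) = Suc (tree_dist r (tail T e))"
    and "tree_dist r (head T a) = Suc (tree_dist r (tail T a))"
  shows "e = a"
proof (rule ccontr)
  assume "e \<noteq> a"
  obtain p where p: "awalk (tail T a) p (tail T e)" 
    "\<And>b. b \<in> set p \<Longrightarrow>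
      (tree_dist r (head T b) = Suc (tree_dist r (tail T b)) \<and> tree_dist r (head T b) \<le> tree_dist r (tail T e))
      \<or> (tree_dist r (tail T b) = Suc (tree_dist r (head T b)) \<and> tree_dist r (tail T b) \<le> tree_dist r (tail T a))"
    by (rule walk_via_root[of r "tail T a" "tail T e"]) (use assms in auto)
  have w: "awalk (head T e) (bar a # p) (tail T e)"
    using p(1) assms by (simp add: awalk_Cons_iff)
  have "e \<notin> set p" using p(2)[of e] assms(5) by linarith
  moreover have "bar e \<notin> set p"
    using p(2)[of "bar e"] assms(4-6) head_arev[OF assms(2)] tail_arev[OF assms(2)] by fastforce
  moreover have "bar a \<noteq> e"
  proof
    assume "bar a = e"
    then have "tail T a = head T e" using head_arev[OF assms(3)] by simp
    then show False using assms(4,6) by simp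
  qed
  moreover have "bar a \<noteq> bar e" using \<open>e \<noteq> a\<close> by (simp add: arev_eq_iff)
  ultimately show False using bridge[OF assms(2) w] by auto
qed

lemma parent_arc_exists:
  assumes "r \<in> verts T" "v \<in> verts T" "v \<noteq> r"
  obtains e where "e \<in> arcs T" "head T e = v" "tree_dist r v = Suc (tree_dist r (tail T e))"
proof -
  obtain p where p: "awalk r p v" "length p = tree_dist r v" using geodesic assms by blast
  have "p \<noteq> []" using p(1) assms(3) by (auto simp: awalk_Nil_iff)
  then obtain q e where "p = q @ [e]" by (metis append_butlast_last_id)
  then have "e \<in> set p" "e \<in> arcs T" "head T e = v"
    using p(1) by (auto simp: awalk_Cons_iff awalk_Nil_iff)
  then show thesis using geodesic_arc(1)[OF p, of e] that[of e] by simp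
qed

text \<open>
  Both arcs lead away from their common tail, when this is taken as the root.
\<close>

lemma arc_eqI:
  assumes "e \<in> arcs T" "a \<in> arcs T" "tail T e = tail T a" "head T e = head T a"
  shows "e = a"
proof (rule parent_arc_unique[of "tail T e"])
  have "tree_dist (tail T e) (head T e) = Suc 0"
    using tree_dist_arc[of "tail T e" e] assms by simp
  then show "tree_dist (tail T e) (head T e) = Suc (tree_dist (tail T e) (tail T e))"
    "tree_dist (tail T e) (head T a) = Suc (tree_dist (tail T e) (tail T a))"
    using assms by auto
qed (use assms in auto)

lemma aut_eq_on_arc:
  assumes "g \<in> carrier (AutG T bar)" "h \<in> carrier (AutG T bar)" "e \<in> arcs T"
    "fst g (tail T e) = fst h (tail T e)" "fst g (head T e) = fst h (head T e)"
  shows "snd g e = snd h e"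
  using assms by (intro arc_eqI) auto

lemma aut_eq_on_vertsI:
  assumes "g \<in> carrier (AutG T bar)" "h \<in> carrier (AutG T bar)"
    and "\<And>v. v \<in> verts T \<Longrightarrow> fst g v = fst h v"
  shows "g = h"
  using assms by (intro aut_eqI aut_eq_on_arc) auto

lemma walk_induct [consumes 2, case_names root arc]:
  assumes "r \<in> verts T" "v \<in> verts T" "P r"
    and step: "\<And>e. e \<in> arcs T \<Longrightarrow> P (tail T e) \<Longrightarrow> P (head T e)"
  shows "P v"
proof -
  have "P u \<Longrightarrow> P v" if "awalk u p v" for u p
    using that
  proof (induction p arbitrary: u)
    case (Cons e p)
    then have "e \<in> arcs T" "u = tail T e" "awalk (head T e) p v" by (auto simp: awalk_Cons_iff)
    then show ?case using Cons step by blast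
  qed (simp add: awalk_Nil_iff)
  then show ?thesis using connected assms by blast
qed

section \<open>Flat sections over a tree\<close>

lemma flat_section_unique:
  assumes det: "\<And>e s t t'. e \<in> arcs T \<Longrightarrow> s \<in> F (tail T e) \<Longrightarrow> t \<in> F (head T e) \<Longrightarrow> t' \<in> F (head T e) \<Longrightarrow>
      link e s t \<Longrightarrow> link e s t' \<Longrightarrow> t = t'"
    and "\<And>v. v \<in> verts T \<Longrightarrow> \<sigma> v \<in> F v" "\<And>e. e \<in> arcs T \<Longrightarrow> link e (\<sigma> (tail T e)) (\<sigma> (head T e))"
    and "\<And>v. v \<in> verts T \<Longrightarrow> \<tau> v \<in> F v" "\<And>e. e \<in> arcs T \<Longrightarrow> link e (\<tau> (tail T e)) (\<tau> (head T e))"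
    and "r \<in> verts T" "\<sigma> r = \<tau> r" "v \<in> verts T"
  shows "\<sigma> v = \<tau> v"
  using assms(6,8)
proof (induction rule: walk_induct)
  case root
  show ?case by fact
next
  case (arc e)
  then show ?case
    using det[of e "\<sigma> (tail T e)" "\<sigma> (head T e)" "\<tau> (head T e)"] assms(2,4) assms(3,5)[of e]
    by simp
qed

text \<open>
  A relation \<open>link e\<close> between the fibres over the ends of each arc is followed outwards from
  the root, by recursion on the distance; since every vertex other than the root has just one
  arc towards the root, no compatibility condition arises.
\<close>

lemma flat_section_exists:
  assumes transport: "\<And>e s. e \<in> arcs T \<Longrightarrow> s \<in> F (tail T e) \<Longrightarrow> \<exists>t \<in> F (head T e). link e s t"
    and sym: "\<And>e s t. e \<in> arcs T \<Longrightarrow> link e s t \<Longrightarrow> link (bar e) t s"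
    and r: "r \<in> verts T" and s: "s \<in> F r"
  obtains \<sigma> where "\<sigma> r = s" "\<And>v. v \<in> verts T \<Longrightarrow> \<sigma> v \<in> F v"
    "\<And>e. e \<in> arcs T \<Longrightarrow> link e (\<sigma> (tail T e)) (\<sigma> (head T e))"
proof -
  \<comment> \<open>The unique arc that leads from the direction of the root to \<open>v\<close>.\<close>
  define par where "par v = (SOME e. e \<in> arcs T \<and> head T e = v \<and> tree_dist r v = Suc (tree_dist r (tail T e)))" for v
  have par: "par v \<in> arcs T \<and> head T (par v) = v \<and> tree_dist r v = Suc (tree_dist r (tail T (par v)))"
    if "v \<in> verts T" "v \<noteq> r" for v
    unfolding par_def by (rule someI_ex) (metis parent_arc_exists r that)
  define \<tau> where "\<tau> = rec_nat (\<lambda>v. s) (\<lambda>n rec v. SOME t. t \<in> F v \<and> link (par v) (rec (tail T (par v))) t)"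
  define \<sigma> where "\<sigma> v = \<tau> (tree_dist r v) v" for v
  have \<sigma>_r: "\<sigma> r = s" using r by (simp add: \<sigma>_def \<tau>_def)
  have \<sigma>_par: "\<sigma> v = (SOME t. t \<in> F v \<and> link (par v) (\<sigma> (tail T (par v))) t)"
    if "v \<in> verts T" "v \<noteq> r" for v
    using par[OF that] by (simp add: \<sigma>_def \<tau>_def)
  have \<sigma>_F: "\<sigma> v \<in> F v \<and> (v \<noteq> r \<longrightarrow> link (par v) (\<sigma> (tail T (par v))) (\<sigma> v))" if "v \<in> verts T" for v
    using that
  proof (induction "tree_dist r v" arbitrary: v rule: less_induct)
    case less
    show ?case
    proof (cases "v = r")
      case False
      have "\<sigma> (tail T (par v)) \<in> F (tail T (par v))"
        using less par False by force
      then have "\<exists>t. t \<in> F v \<and> link (par v) (\<sigma> (tail T (par v))) t"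
        using transport[of "par v"] par[OF less.prems False] by auto
      then show ?thesis
        unfolding \<sigma>_par[OF less.prems False] by (rule someI2_ex) simp
    qed (use s \<sigma>_r in simp)
  qed
  have up: "link e (\<sigma> (tail T e)) (\<sigma> (head T e))"
    if e: "e \<in> arcs T" "tree_dist r (head T e) = Suc (tree_dist r (tail T e))" for e
  proof -
    have ne: "head T e \<noteq> r" using e r by auto
    have "e = par (head T e)"
      using parent_arc_unique[OF r e(1), of "par (head T e)"] par[of "head T e"] e ne by auto
    then show ?thesis using \<sigma>_F[of "head T e"] ne e by auto
  qed
  show thesis
  proof
    fix e assume e: "e \<in> arcs T"
    show "link e (\<sigma> (tail T e)) (\<sigma> (head T e))"
      using tree_dist_arc[OF r e] up[OF e] up[of "bar e"] sym[of "bar e"] e by auto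
  qed (use \<sigma>_r \<sigma>_F in auto)
qed

section \<open>Locally bijective maps of a tree\<close>

text \<open>
  Away from the root, a geodesic never turns back. As the map is injective on stars, neither
  does its image, and a path in a tree that does not turn back is a geodesic.
\<close>

lemma local_iso_preserves_dist:
  assumes verts: "\<And>v. v \<in> verts T \<Longrightarrow> p v \<in> verts T" and arcs: "\<And>e. e \<in> arcs T \<Longrightarrow> q e \<in> arcs T"
    and hom: "\<And>e. e \<in> arcs T \<Longrightarrow> tail T (q e) = p (tail T e) \<and> head T (q e) = p (head T e) \<and> q (bar e) = bar (q e)"
    and inj: "\<And>e a. e \<in> arcs T \<Longrightarrow> a \<in> arcs T \<Longrightarrow> tail T e = tail T a \<Longrightarrow> q e = q a \<Longrightarrow> e = a"
    and "r \<in> verts T" "v \<in> verts T"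
  shows "tree_dist (p r) (p v) = tree_dist r v"
  using assms(6)
proof (induction "tree_dist r v" arbitrary: v rule: less_induct)
  case less
  show ?case
  proof (cases "v = r")
    case True
    then show ?thesis using assms(5) verts by simp
  next
    case False
    obtain e where e: "e \<in> arcs T" "head T e = v" "tree_dist r v = Suc (tree_dist r (tail T e))"
      using parent_arc_exists assms(5) less.prems False by blast
    have IH: "tree_dist (p r) (p (tail T e)) = tree_dist r (tail T e)"
      using less.hyps[of "tail T e"] e(1,3) by simp
    have dist_e: "tree_dist (p r) (p v) = Suc (tree_dist (p r) (p (tail T e))) \<or>
        tree_dist (p r) (p (tail T e)) = Suc (tree_dist (p r) (p v))"
      using tree_dist_arc[OF verts[OF assms(5)] arcs[OF e(1)]] hom[OF e(1)] e(2) by simp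
    show ?thesis
    proof (cases "tail T e = r")
      case True
      have "tree_dist (p r) (p v) = Suc 0"
        using dist_e True verts[OF assms(5)] by simp
      then show ?thesis using e(3) True assms(5) by simp
    next
      case ne: False
      obtain a where a: "a \<in> arcs T" "head T a = tail T e" "tree_dist r (tail T e) = Suc (tree_dist r (tail T a))"
        using parent_arc_exists[OF assms(5) tail_in_verts[OF e(1)] ne] by metis
      have IHa: "tree_dist (p r) (p (tail T a)) = tree_dist r (tail T a)"
      proof (rule less.hyps)
        show "tree_dist r (tail T a) < tree_dist r v" using e(3) a(3) by linarith
      qed (use a(1) in simp)
      have "tree_dist (p r) (p v) = Suc (tree_dist (p r) (p (tail T e)))"
      proof (rule ccontr)
        assume "\<not> ?thesis"
        then have down: "tree_dist (p r) (p (tail T e)) = Suc (tree_dist (p r) (p v))"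
          using e(1) dist_e by blast
        have "q (bar e) = q a"
        proof (rule parent_arc_unique[OF verts[OF assms(5)]])
          show "head T (q (bar e)) = head T (q a)"
            using hom[of "bar e"] hom[OF a(1)] e(1) a(2) by simp
          show "tree_dist (p r) (head T (q (bar e))) = Suc (tree_dist (p r) (tail T (q (bar e))))"
            using hom[of "bar e"] e(1,2) down by simp
          show "tree_dist (p r) (head T (q a)) = Suc (tree_dist (p r) (tail T (q a)))"
            using hom[OF a(1)] a(2) IH IHa a(3) by presburger
        qed (use arcs e(1) a(1) in auto)
        then have "q e = q (bar a)" using hom e(1) a(1) by (metis arev_arev)
        then have "e = bar a" using inj[OF e(1) arev_in_arcs[OF a(1)]] a(1,2) by simp
        then have "v = tail T a" using e(2) a(1) by simp
        then have "tree_dist r v = tree_dist r (tail T a)" by simp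
        then show False using e(3) a(3) by linarith
      qed
      then show ?thesis using IH e(3) by linarith
    qed
  qed
qed

text \<open>
  Injectivity on vertices holds because distances are preserved; surjectivity because the image
  is nonempty and closed under passing to neighbours.
\<close>

lemma local_iso_in_AutG:
  assumes verts: "\<And>v. v \<in> verts T \<Longrightarrow> p v \<in> verts T" and arcs: "\<And>e. e \<in> arcs T \<Longrightarrow> q e \<in> arcs T"
    and hom: "\<And>e. e \<in> arcs T \<Longrightarrow> tail T (q e) = p (tail T e) \<and> head T (q e) = p (head T e) \<and> q (bar e) = bar (q e)"
    and inj: "\<And>e a. e \<in> arcs T \<Longrightarrow> a \<in> arcs T \<Longrightarrow> tail T e = tail T a \<Longrightarrow> q e = q a \<Longrightarrow> e = a"
    and surj: "\<And>v a. v \<in> verts T \<Longrightarrow> a \<in> arcs T \<Longrightarrow> tail T a = p v \<Longrightarrow> \<exists>e \<in> arcs T. tail T e = v \<and> q e = a"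
  shows "(restrict p (verts T), restrict q (arcs T)) \<in> carrier (AutG T bar)"
proof -
  have p_inj: "u = v" if "u \<in> verts T" "v \<in> verts T" "p u = p v" for u v
  proof (rule tree_dist_eq_0[OF that(1,2)])
    have "tree_dist (p u) (p v) = tree_dist u v"
      by (rule local_iso_preserves_dist[where p = p and q = q]; (fact verts arcs hom inj that)?)
    then show "tree_dist u v = 0" using that(3) verts[OF that(2)] by simp
  qed
  obtain r where r: "r \<in> verts T" using nonempty by blast
  have p_surj: "w \<in> p ` verts T" if "w \<in> verts T" for w
    using verts[OF r] that
  proof (induction rule: walk_induct)
    case (arc a)
    then obtain v where "v \<in> verts T" "tail T a = p v" by auto
    then obtain e where "e \<in> arcs T" "q e = a" using surj arc by blast
    then show ?case using hom by force
  qed (use r in blast)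
  have bij_p: "bij_betw p (verts T) (verts T)"
    unfolding bij_betw_def inj_on_def using p_inj p_surj verts by blast
  have q_inj: "e = a" if "e \<in> arcs T" "a \<in> arcs T" "q e = q a" for e a
  proof (rule inj[OF that(1,2) _ that(3)])
    have "p (tail T e) = p (tail T a)" using hom that by metis
    then show "tail T e = tail T a" using p_inj that by simp
  qed
  have q_surj: "a \<in> q ` arcs T" if a: "a \<in> arcs T" for a
  proof -
    obtain v where "v \<in> verts T" "tail T a = p v" using p_surj[of "tail T a"] a by auto
    then show ?thesis using surj a by blast
  qed
  have bij_q: "bij_betw q (arcs T) (arcs T)"
    unfolding bij_betw_def inj_on_def using q_inj q_surj arcs by blast
  show ?thesis
    unfolding AutG_carrier Bij_def using bij_p bij_q hom by (simp add: bij_betw_restrict_eq)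
qed

lemma awalk_aut:
  assumes "g \<in> carrier (AutG T bar)" "awalk u p v"
  shows "awalk (fst g u) (map (snd g) p) (fst g v)"
  using assms(2)
proof (induction p arbitrary: u)
  case (Cons e p)
  then have "e \<in> arcs T" "u = tail T e" "awalk (head T e) p v" by (auto simp: awalk_Cons_iff)
  then show ?case using Cons.IH[of "head T e"] assms(1) by (simp add: awalk_Cons_iff)
qed (use assms(1) in \<open>auto simp: awalk_Nil_iff\<close>)

lemma ball_verts_subset: "ball_verts T n v \<subseteq> verts T"
  unfolding ball_verts_def using awalk_last_in_verts by blast

lemma ball_verts_mono: "m \<le> n \<Longrightarrow> ball_verts T m v \<subseteq> ball_verts T n v"
  unfolding ball_verts_def by (intro Collect_mono) (metis le_trans)

lemma center_in_ball: "v \<in> verts T \<Longrightarrow> v \<in> ball_verts T n v"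
  unfolding ball_verts_def by (auto intro!: exI[of _ "[]"] simp: awalk_Nil_iff)

lemma ends_in_ball:
  assumes "e \<in> arcs T"
  shows "head T e \<in> ball_verts T (Suc n) (tail T e)" "tail T e \<in> ball_verts T (Suc n) (head T e)"
proof -
  show "head T e \<in> ball_verts T (Suc n) (tail T e)"
    using arc_implies_awalk[OF assms] unfolding ball_verts_def by (auto intro!: exI[of _ "[e]"])
  show "tail T e \<in> ball_verts T (Suc n) (head T e)"
    using arc_implies_awalk[of "bar e"] assms unfolding ball_verts_def by (auto intro!: exI[of _ "[bar e]"])
qed

lemma ball_aut:
  assumes g: "g \<in> carrier (AutG T bar)" and v: "v \<in> verts T"
  shows "ball_verts T n (fst g v) = fst g ` ball_verts T n v"
proof -
  have sub: "fst h ` ball_verts T n w \<subseteq> ball_verts T n (fst h w)"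
    if "h \<in> carrier (AutG T bar)" for h w
  proof (rule image_subsetI)
    fix u assume "u \<in> ball_verts T n w"
    then obtain p where "awalk w p u" "length p \<le> n" unfolding ball_verts_def by blast
    then show "fst h u \<in> ball_verts T n (fst h w)"
      unfolding ball_verts_def using awalk_aut[OF that, of w p u]
      by (intro CollectI exI[of _ "map (snd h) p"]) simp
  qed
  show ?thesis
  proof (rule antisym[OF _ sub[OF g]])
    let ?k = "inv\<^bsub>AutG T bar\<^esub> g"
    show "ball_verts T n (fst g v) \<subseteq> fst g ` ball_verts T n v"
    proof
      fix u assume u: "u \<in> ball_verts T n (fst g v)"
      then have "fst ?k u \<in> ball_verts T n v"
        using sub[of ?k "fst g v"] g v by auto
      moreover have "u = fst g (fst ?k u)" using u ball_verts_subset g by (metis fst_inv(2) subsetD)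
      ultimately show "u \<in> fst g ` ball_verts T n v" by blast
    qed
  qed
qed

lemma finite_ball:
  assumes "\<And>v. finite {e \<in> arcs T. tail T e = v}"
  shows "finite (ball_verts T n v)"
proof (induction n arbitrary: v)
  case 0
  have "ball_verts T 0 v \<subseteq> {v}" unfolding ball_verts_def by (auto simp: awalk_Nil_iff)
  then show ?case using finite_subset by blast
next
  case (Suc n)
  have "ball_verts T (Suc n) v \<subseteq> {v} \<union> (\<Union>e \<in> {e \<in> arcs T. tail T e = v}. ball_verts T n (head T e))"
  proof
    fix u assume "u \<in> ball_verts T (Suc n) v"
    then obtain p where p: "awalk v p u" "length p \<le> Suc n" unfolding ball_verts_def by blast
    show "u \<in> {v} \<union> (\<Union>e \<in> {e \<in> arcs T. tail T e = v}. ball_verts T n (head T e))"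
    proof (cases p)
      case Nil
      then show ?thesis using p by (simp add: awalk_Nil_iff)
    next
      case (Cons e q)
      then have "e \<in> arcs T" "tail T e = v" "awalk (head T e) q u" "length q \<le> n"
        using p by (auto simp: awalk_Cons_iff)
      then show ?thesis unfolding ball_verts_def by blast
    qed
  qed
  then show ?case using Suc assms by (meson finite.emptyI finite.insertI finite_UN_I finite_Un finite_subset)
qed

text \<open>
  Along a walk of length at most the radius that starts at \<open>v\<close>, its end point stays in the
  balls around all vertices of the walk, so the value of \<open>h v\<close> there can be compared step by
  step with that of the automorphism that belongs to the end point itself. The radius must be
  positive for the ends of an arc to lie in the overlap of the balls around them.
\<close>

lemma glue_automorphisms:
  assumes h: "\<And>v. v \<in> verts T \<Longrightarrow> h v \<in> carrier (AutG T bar)"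
    and agree: "\<And>e u. e \<in> arcs T \<Longrightarrow> u \<in> ball_verts T (Suc n) (tail T e) \<Longrightarrow>
      u \<in> ball_verts T (Suc n) (head T e) \<Longrightarrow> fst (h (tail T e)) u = fst (h (head T e)) u"
  obtains g where "g \<in> carrier (AutG T bar)"
    "\<And>v u. v \<in> verts T \<Longrightarrow> u \<in> ball_verts T (Suc n) v \<Longrightarrow> fst g u = fst (h v) u"
proof -
  define p where "p v = fst (h v) v" for v
  define q where "q e = snd (h (tail T e)) e" for e
  have p_head: "fst (h (tail T e)) (head T e) = p (head T e)" if "e \<in> arcs T" for e
    unfolding p_def using agree[of e "head T e"] that ends_in_ball[OF that] center_in_ball[of "head T e"] by simp
  have p: "p v \<in> verts T" if "v \<in> verts T" for v
    using that h by (simp add: p_def)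
  have q: "q e \<in> arcs T" "tail T (q e) = p (tail T e)" "head T (q e) = p (head T e)" if "e \<in> arcs T" for e
    using that h[of "tail T e"] p_head[OF that] by (simp_all add: q_def p_def)
  have q_bar: "q (bar e) = bar (q e)" if "e \<in> arcs T" for e
    by (rule arc_eqI) (use that q[of e] q[of "bar e"] in auto)
  let ?g = "(restrict p (verts T), restrict q (arcs T))"
  have g: "?g \<in> carrier (AutG T bar)"
  proof (rule local_iso_in_AutG)
    fix e a assume "e \<in> arcs T" "a \<in> arcs T" "tail T e = tail T a" "q e = q a"
    then show "e = a" using h[of "tail T a"] by (simp add: q_def)
  next
    fix v a assume v: "v \<in> verts T" "a \<in> arcs T" "tail T a = p v"
    \<comment> \<open>Near \<open>v\<close> the glued map is the automorphism \<open>h v\<close>, which can be inverted.\<close>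
    let ?e = "snd (inv\<^bsub>AutG T bar\<^esub> (h v)) a"
    have "?e \<in> arcs T" "snd (h v) ?e = a" "tail T ?e = v"
      using v h[OF v(1)] by (auto simp: p_def)
    then show "\<exists>e \<in> arcs T. tail T e = v \<and> q e = a" by (auto simp: q_def)
  qed (use p q q_bar in auto)
  have walk: "fst (h v) u = p u" if "awalk v w u" "length w \<le> Suc n" for v w u
    using that
  proof (induction w arbitrary: v)
    case Nil
    then show ?case by (simp add: awalk_Nil_iff p_def)
  next
    case (Cons e w)
    then have e: "e \<in> arcs T" "v = tail T e" "awalk (head T e) w u" by (auto simp: awalk_Cons_iff)
    have "u \<in> ball_verts T (Suc n) (tail T e)" "u \<in> ball_verts T (Suc n) (head T e)"
      using Cons.prems e Suc_leD unfolding ball_verts_def by auto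
    then have "fst (h v) u = fst (h (head T e)) u" using agree e by simp
    then show ?case using Cons.IH[OF e(3)] Cons.prems(2) by simp
  qed
  show thesis
  proof (rule that[OF g])
    fix v u assume "v \<in> verts T" and u: "u \<in> ball_verts T (Suc n) v"
    then have "u \<in> verts T" using ball_verts_subset by blast
    then show "fst ?g u = fst (h v) u" using u walk unfolding ball_verts_def by auto
  qed
qed

end

section \<open>Lattices\<close>

locale free_cocompact = arc_tree T bar for T :: "('v, 'e) pre_digraph" and bar +
  fixes \<Gamma>
  assumes \<Gamma>: "subgroup \<Gamma> (AutG T bar)"
    and free: "\<gamma> \<in> \<Gamma> \<Longrightarrow> v \<in> verts T \<Longrightarrow> fst \<gamma> v = v \<Longrightarrow> \<gamma> = \<one>\<^bsub>AutG T bar\<^esub>"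
    and fin_orbits: "finite ((\<lambda>e. (\<lambda>\<gamma>. snd \<gamma> e) ` \<Gamma>) ` arcs T)"
begin

sublocale \<Gamma>: subgroup \<Gamma> "AutG T bar" by (rule \<Gamma>)

lemma \<Gamma>_carrier [simp]: "g \<in> \<Gamma> \<Longrightarrow> g \<in> carrier (AutG T bar)" by (rule \<Gamma>.mem_carrier)

text \<open>
  Only the trivial element of \<open>\<Gamma>\<close> fixes \<open>v\<close>, so different arcs starting at \<open>v\<close> lie in different
  orbits.
\<close>

lemma finite_out_arcs: "finite {e \<in> arcs T. tail T e = v}"
proof -
  let ?o = "\<lambda>e. (\<lambda>\<gamma>. snd \<gamma> e) ` \<Gamma>"
  have "inj_on ?o {e \<in> arcs T. tail T e = v}"
  proof (rule inj_onI)
    fix e a assume ea: "e \<in> {e \<in> arcs T. tail T e = v}" "a \<in> {e \<in> arcs T. tail T e = v}" "?o e = ?o a"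
    have "snd \<one>\<^bsub>AutG T bar\<^esub> e \<in> ?o e" by (rule imageI) (rule \<Gamma>.one_closed)
    then have "e \<in> ?o a" using ea by simp
    then obtain \<gamma> where \<gamma>: "\<gamma> \<in> \<Gamma>" "e = snd \<gamma> a" by blast
    then have "fst \<gamma> v = v" using ea by auto
    then have "\<gamma> = \<one>\<^bsub>AutG T bar\<^esub>" using free[OF \<gamma>(1), of v] ea(1) by auto
    then show "e = a" using \<gamma> ea by simp
  qed
  moreover have "finite (?o ` {e \<in> arcs T. tail T e = v})"
    by (rule finite_subset[OF _ fin_orbits]) blast
  ultimately show ?thesis using finite_imageD by blast
qed

lemma finite_balls: "finite (ball_verts T n v)"
  using finite_ball finite_out_arcs by blast

text \<open>
  Tails of representatives of the orbits of arcs represent all vertices, unless there are no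
  arcs at all; then there is only one vertex.
\<close>

lemma orbit_reps:
  obtains W where "finite W" "W \<subseteq> verts T" "\<And>v. v \<in> verts T \<Longrightarrow> \<exists>\<gamma> \<in> \<Gamma>. fst \<gamma> v \<in> W"
proof (cases "arcs T = {}")
  case True
  obtain r where r: "r \<in> verts T" using nonempty by blast
  have "v = r" if v: "v \<in> verts T" for v
  proof -
    obtain p where p: "awalk v p r" using connected[OF v r] by blast
    then have "set p = {}" using True unfolding awalk_def by simp
    then have "p = []" by simp
    then show ?thesis using p by (simp add: awalk_Nil_iff)
  qed
  then have "\<exists>\<gamma> \<in> \<Gamma>. fst \<gamma> v \<in> {r}" if "v \<in> verts T" for v
    using \<Gamma>.one_closed r that by (intro bexI[of _ "\<one>\<^bsub>AutG T bar\<^esub>"]) auto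
  then show thesis using that[of "{r}"] r by blast
next
  case False
  let ?o = "\<lambda>e. (\<lambda>\<gamma>. snd \<gamma> e) ` \<Gamma>"
  let ?W = "(\<lambda>Y. tail T (SOME e. e \<in> Y)) ` ?o ` arcs T"
  have rep: "\<exists>\<gamma> \<in> \<Gamma>. (SOME a. a \<in> ?o e) = snd \<gamma> e" for e
  proof -
    have "snd \<one>\<^bsub>AutG T bar\<^esub> e \<in> ?o e" by (rule imageI) (rule \<Gamma>.one_closed)
    then have "(SOME a. a \<in> ?o e) \<in> ?o e" by (rule someI)
    then show ?thesis by blast
  qed
  show thesis
  proof
    show "finite ?W" using fin_orbits by (rule finite_imageI)
    show "?W \<subseteq> verts T"
    proof (intro subsetI, elim imageE)
      fix w Y e assume w: "w = tail T (SOME e. e \<in> Y)" "Y = ?o e" "e \<in> arcs T"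
      obtain \<gamma> where "\<gamma> \<in> \<Gamma>" "(SOME a. a \<in> ?o e) = snd \<gamma> e" using rep by blast
      then show "w \<in> verts T" using w by simp
    qed
    fix v assume v: "v \<in> verts T"
    have "\<exists>e \<in> arcs T. tail T e = v"
    proof -
      obtain a where a: "a \<in> arcs T" using False by blast
      obtain p where p: "awalk v p (tail T a)" using connected[OF v tail_in_verts[OF a]] by blast
      show ?thesis
      proof (cases p)
        case Nil
        then show ?thesis using a p by (auto simp: awalk_Nil_iff)
      next
        case (Cons e q)
        then show ?thesis using p by (auto simp: awalk_Cons_iff)
      qed
    qed
    then obtain e where e: "e \<in> arcs T" "tail T e = v" by blast
    obtain \<gamma> where \<gamma>: "\<gamma> \<in> \<Gamma>" "(SOME a. a \<in> ?o e) = snd \<gamma> e" using rep by blast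
    then have "fst \<gamma> v = tail T (SOME a. a \<in> ?o e)" using e by simp
    then show "\<exists>\<gamma> \<in> \<Gamma>. fst \<gamma> v \<in> ?W" using \<gamma>(1) e(1) by blast
  qed
qed

end

section \<open>Equivariant labellings\<close>

lemma card_image_eq_if_same_kernel:
  assumes "\<And>x y. x \<in> A \<Longrightarrow> y \<in> A \<Longrightarrow> f x = f y \<longleftrightarrow> g x = g y"
  shows "card (f ` A) = card (g ` A)"
proof (rule bij_betw_same_card)
  let ?h = "\<lambda>z. g (inv_into A f z)"
  have h: "?h (f x) = g x" if "x \<in> A" for x
    using assms[of "inv_into A f (f x)" x] that by (simp add: inv_into_into f_inv_into_f)
  show "bij_betw ?h (f ` A) (g ` A)"
    unfolding bij_betw_def inj_on_def using assms h by (auto simp: image_iff)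
qed

lemma finite_image_if_factors:
  assumes "finite (g ` A)" "\<And>x y. x \<in> A \<Longrightarrow> y \<in> A \<Longrightarrow> g x = g y \<Longrightarrow> f x = f y"
  shows "finite (f ` A)"
proof (rule finite_subset)
  have "f x = f (inv_into A g (g x))" if "x \<in> A" for x
    using assms(2)[of "inv_into A g (g x)" x] that by (simp add: inv_into_into f_inv_into_f)
  then show "f ` A \<subseteq> (\<lambda>z. f (inv_into A g z)) ` g ` A" by blast
qed (use assms(1) in simp)

text \<open>
  Choose an arbitrary labelling of the fibre over one representative of each orbit of \<open>P\<close>, and
  move it to the other fibres. As the action on \<open>P\<close> is free, the group element that moves a
  point of \<open>P\<close> to the representative of its orbit is unique, so that this is well defined.
\<close>

lemma equivariant_labelling:
  fixes \<G> :: "('g, 'm) monoid_scheme" and a :: "'g \<Rightarrow> 'x \<Rightarrow> 'x" and b :: "'g \<Rightarrow> 'p \<Rightarrow> 'p"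
  assumes "group \<G>"
    and a: "\<And>g x. g \<in> carrier \<G> \<Longrightarrow> x \<in> X \<Longrightarrow> a g x \<in> X"
      "\<And>x. x \<in> X \<Longrightarrow> a \<one>\<^bsub>\<G>\<^esub> x = x"
      "\<And>g h x. g \<in> carrier \<G> \<Longrightarrow> h \<in> carrier \<G> \<Longrightarrow> x \<in> X \<Longrightarrow> a (g \<otimes>\<^bsub>\<G>\<^esub> h) x = a g (a h x)"
    and b: "\<And>g p. g \<in> carrier \<G> \<Longrightarrow> p \<in> P \<Longrightarrow> b g p \<in> P"
      "\<And>p. p \<in> P \<Longrightarrow> b \<one>\<^bsub>\<G>\<^esub> p = p"
      "\<And>g h p. g \<in> carrier \<G> \<Longrightarrow> h \<in> carrier \<G> \<Longrightarrow> p \<in> P \<Longrightarrow> b (g \<otimes>\<^bsub>\<G>\<^esub> h) p = b g (b h p)"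
    and \<pi>: "\<And>x. x \<in> X \<Longrightarrow> \<pi> x \<in> P" "\<And>g x. g \<in> carrier \<G> \<Longrightarrow> x \<in> X \<Longrightarrow> \<pi> (a g x) = b g (\<pi> x)"
    and free: "\<And>g p. g \<in> carrier \<G> \<Longrightarrow> p \<in> P \<Longrightarrow> b g p = p \<Longrightarrow> g = \<one>\<^bsub>\<G>\<^esub>"
    and fin: "\<And>p. p \<in> P \<Longrightarrow> finite {x \<in> X. \<pi> x = p}"
  obtains \<beta> :: "'x \<Rightarrow> nat" where
    "\<And>g x. g \<in> carrier \<G> \<Longrightarrow> x \<in> X \<Longrightarrow> \<beta> (a g x) = \<beta> x"
    "\<And>p. p \<in> P \<Longrightarrow> bij_betw \<beta> {x \<in> X. \<pi> x = p} {..<card {x \<in> X. \<pi> x = p}}"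
proof -
  interpret group \<G> by fact
  let ?fib = "\<lambda>p. {x \<in> X. \<pi> x = p}"
  define rep where "rep p = (SOME q. q \<in> (\<lambda>g. b g p) ` carrier \<G>)" for p
  define t where "t p = (SOME g. g \<in> carrier \<G> \<and> b g p = rep p)" for p
  define \<beta>0 where "\<beta>0 p = (SOME f. bij_betw f (?fib p) {..<card (?fib p)})" for p
  have orbit: "(\<lambda>h. b h (b g p)) ` carrier \<G> = (\<lambda>h. b h p) ` carrier \<G>"
    if g: "g \<in> carrier \<G>" and p: "p \<in> P" for g p
  proof (intro equalityI image_subsetI)
    fix h assume h: "h \<in> carrier \<G>"
    show "b h (b g p) \<in> (\<lambda>h. b h p) ` carrier \<G>"
      using g h p by (intro image_eqI[of _ _ "h \<otimes>\<^bsub>\<G>\<^esub> g"]) (simp_all add: b)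
    have "h = h \<otimes>\<^bsub>\<G>\<^esub> inv\<^bsub>\<G>\<^esub> g \<otimes>\<^bsub>\<G>\<^esub> g" using g h by (simp add: m_assoc)
    then have "b h p = b (h \<otimes>\<^bsub>\<G>\<^esub> inv\<^bsub>\<G>\<^esub> g) (b g p)"
      using b(3)[of "h \<otimes>\<^bsub>\<G>\<^esub> inv\<^bsub>\<G>\<^esub> g" g p] g h p by simp
    then show "b h p \<in> (\<lambda>h. b h (b g p)) ` carrier \<G>"
      using g h by (intro image_eqI[of _ _ "h \<otimes>\<^bsub>\<G>\<^esub> inv\<^bsub>\<G>\<^esub> g"]) simp_all
  qed
  have rep_eq: "rep (b g p) = rep p" if "g \<in> carrier \<G>" "p \<in> P" for g p
    unfolding rep_def orbit[OF that] ..
  have t: "t p \<in> carrier \<G>" "b (t p) p = rep p" for p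
  proof -
    have "rep p \<in> (\<lambda>g. b g p) ` carrier \<G>"
      unfolding rep_def by (rule someI[of _ "b \<one>\<^bsub>\<G>\<^esub> p"]) simp
    then have "\<exists>g. g \<in> carrier \<G> \<and> b g p = rep p" by auto
    then have "t p \<in> carrier \<G> \<and> b (t p) p = rep p" unfolding t_def by (rule someI_ex)
    then show "t p \<in> carrier \<G>" "b (t p) p = rep p" by auto
  qed
  have t_mult: "t (b g p) \<otimes>\<^bsub>\<G>\<^esub> g = t p" if g: "g \<in> carrier \<G>" and p: "p \<in> P" for g p
  proof -
    let ?s = "t (b g p) \<otimes>\<^bsub>\<G>\<^esub> g"
    have s: "?s \<in> carrier \<G>" "b ?s p = rep p"
      using g p t b(3)[of "t (b g p)" g p] rep_eq by auto
    have "b (inv\<^bsub>\<G>\<^esub> (t p) \<otimes>\<^bsub>\<G>\<^esub> ?s) p = b (inv\<^bsub>\<G>\<^esub> (t p)) (b (t p) p)"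
      using s t p by (simp add: b(3) del: m_assoc)
    also have "\<dots> = b (inv\<^bsub>\<G>\<^esub> (t p) \<otimes>\<^bsub>\<G>\<^esub> t p) p"
      using t p by (intro b(3)[symmetric]) auto
    also have "\<dots> = p" using t p b(2) by simp
    finally have "inv\<^bsub>\<G>\<^esub> (t p) \<otimes>\<^bsub>\<G>\<^esub> ?s = \<one>\<^bsub>\<G>\<^esub>"
      using free[OF _ p] s t by simp
    then have "inv\<^bsub>\<G>\<^esub> (t p) \<otimes>\<^bsub>\<G>\<^esub> ?s = inv\<^bsub>\<G>\<^esub> (t p) \<otimes>\<^bsub>\<G>\<^esub> t p"
      using t by simp
    then show ?thesis using s(1) t(1)[of p] by (metis Units_eq Units_l_cancel inv_closed)
  qed
  have shift: "bij_betw (a g) (?fib p) (?fib (b g p))" if g: "g \<in> carrier \<G>" and p: "p \<in> P" for g p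
  proof (rule bij_betw_byWitness[of _ "a (inv\<^bsub>\<G>\<^esub> g)"])
    have ag: "a (inv\<^bsub>\<G>\<^esub> g) (a g x) = x" "a g (a (inv\<^bsub>\<G>\<^esub> g) x) = x" if "x \<in> X" for x
      using that g a(2) a(3)[of "inv\<^bsub>\<G>\<^esub> g" g x] a(3)[of g "inv\<^bsub>\<G>\<^esub> g" x] by auto
    have bg: "b (inv\<^bsub>\<G>\<^esub> g) (b g p) = p"
      using p g b(2) b(3)[of "inv\<^bsub>\<G>\<^esub> g" g p] by auto
    show "\<forall>x\<in>?fib p. a (inv\<^bsub>\<G>\<^esub> g) (a g x) = x" "\<forall>x\<in>?fib (b g p). a g (a (inv\<^bsub>\<G>\<^esub> g) x) = x"
      using ag by auto
    show "a g ` ?fib p \<subseteq> ?fib (b g p)" "a (inv\<^bsub>\<G>\<^esub> g) ` ?fib (b g p) \<subseteq> ?fib p"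
      using g a(1) \<pi>(2) bg by auto
  qed
  have \<beta>0: "bij_betw (\<beta>0 p) (?fib p) {..<card (?fib p)}" if "p \<in> P" for p
  proof -
    have "\<exists>f. bij_betw f (?fib p) {..<card (?fib p)}"
      using ex_bij_betw_finite_nat[OF fin[OF that]] by (simp add: atLeast0LessThan)
    then show ?thesis unfolding \<beta>0_def by (rule someI_ex)
  qed
  define \<beta> where "\<beta> x = \<beta>0 (rep (\<pi> x)) (a (t (\<pi> x)) x)" for x
  show thesis
  proof
    fix g x assume "g \<in> carrier \<G>" "x \<in> X"
    then show "\<beta> (a g x) = \<beta> x"
      using a(3)[of "t (b g (\<pi> x))" g x] t(1) t_mult[of g "\<pi> x"] rep_eq \<pi> unfolding \<beta>_def by simp
  next
    fix p assume p: "p \<in> P"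
    have rp: "rep p \<in> P" using t b(1) p by metis
    have s: "bij_betw (a (t p)) (?fib p) (?fib (rep p))"
      using shift[OF t(1)[of p] p] t(2) by simp
    then have "bij_betw (\<beta>0 (rep p) \<circ> a (t p)) (?fib p) {..<card (?fib p)}"
      using bij_betw_trans[OF s \<beta>0[OF rp]] bij_betw_same_card[OF s] by simp
    then show "bij_betw \<beta> (?fib p) {..<card (?fib p)}"
      by (rule bij_betw_cong[THEN iffD1, rotated]) (simp add: \<beta>_def)
  qed
qed

section \<open>Germs of a group of automorphisms\<close>

locale tree_group = arc_tree T bar for T :: "('v, 'e) pre_digraph" and bar +
  fixes H assumes H: "subgroup H (AutG T bar)"
begin

abbreviation "G \<equiv> AutG T bar"

sublocale H: subgroup H "AutG T bar" by (rule H)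

lemma H_carrier [simp]: "h \<in> H \<Longrightarrow> h \<in> carrier G" by (rule H.mem_carrier)

lemma inv_cancel:
  assumes "x \<in> carrier G" "y \<in> carrier G"
  shows "inv\<^bsub>G\<^esub> x \<otimes>\<^bsub>G\<^esub> (x \<otimes>\<^bsub>G\<^esub> y) = y" "x \<otimes>\<^bsub>G\<^esub> (inv\<^bsub>G\<^esub> x \<otimes>\<^bsub>G\<^esub> y) = y"
  using assms by (simp_all flip: m_assoc)

text \<open>
  The germ of \<open>h\<close> on \<open>S\<close> is encoded as the class of all elements of \<open>H\<close> with the same
  restriction to \<open>S\<close>. In a tree, the values of an automorphism on vertices determine those on
  arcs.
\<close>

definition germ :: "'v set \<Rightarrow> ('v, 'e) aut \<Rightarrow> ('v, 'e) aut set" where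
  "germ S h = {k \<in> H. \<forall>u \<in> S. fst k u = fst h u}"

lemma germ_eq_iff: "h \<in> H \<Longrightarrow> k \<in> H \<Longrightarrow> germ S h = germ S k \<longleftrightarrow> (\<forall>u \<in> S. fst h u = fst k u)"
  by (auto simp: germ_def)

lemma mem_germ_iff: "k \<in> germ S h \<longleftrightarrow> k \<in> H \<and> (\<forall>u \<in> S. fst k u = fst h u)"
  by (auto simp: germ_def)

lemma germ_mult_left:
  assumes "S \<subseteq> verts T" "x \<in> H" "h \<in> H" "k \<in> H"
  shows "germ S (x \<otimes>\<^bsub>G\<^esub> h) = germ S (x \<otimes>\<^bsub>G\<^esub> k) \<longleftrightarrow> germ S h = germ S k"
proof -
  have "fst (x \<otimes>\<^bsub>G\<^esub> h) u = fst (x \<otimes>\<^bsub>G\<^esub> k) u \<longleftrightarrow> fst h u = fst k u" if "u \<in> S" for u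
  proof -
    have "u \<in> verts T" using that assms by auto
    then show ?thesis using assms by simp
  qed
  then show ?thesis using assms by (simp add: germ_eq_iff)
qed

text \<open>
  The action of a pair \<open>(\<gamma>, \<delta>)\<close> on germs. It takes germs on \<open>S\<close> to germs on \<open>\<gamma> S\<close>.
\<close>

definition move where
  "move \<gamma> \<delta> c = (\<lambda>k. \<delta> \<otimes>\<^bsub>G\<^esub> k \<otimes>\<^bsub>G\<^esub> inv\<^bsub>G\<^esub> \<gamma>) ` c"

lemma move_move:
  assumes "\<gamma> \<in> H" "\<gamma>' \<in> H" "\<delta> \<in> H" "\<delta>' \<in> H" "c \<subseteq> H"
  shows "move \<gamma>' \<delta>' (move \<gamma> \<delta> c) = move (\<gamma>' \<otimes>\<^bsub>G\<^esub> \<gamma>) (\<delta>' \<otimes>\<^bsub>G\<^esub> \<delta>) c"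
  unfolding move_def image_image
proof (rule image_cong)
  fix k assume "k \<in> c"
  then have "k \<in> carrier G" using assms by auto
  then show "\<delta>' \<otimes>\<^bsub>G\<^esub> (\<delta> \<otimes>\<^bsub>G\<^esub> k \<otimes>\<^bsub>G\<^esub> inv\<^bsub>G\<^esub> \<gamma>) \<otimes>\<^bsub>G\<^esub> inv\<^bsub>G\<^esub> \<gamma>' =
      \<delta>' \<otimes>\<^bsub>G\<^esub> \<delta> \<otimes>\<^bsub>G\<^esub> k \<otimes>\<^bsub>G\<^esub> inv\<^bsub>G\<^esub> (\<gamma>' \<otimes>\<^bsub>G\<^esub> \<gamma>)"
    using assms by (simp add: inv_mult_group m_assoc)
qed simp

lemma move_one: "c \<subseteq> H \<Longrightarrow> move \<one>\<^bsub>G\<^esub> \<one>\<^bsub>G\<^esub> c = c"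
proof -
  assume c: "c \<subseteq> H"
  have "(\<lambda>k. \<one>\<^bsub>G\<^esub> \<otimes>\<^bsub>G\<^esub> k \<otimes>\<^bsub>G\<^esub> inv\<^bsub>G\<^esub> \<one>\<^bsub>G\<^esub>) ` c = id ` c"
    by (rule image_cong) (use c in auto)
  then show ?thesis by (simp add: move_def)
qed

lemma germ_subset: "germ S h \<subseteq> H" by (auto simp: germ_def)

lemma move_in_H: "\<gamma> \<in> H \<Longrightarrow> \<delta> \<in> H \<Longrightarrow> k \<in> H \<Longrightarrow> \<delta> \<otimes>\<^bsub>G\<^esub> k \<otimes>\<^bsub>G\<^esub> inv\<^bsub>G\<^esub> \<gamma> \<in> H"
  by (intro H.m_closed H.m_inv_closed)

lemma fst_move:
  assumes "\<gamma> \<in> H" "\<delta> \<in> H" "k \<in> H" "u \<in> verts T"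
  shows "fst (\<delta> \<otimes>\<^bsub>G\<^esub> k \<otimes>\<^bsub>G\<^esub> inv\<^bsub>G\<^esub> \<gamma>) (fst \<gamma> u) = fst \<delta> (fst k u)"
  using assms by simp

lemma move_subset:
  assumes "S \<subseteq> verts T" "\<gamma> \<in> H" "\<delta> \<in> H" "h \<in> H"
  shows "move \<gamma> \<delta> (germ S h) \<subseteq> germ (fst \<gamma> ` S) (\<delta> \<otimes>\<^bsub>G\<^esub> h \<otimes>\<^bsub>G\<^esub> inv\<^bsub>G\<^esub> \<gamma>)"
proof
  fix x assume "x \<in> move \<gamma> \<delta> (germ S h)"
  then obtain k where k: "k \<in> H" "\<forall>u \<in> S. fst k u = fst h u" "x = \<delta> \<otimes>\<^bsub>G\<^esub> k \<otimes>\<^bsub>G\<^esub> inv\<^bsub>G\<^esub> \<gamma>"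
    by (auto simp: move_def germ_def)
  have "fst x (fst \<gamma> u) = fst (\<delta> \<otimes>\<^bsub>G\<^esub> h \<otimes>\<^bsub>G\<^esub> inv\<^bsub>G\<^esub> \<gamma>) (fst \<gamma> u)" if "u \<in> S" for u
  proof -
    have "u \<in> verts T" using that assms by auto
    then show ?thesis using k that fst_move assms by presburger
  qed
  moreover have "x \<in> H" using k assms move_in_H by simp
  ultimately show "x \<in> germ (fst \<gamma> ` S) (\<delta> \<otimes>\<^bsub>G\<^esub> h \<otimes>\<^bsub>G\<^esub> inv\<^bsub>G\<^esub> \<gamma>)"
    by (auto simp: germ_def)
qed

lemma move_germ:
  assumes S: "S \<subseteq> verts T" and \<gamma>: "\<gamma> \<in> H" and \<delta>: "\<delta> \<in> H" and h: "h \<in> H"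
  shows "move \<gamma> \<delta> (germ S h) = germ (fst \<gamma> ` S) (\<delta> \<otimes>\<^bsub>G\<^esub> h \<otimes>\<^bsub>G\<^esub> inv\<^bsub>G\<^esub> \<gamma>)"
proof (rule antisym[OF move_subset[OF assms]])
  let ?h = "\<delta> \<otimes>\<^bsub>G\<^esub> h \<otimes>\<^bsub>G\<^esub> inv\<^bsub>G\<^esub> \<gamma>" and ?S = "fst \<gamma> ` S" and ?\<gamma> = "inv\<^bsub>G\<^esub> \<gamma>" and ?\<delta> = "inv\<^bsub>G\<^esub> \<delta>"
  have inv: "?\<gamma> \<in> H" "?\<delta> \<in> H" using \<gamma> \<delta> by auto
  have S': "?S \<subseteq> verts T" using S \<gamma> by auto
  have "move ?\<gamma> ?\<delta> (germ ?S ?h) \<subseteq> germ (fst ?\<gamma> ` ?S) (?\<delta> \<otimes>\<^bsub>G\<^esub> ?h \<otimes>\<^bsub>G\<^esub> inv\<^bsub>G\<^esub> ?\<gamma>)"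
    using move_subset[OF S' inv move_in_H[OF \<gamma> \<delta> h]] .
  also have "fst ?\<gamma> ` ?S = S"
    unfolding image_image using S \<gamma> by (intro trans[OF image_cong[OF refl] image_ident]) auto
  also have "?\<delta> \<otimes>\<^bsub>G\<^esub> ?h \<otimes>\<^bsub>G\<^esub> inv\<^bsub>G\<^esub> ?\<gamma> = h"
    using \<gamma> \<delta> h by (simp add: m_assoc) (simp add: m_assoc[symmetric])
  finally have "move \<gamma> \<delta> (move ?\<gamma> ?\<delta> (germ ?S ?h)) \<subseteq> move \<gamma> \<delta> (germ S h)"
    unfolding move_def by (rule image_mono)
  then show "germ ?S ?h \<subseteq> move \<gamma> \<delta> (germ S h)"
    using move_move[OF inv(1) \<gamma> inv(2) \<delta> germ_subset] \<gamma> \<delta> by (simp add: move_one[OF germ_subset])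
qed

section \<open>Counting orbits of germs\<close>

text \<open>
  The \<open>\<Gamma>\<close>-orbit of the germ of \<open>h\<close> on \<open>S\<close>, as the union of its members.
\<close>

definition orb where
  "orb \<Gamma> S h = {k \<in> H. \<exists>\<gamma> \<in> \<Gamma>. \<forall>u \<in> S. fst k u = fst \<gamma> (fst h u)}"

definition num_orbs :: "('v, 'e) aut set \<Rightarrow> 'v set \<Rightarrow> nat" where
  "num_orbs \<Gamma> S = card (orb \<Gamma> S ` H)"

lemma self_in_orb:
  assumes "subgroup \<Gamma> G" "S \<subseteq> verts T" "h \<in> H"
  shows "h \<in> orb \<Gamma> S h"
  unfolding orb_def using assms subgroup.one_closed[OF assms(1)]
  by (auto intro!: bexI[of _ "\<one>\<^bsub>G\<^esub>"] simp: subset_iff)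

lemma orb_eq_iff:
  assumes \<Gamma>: "subgroup \<Gamma> G" "\<Gamma> \<subseteq> H" and S: "S \<subseteq> verts T" and h: "h \<in> H" "k \<in> H"
  shows "orb \<Gamma> S h = orb \<Gamma> S k \<longleftrightarrow> k \<in> orb \<Gamma> S h"
proof
  interpret \<Gamma>: subgroup \<Gamma> G by fact
  have V: "\<And>u h. u \<in> S \<Longrightarrow> h \<in> H \<Longrightarrow> fst h u \<in> verts T" using S vert_closed H_carrier by blast
  have "k \<in> orb \<Gamma> S k"
    by (rule self_in_orb[OF \<Gamma>(1) S h(2)])
  then show "k \<in> orb \<Gamma> S h" if "orb \<Gamma> S h = orb \<Gamma> S k" using that by simp
  assume "k \<in> orb \<Gamma> S h"
  then obtain \<gamma> where \<gamma>: "\<gamma> \<in> \<Gamma>" "\<forall>u \<in> S. fst k u = fst \<gamma> (fst h u)" by (auto simp: orb_def)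
  show "orb \<Gamma> S h = orb \<Gamma> S k"
  proof (intro equalityI subsetI)
    fix x assume "x \<in> orb \<Gamma> S h"
    then obtain \<delta> where \<delta>: "x \<in> H" "\<delta> \<in> \<Gamma>" "\<forall>u \<in> S. fst x u = fst \<delta> (fst h u)" by (auto simp: orb_def)
    have "fst x u = fst (\<delta> \<otimes>\<^bsub>G\<^esub> inv\<^bsub>G\<^esub> \<gamma>) (fst k u)" if "u \<in> S" for u
      using that \<gamma> \<delta> V[OF that h(1)] by simp
    then show "x \<in> orb \<Gamma> S k"
      unfolding orb_def using \<delta>(1,2) \<gamma>(1) by (auto intro!: bexI[of _ "\<delta> \<otimes>\<^bsub>G\<^esub> inv\<^bsub>G\<^esub> \<gamma>"])
  next
    fix x assume "x \<in> orb \<Gamma> S k"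
    then obtain \<delta> where \<delta>: "x \<in> H" "\<delta> \<in> \<Gamma>" "\<forall>u \<in> S. fst x u = fst \<delta> (fst k u)" by (auto simp: orb_def)
    have "fst x u = fst (\<delta> \<otimes>\<^bsub>G\<^esub> \<gamma>) (fst h u)" if "u \<in> S" for u
      using that \<gamma> \<delta> V[OF that h(1)] by simp
    then show "x \<in> orb \<Gamma> S h"
      unfolding orb_def using \<delta>(1,2) \<gamma>(1) by (auto intro!: bexI[of _ "\<delta> \<otimes>\<^bsub>G\<^esub> \<gamma>"])
  qed
qed

lemma orb_image:
  assumes \<Gamma>: "subgroup \<Gamma> G" "\<Gamma> \<subseteq> H" and S: "S' \<subseteq> S" "S \<subseteq> verts T" and h: "h \<in> H"
  shows "orb \<Gamma> S ` orb \<Gamma> S' h = orb \<Gamma> S ` germ S' h"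
proof (intro equalityI image_subsetI)
  interpret \<Gamma>: subgroup \<Gamma> G by fact
  fix k assume "k \<in> orb \<Gamma> S' h"
  then obtain \<gamma> where k: "k \<in> H" and \<gamma>: "\<gamma> \<in> \<Gamma>" "\<forall>u \<in> S'. fst k u = fst \<gamma> (fst h u)" by (auto simp: orb_def)
  have \<gamma>H: "\<gamma> \<in> H" using \<gamma> \<Gamma> by auto
  let ?k = "inv\<^bsub>G\<^esub> \<gamma> \<otimes>\<^bsub>G\<^esub> k"
  have kH: "?k \<in> H" using \<gamma>H k by auto
  have "fst ?k u = fst h u" if "u \<in> S'" for u
  proof -
    have "u \<in> verts T" using that S by auto
    then show ?thesis using \<gamma>H k h \<gamma>(2) that by simp
  qed
  then have 1: "?k \<in> germ S' h" using kH by (simp add: germ_def)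
  have "fst k u = fst \<gamma> (fst ?k u)" if "u \<in> S" for u
  proof -
    have "u \<in> verts T" using that S by auto
    then show ?thesis using \<gamma>H k by simp
  qed
  then have "k \<in> orb \<Gamma> S ?k" using k \<gamma>(1) by (auto simp: orb_def)
  then have "orb \<Gamma> S k = orb \<Gamma> S ?k" using orb_eq_iff[OF \<Gamma> S(2) kH k] by simp
  then show "orb \<Gamma> S k \<in> orb \<Gamma> S ` germ S' h" using 1 by blast
next
  fix k assume "k \<in> germ S' h"
  moreover have "fst \<one>\<^bsub>G\<^esub> (fst h u) = fst h u" if "u \<in> S'" for u
    using that S h by (auto intro!: fst_one vert_closed)
  ultimately have "k \<in> orb \<Gamma> S' h"
    using subgroup.one_closed[OF \<Gamma>(1)] by (auto simp: orb_def germ_def intro!: bexI[of _ "\<one>\<^bsub>G\<^esub>"])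
  then show "orb \<Gamma> S k \<in> orb \<Gamma> S ` orb \<Gamma> S' h" by blast
qed

text \<open>
  Left multiplication by elements of \<open>H\<close> is compatible with restriction and transitive on the
  germs on \<open>S'\<close>.
\<close>

lemma card_germ_extensions:
  assumes S: "S' \<subseteq> S" "S \<subseteq> verts T" and h: "h \<in> H" and k: "k \<in> H"
  shows "card (germ S ` germ S' h) = card (germ S ` germ S' k)"
proof -
  let ?x = "h \<otimes>\<^bsub>G\<^esub> inv\<^bsub>G\<^esub> k"
  have x: "?x \<in> H" using h k by auto
  have S': "S' \<subseteq> verts T" using S by auto
  have "germ S' h = (\<lambda>y. ?x \<otimes>\<^bsub>G\<^esub> y) ` germ S' k"
  proof (intro equalityI subsetI)
    fix y assume y: "y \<in> germ S' h"
    let ?y = "k \<otimes>\<^bsub>G\<^esub> inv\<^bsub>G\<^esub> h \<otimes>\<^bsub>G\<^esub> y"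
    have yH: "y \<in> H" using y by (simp add: germ_def)
    have "fst ?y u = fst k u" if "u \<in> S'" for u
    proof -
      have "u \<in> verts T" using that S' by auto
      moreover have "fst y u = fst h u" using y that by (simp add: germ_def)
      ultimately show ?thesis using yH h k by simp
    qed
    then have "?y \<in> germ S' k" using yH h k by (simp add: germ_def)
    moreover have "y = ?x \<otimes>\<^bsub>G\<^esub> ?y"
    proof -
      have "?x \<otimes>\<^bsub>G\<^esub> ?y = h \<otimes>\<^bsub>G\<^esub> (inv\<^bsub>G\<^esub> k \<otimes>\<^bsub>G\<^esub> k) \<otimes>\<^bsub>G\<^esub> inv\<^bsub>G\<^esub> h \<otimes>\<^bsub>G\<^esub> y"
        using yH h k by (simp add: m_assoc inv_cancel)
      then show ?thesis using yH h k by (simp add: m_assoc inv_cancel)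
    qed
    ultimately show "y \<in> (\<lambda>y. ?x \<otimes>\<^bsub>G\<^esub> y) ` germ S' k" by (rule rev_image_eqI)
  next
    fix z assume "z \<in> (\<lambda>y. ?x \<otimes>\<^bsub>G\<^esub> y) ` germ S' k"
    then obtain y where y: "y \<in> H" "\<forall>u\<in>S'. fst y u = fst k u" "z = ?x \<otimes>\<^bsub>G\<^esub> y" by (auto simp: germ_def)
    have "fst z u = fst h u" if "u \<in> S'" for u
    proof -
      have "u \<in> verts T" using that S' by auto
      then show ?thesis using y that h k by simp
    qed
    then show "z \<in> germ S' h" using y x by (simp add: germ_def)
  qed
  then have "germ S ` germ S' h = (\<lambda>y. germ S (?x \<otimes>\<^bsub>G\<^esub> y)) ` germ S' k" by (simp add: image_image)
  moreover have "card ((\<lambda>y. germ S (?x \<otimes>\<^bsub>G\<^esub> y)) ` germ S' k) = card (germ S ` germ S' k)"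
    by (rule card_image_eq_if_same_kernel)
      (use germ_mult_left[OF S(2) x] germ_subset in blast)
  ultimately show ?thesis by simp
qed

text \<open>
  Restriction from \<open>S\<close> to \<open>S'\<close> induces a map of \<open>\<Gamma>\<close>-orbits of germs. Its fibre over the orbit
  of a germ \<open>d\<close> is in bijection with the set of extensions of \<open>d\<close>: every orbit over that of \<open>d\<close>
  contains an extension of \<open>d\<close>, and two extensions of \<open>d\<close> in the same orbit are equal, since an
  element of \<open>\<Gamma>\<close> that relates them fixes the image of a point of \<open>S'\<close>.
\<close>

lemma num_orbs_extensions:
  assumes \<Gamma>: "subgroup \<Gamma> G" "\<Gamma> \<subseteq> H"
    and free: "\<And>\<gamma> v. \<gamma> \<in> \<Gamma> \<Longrightarrow> v \<in> verts T \<Longrightarrow> fst \<gamma> v = v \<Longrightarrow> \<gamma> = \<one>\<^bsub>G\<^esub>"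
    and S: "S' \<subseteq> S" "S \<subseteq> verts T" "S' \<noteq> {}"
    and fin: "finite (orb \<Gamma> S ` H)" "finite (orb \<Gamma> S' ` H)" and h0: "h0 \<in> H"
  shows "num_orbs \<Gamma> S = card (germ S ` germ S' h0) * num_orbs \<Gamma> S'"
proof -
  interpret \<Gamma>: subgroup \<Gamma> G by fact
  have S': "S' \<subseteq> verts T" using S by auto
  have sub: "orb \<Gamma> S' h \<subseteq> H" for h by (auto simp: orb_def)
  have part: "orb \<Gamma> S ` H = (\<Union>D \<in> orb \<Gamma> S' ` H. orb \<Gamma> S ` D)"
    using self_in_orb[OF \<Gamma>(1) S'] sub by blast
  have disj: "orb \<Gamma> S ` D \<inter> orb \<Gamma> S ` D' = {}"
    if DD: "D \<in> orb \<Gamma> S' ` H" "D' \<in> orb \<Gamma> S' ` H" "D \<noteq> D'" for D D'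
  proof (rule ccontr)
    obtain h h' where h: "h \<in> H" "D = orb \<Gamma> S' h" "h' \<in> H" "D' = orb \<Gamma> S' h'"
      using DD(1,2) by (elim imageE)
    assume "orb \<Gamma> S ` D \<inter> orb \<Gamma> S ` D' \<noteq> {}"
    then obtain k k' where k: "k \<in> D" "k' \<in> D'" "orb \<Gamma> S k = orb \<Gamma> S k'" by auto
    then have kH: "k \<in> H" "k' \<in> H" using sub unfolding h(2,4) by blast+
    then have "k' \<in> orb \<Gamma> S k" using k(3) orb_eq_iff[OF \<Gamma> S(2)] by simp
    then have "k' \<in> orb \<Gamma> S' k" using S(1) unfolding orb_def by blast
    then have "orb \<Gamma> S' k = orb \<Gamma> S' k'" using orb_eq_iff[OF \<Gamma> S'] kH by simp
    moreover have "orb \<Gamma> S' h = orb \<Gamma> S' k" "orb \<Gamma> S' h' = orb \<Gamma> S' k'"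
      using orb_eq_iff[OF \<Gamma> S'] kH h k by auto
    ultimately show False using h DD by simp
  qed
  have card: "card (orb \<Gamma> S ` orb \<Gamma> S' h) = card (germ S ` germ S' h0)" if h: "h \<in> H" for h
  proof -
    have "card (orb \<Gamma> S ` germ S' h) = card (germ S ` germ S' h)"
    proof (rule card_image_eq_if_same_kernel)
      fix x y assume xy: "x \<in> germ S' h" "y \<in> germ S' h"
      then have H: "x \<in> H" "y \<in> H" by (auto simp: germ_def)
      show "orb \<Gamma> S x = orb \<Gamma> S y \<longleftrightarrow> germ S x = germ S y"
      proof
        assume "orb \<Gamma> S x = orb \<Gamma> S y"
        then have "y \<in> orb \<Gamma> S x" using orb_eq_iff[OF \<Gamma> S(2) H] by simp
        then obtain \<gamma> where \<gamma>: "\<gamma> \<in> \<Gamma>" "\<forall>u \<in> S. fst y u = fst \<gamma> (fst x u)" by (auto simp: orb_def)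
        obtain s where s: "s \<in> S'" using S by auto
        have "s \<in> S" "s \<in> verts T" using s S by auto
        moreover have "fst x s = fst y s" using xy s by (simp add: germ_def)
        ultimately have "fst \<gamma> (fst x s) = fst x s" using \<gamma>(2) by simp
        then have "\<gamma> = \<one>\<^bsub>G\<^esub>" using free[OF \<gamma>(1), of "fst x s"] H \<open>s \<in> verts T\<close> by simp
        then have "fst x u = fst y u" if "u \<in> S" for u
        proof -
          have "u \<in> verts T" using that S by auto
          then show ?thesis using \<gamma> that \<open>\<gamma> = \<one>\<^bsub>G\<^esub>\<close> H by simp
        qed
        then show "germ S x = germ S y" using H by (simp add: germ_eq_iff)
      next
        assume "germ S x = germ S y"
        then have xy': "\<forall>u \<in> S. fst x u = fst y u" using H by (simp add: germ_eq_iff)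
        then show "orb \<Gamma> S x = orb \<Gamma> S y" by (simp add: orb_def)
      qed
    qed
    then show ?thesis using orb_image[OF \<Gamma> S(1,2) h] card_germ_extensions[OF S(1,2) h h0] by simp
  qed
  have "card (orb \<Gamma> S ` H) = (\<Sum>D \<in> orb \<Gamma> S' ` H. card (orb \<Gamma> S ` D))"
    unfolding part
  proof (rule card_UN_disjoint)
    show "\<forall>D\<in>orb \<Gamma> S' ` H. finite (orb \<Gamma> S ` D)"
    proof
      fix D assume "D \<in> orb \<Gamma> S' ` H"
      then have "orb \<Gamma> S ` D \<subseteq> orb \<Gamma> S ` H" unfolding part by blast
      then show "finite (orb \<Gamma> S ` D)" using fin(1) by (rule finite_subset)
    qed
    show "\<forall>D\<in>orb \<Gamma> S' ` H. \<forall>D'\<in>orb \<Gamma> S' ` H. D \<noteq> D' \<longrightarrow> orb \<Gamma> S ` D \<inter> orb \<Gamma> S ` D' = {}"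
      by (intro ballI impI disj)
  qed (rule fin(2))
  also have "\<dots> = (\<Sum>D \<in> orb \<Gamma> S' ` H. card (germ S ` germ S' h0))"
    by (rule sum.cong) (use card in auto)
  finally show ?thesis by (simp add: num_orbs_def)
qed

text \<open>
  Multiplication by \<open>x\<close> on the right is a bijection from the germs on \<open>x S\<close> to the germs on
  \<open>S\<close>, and commutes with the action of \<open>\<Gamma>\<close> on the left.
\<close>

lemma num_orbs_invariant:
  assumes \<Gamma>: "subgroup \<Gamma> G" "\<Gamma> \<subseteq> H" and S: "S \<subseteq> verts T" and x: "x \<in> H"
  shows "num_orbs \<Gamma> (fst x ` S) = num_orbs \<Gamma> S"
proof -
  have xS: "fst x ` S \<subseteq> verts T" using S x by auto
  have mult_x: "fst (h \<otimes>\<^bsub>G\<^esub> x) u = fst h (fst x u)" if "h \<in> H" "u \<in> S" for h u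
    using S x that by auto
  have "card (orb \<Gamma> (fst x ` S) ` H) = card ((\<lambda>h. orb \<Gamma> S (h \<otimes>\<^bsub>G\<^esub> x)) ` H)"
  proof (rule card_image_eq_if_same_kernel)
    fix h k assume h: "h \<in> H" "k \<in> H"
    have "k \<in> orb \<Gamma> (fst x ` S) h \<longleftrightarrow> k \<otimes>\<^bsub>G\<^esub> x \<in> orb \<Gamma> S (h \<otimes>\<^bsub>G\<^esub> x)"
      using h x by (auto simp: orb_def mult_x)
    then show "orb \<Gamma> (fst x ` S) h = orb \<Gamma> (fst x ` S) k \<longleftrightarrow>
        orb \<Gamma> S (h \<otimes>\<^bsub>G\<^esub> x) = orb \<Gamma> S (k \<otimes>\<^bsub>G\<^esub> x)"
      using orb_eq_iff[OF \<Gamma> xS h] orb_eq_iff[OF \<Gamma> S, of "h \<otimes>\<^bsub>G\<^esub> x" "k \<otimes>\<^bsub>G\<^esub> x"] h x by simp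
  qed
  also have "(\<lambda>h. orb \<Gamma> S (h \<otimes>\<^bsub>G\<^esub> x)) ` H = orb \<Gamma> S ` H"
  proof (intro equalityI image_subsetI)
    fix h assume h: "h \<in> H"
    show "orb \<Gamma> S (h \<otimes>\<^bsub>G\<^esub> x) \<in> orb \<Gamma> S ` H" using h x by auto
    have "h = h \<otimes>\<^bsub>G\<^esub> inv\<^bsub>G\<^esub> x \<otimes>\<^bsub>G\<^esub> x" using h x by (simp add: m_assoc)
    then show "orb \<Gamma> S h \<in> (\<lambda>h. orb \<Gamma> S (h \<otimes>\<^bsub>G\<^esub> x)) ` H"
      using h x by (intro image_eqI[of _ _ "h \<otimes>\<^bsub>G\<^esub> inv\<^bsub>G\<^esub> x"]) auto
  qed
  finally show ?thesis by (simp add: num_orbs_def)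
qed

end

section \<open>The fibres of a common covering\<close>

text \<open>
  The radius is \<open>Suc n\<close>, not \<open>n\<close>, in order that the balls around the ends of an arc both
  contain the arc.
\<close>

locale lattice_pair = tree_group T bar H + L1: free_cocompact T bar \<Gamma>\<^sub>1 + L2: free_cocompact T bar \<Gamma>\<^sub>2
  for T :: "('v, 'e) pre_digraph" and bar H \<Gamma>\<^sub>1 \<Gamma>\<^sub>2 +
  fixes n :: nat
  assumes \<Gamma>\<^sub>1_H: "\<Gamma>\<^sub>1 \<subseteq> H" and \<Gamma>\<^sub>2_H: "\<Gamma>\<^sub>2 \<subseteq> H"
begin

lemma \<Gamma>H [simp]: "\<gamma> \<in> \<Gamma>\<^sub>1 \<Longrightarrow> \<gamma> \<in> H" "\<delta> \<in> \<Gamma>\<^sub>2 \<Longrightarrow> \<delta> \<in> H"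
  using \<Gamma>\<^sub>1_H \<Gamma>\<^sub>2_H by blast+

abbreviation B where "B v \<equiv> ball_verts T (Suc n) v"

definition overlap where "overlap e = B (tail T e) \<inter> B (head T e)"

lemma B_verts: "B v \<subseteq> verts T" by (rule ball_verts_subset)
lemma overlap_verts: "overlap e \<subseteq> verts T" using B_verts by (auto simp: overlap_def)
lemma overlap_subset: "overlap e \<subseteq> B (tail T e)" "overlap e \<subseteq> B (head T e)" by (auto simp: overlap_def)
lemma overlap_bar: "e \<in> arcs T \<Longrightarrow> overlap (bar e) = overlap e" by (auto simp: overlap_def)

lemma ends_in_overlap: "e \<in> arcs T \<Longrightarrow> tail T e \<in> overlap e" "e \<in> arcs T \<Longrightarrow> head T e \<in> overlap e"
  unfolding overlap_def using ends_in_ball center_in_ball by auto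

lemma B_aut: "h \<in> H \<Longrightarrow> v \<in> verts T \<Longrightarrow> B (fst h v) = fst h ` B v"
  by (rule ball_aut) auto

lemma overlap_aut:
  assumes "h \<in> H" "e \<in> arcs T"
  shows "overlap (snd h e) = fst h ` overlap e"
proof -
  have "inj_on (fst h) (verts T)" using assms(1) by (intro inj_onI) simp
  then have "fst h ` (B (tail T e) \<inter> B (head T e)) = fst h ` B (tail T e) \<inter> fst h ` B (head T e)"
    by (rule inj_on_image_Int[OF _ B_verts B_verts])
  then show ?thesis using assms B_aut by (simp add: overlap_def)
qed

text \<open>
  A germ on a finite set that sends one point into a finite set has only finitely many possible
  values at the others, because distances are preserved and balls are finite.
\<close>

lemma finite_germs:
  assumes S: "finite S" "S \<subseteq> verts T" "v \<in> S" and W: "finite W"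
  shows "finite (germ S ` {h \<in> H. fst h v \<in> W})"
proof (rule finite_image_if_factors)
  let ?Y = "\<Union>w \<in> W. \<Union>u \<in> S. ball_verts T (tree_dist v u) w"
  have "(\<lambda>h. restrict (fst h) S) ` {h \<in> H. fst h v \<in> W} \<subseteq> S \<rightarrow>\<^sub>E ?Y"
  proof (intro image_subsetI PiE_I)
    fix h u assume h: "h \<in> {h \<in> H. fst h v \<in> W}" and u: "u \<in> S"
    have "v \<in> verts T" "u \<in> verts T" using S u by auto
    then obtain p where p: "awalk v p u" "length p = tree_dist v u" by (rule geodesic)
    have "awalk (fst h v) (map (snd h) p) (fst h u)" using awalk_aut p(1) h by simp
    then have "fst h u \<in> ball_verts T (tree_dist v u) (fst h v)"
      unfolding ball_verts_def using p(2) by (intro CollectI exI[of _ "map (snd h) p"]) simp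
    then show "restrict (fst h) S u \<in> ?Y" using h u by auto
  qed simp
  moreover have "finite (S \<rightarrow>\<^sub>E ?Y)"
    using S W L1.finite_balls by (intro finite_PiE) auto
  ultimately show "finite ((\<lambda>h. restrict (fst h) S) ` {h \<in> H. fst h v \<in> W})"
    by (rule finite_subset)
next
  fix h k assume hk: "h \<in> {h \<in> H. fst h v \<in> W}" "k \<in> {h \<in> H. fst h v \<in> W}"
    and eq: "restrict (fst h) S = restrict (fst k) S"
  have "fst h u = fst k u" if "u \<in> S" for u
    using fun_cong[OF eq, of u] that by simp
  then show "germ S h = germ S k" using hk by (simp add: germ_eq_iff)
qed

lemma finite_orbs:
  assumes S: "finite S" "S \<subseteq> verts T" "v \<in> S"
  shows "finite (orb \<Gamma>\<^sub>1 S ` H)"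
proof -
  obtain W where W: "finite W" "\<And>v. v \<in> verts T \<Longrightarrow> \<exists>\<gamma> \<in> \<Gamma>\<^sub>1. fst \<gamma> v \<in> W"
    using L1.orbit_reps by metis
  have v: "v \<in> verts T" using S by auto
  have "finite (orb \<Gamma>\<^sub>1 S ` {h \<in> H. fst h v \<in> W})"
  proof (rule finite_image_if_factors[OF finite_germs[OF S W(1)]])
    fix h k assume "h \<in> {h \<in> H. fst h v \<in> W}" "k \<in> {h \<in> H. fst h v \<in> W}" "germ S h = germ S k"
    then have "\<forall>u \<in> S. fst h u = fst k u" by (simp add: germ_eq_iff)
    then show "orb \<Gamma>\<^sub>1 S h = orb \<Gamma>\<^sub>1 S k" by (simp add: orb_def)
  qed
  moreover have "orb \<Gamma>\<^sub>1 S ` H \<subseteq> orb \<Gamma>\<^sub>1 S ` {h \<in> H. fst h v \<in> W}"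
  proof (rule image_subsetI)
    fix h assume h: "h \<in> H"
    obtain \<gamma> where \<gamma>: "\<gamma> \<in> \<Gamma>\<^sub>1" "fst \<gamma> (fst h v) \<in> W" using W(2)[of "fst h v"] h v by auto
    have k: "\<gamma> \<otimes>\<^bsub>G\<^esub> h \<in> H" "fst (\<gamma> \<otimes>\<^bsub>G\<^esub> h) v \<in> W" using \<gamma> h v by auto
    have "fst (\<gamma> \<otimes>\<^bsub>G\<^esub> h) u = fst \<gamma> (fst h u)" if "u \<in> S" for u
      using that S(2) \<gamma>(1) h by (intro fst_mult) auto
    then have "\<gamma> \<otimes>\<^bsub>G\<^esub> h \<in> orb \<Gamma>\<^sub>1 S h" using k(1) \<gamma>(1) unfolding orb_def by blast
    then have "orb \<Gamma>\<^sub>1 S h = orb \<Gamma>\<^sub>1 S (\<gamma> \<otimes>\<^bsub>G\<^esub> h)"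
      using orb_eq_iff[OF L1.\<Gamma> \<Gamma>\<^sub>1_H S(2) h k(1)] by simp
    then show "orb \<Gamma>\<^sub>1 S h \<in> orb \<Gamma>\<^sub>1 S ` {h \<in> H. fst h v \<in> W}" using k by blast
  qed
  ultimately show ?thesis by (rule finite_subset[rotated])
qed

lemma finite_orbs_B: "v \<in> verts T \<Longrightarrow> finite (orb \<Gamma>\<^sub>1 (B v) ` H)"
  by (rule finite_orbs[OF L1.finite_balls B_verts center_in_ball])

lemma finite_orbs_overlap: "e \<in> arcs T \<Longrightarrow> finite (orb \<Gamma>\<^sub>1 (overlap e) ` H)"
  by (rule finite_orbs[OF finite_subset[OF overlap_subset(1) L1.finite_balls] overlap_verts ends_in_overlap(1)])

lemma num_orbs_pos: "finite (orb \<Gamma>\<^sub>1 S ` H) \<Longrightarrow> 0 < num_orbs \<Gamma>\<^sub>1 S"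
proof -
  assume "finite (orb \<Gamma>\<^sub>1 S ` H)"
  moreover have "H \<noteq> {}" using H.one_closed by blast
  ultimately show ?thesis unfolding num_orbs_def by (simp add: card_gt_0_iff)
qed

lemma num_orbs_B_aut: "\<gamma> \<in> \<Gamma>\<^sub>1 \<Longrightarrow> v \<in> verts T \<Longrightarrow> num_orbs \<Gamma>\<^sub>1 (B (fst \<gamma> v)) = num_orbs \<Gamma>\<^sub>1 (B v)"
  using num_orbs_invariant[OF L1.\<Gamma> \<Gamma>\<^sub>1_H B_verts] B_aut by simp

lemma common_multiple:
  obtains C where "0 < C" "\<And>v. v \<in> verts T \<Longrightarrow> num_orbs \<Gamma>\<^sub>1 (B v) dvd C"
proof -
  obtain W where W: "finite W" "W \<subseteq> verts T" "\<And>v. v \<in> verts T \<Longrightarrow> \<exists>\<gamma> \<in> \<Gamma>\<^sub>1. fst \<gamma> v \<in> W"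
    using L1.orbit_reps by metis
  show thesis
  proof
    \<comment> \<open>A product over representatives of the orbits of vertices suffices, as the factors
      are constant on orbits.\<close>
    show "0 < (\<Prod>w\<in>W. num_orbs \<Gamma>\<^sub>1 (B w))"
      using W num_orbs_pos finite_orbs_B by (intro prod_pos) auto
    fix v assume v: "v \<in> verts T"
    then obtain \<gamma> where "\<gamma> \<in> \<Gamma>\<^sub>1" "fst \<gamma> v \<in> W" using W by blast
    then show "num_orbs \<Gamma>\<^sub>1 (B v) dvd (\<Prod>w\<in>W. num_orbs \<Gamma>\<^sub>1 (B w))"
      using num_orbs_B_aut[OF _ v] dvd_prodI[OF W(1), of "fst \<gamma> v" "\<lambda>w. num_orbs \<Gamma>\<^sub>1 (B w)"] by simp
  qed
qed

definition orbit_multiple :: nat where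
  "orbit_multiple = (SOME C. 0 < C \<and> (\<forall>v \<in> verts T. num_orbs \<Gamma>\<^sub>1 (B v) dvd C))"

lemma orbit_multiple: "0 < orbit_multiple" "v \<in> verts T \<Longrightarrow> num_orbs \<Gamma>\<^sub>1 (B v) dvd orbit_multiple"
proof -
  have "\<exists>C. 0 < C \<and> (\<forall>v \<in> verts T. num_orbs \<Gamma>\<^sub>1 (B v) dvd C)" using common_multiple by metis
  then have "0 < orbit_multiple \<and> (\<forall>v \<in> verts T. num_orbs \<Gamma>\<^sub>1 (B v) dvd orbit_multiple)"
    unfolding orbit_multiple_def by (rule someI_ex)
  then show "0 < orbit_multiple" "v \<in> verts T \<Longrightarrow> num_orbs \<Gamma>\<^sub>1 (B v) dvd orbit_multiple" by auto
qed

text \<open>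
  Labelled germs at \<open>v\<close>. The number of labels is inversely proportional to the number of orbits
  of germs, so as to compensate for the different numbers of extensions of a germ at an arc to
  germs at its ends.
\<close>

definition fibre where
  "fibre v = germ (B v) ` H \<times> {..<orbit_multiple div num_orbs \<Gamma>\<^sub>1 (B v)}"

text \<open>
  Restriction of a germ to a smaller set; as germs are classes, this makes the class larger.
\<close>

definition coarsen where "coarsen S c = \<Union> (germ S ` c)"

lemma coarsen_germ:
  assumes "S' \<subseteq> S" "h \<in> H"
  shows "coarsen S' (germ S h) = germ S' h"
proof -
  have "germ S' k = germ S' h" if "k \<in> germ S h" for k
    using that assms by (subst germ_eq_iff) (auto simp: mem_germ_iff)
  moreover have "h \<in> germ S h" using assms by (simp add: mem_germ_iff)
  ultimately show ?thesis unfolding coarsen_def by blast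
qed

lemma move_germ_B:
  assumes "\<gamma> \<in> H" "\<delta> \<in> H" "h \<in> H" "v \<in> verts T"
  shows "move \<gamma> \<delta> (germ (B v) h) = germ (B (fst \<gamma> v)) (\<delta> \<otimes>\<^bsub>G\<^esub> h \<otimes>\<^bsub>G\<^esub> inv\<^bsub>G\<^esub> \<gamma>)"
  using move_germ[OF B_verts assms(1-3)] B_aut[OF assms(1,4)] by simp

lemma move_germ_overlap:
  assumes "\<gamma> \<in> H" "\<delta> \<in> H" "h \<in> H" "e \<in> arcs T"
  shows "move \<gamma> \<delta> (germ (overlap e) h) = germ (overlap (snd \<gamma> e)) (\<delta> \<otimes>\<^bsub>G\<^esub> h \<otimes>\<^bsub>G\<^esub> inv\<^bsub>G\<^esub> \<gamma>)"
  using move_germ[OF overlap_verts assms(1-3)] overlap_aut[OF assms(1,4)] by simp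

lemma fibre_move:
  assumes "\<gamma> \<in> \<Gamma>\<^sub>1" "\<delta> \<in> \<Gamma>\<^sub>2" "v \<in> verts T" "s \<in> fibre v"
  shows "(move \<gamma> \<delta> (fst s), snd s) \<in> fibre (fst \<gamma> v)"
proof -
  obtain h where h: "h \<in> H" "fst s = germ (B v) h" "snd s < orbit_multiple div num_orbs \<Gamma>\<^sub>1 (B v)"
    using assms(4) by (auto simp: fibre_def)
  then show ?thesis
    using assms move_germ_B[of \<gamma> \<delta> h v] num_orbs_B_aut[of \<gamma> v] move_in_H[of \<gamma> \<delta> h]
    by (simp add: fibre_def)
qed

section \<open>Matching the fibres along the arcs\<close>

definition points where "points = Sigma (arcs T) (\<lambda>e. fibre (tail T e))"

definition edge_germs where "edge_germs = Sigma (arcs T) (\<lambda>e. germ (overlap e) ` H)"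

definition edge_germ where "edge_germ x = (fst x, coarsen (overlap (fst x)) (fst (snd x)))"

lemma points_cases:
  assumes "x \<in> points"
  obtains e h i where "x = (e, germ (B (tail T e)) h, i)" "e \<in> arcs T" "h \<in> H"
    "i < orbit_multiple div num_orbs \<Gamma>\<^sub>1 (B (tail T e))" "edge_germ x = (e, germ (overlap e) h)"
  using assms unfolding points_def fibre_def
  by (auto simp: edge_germ_def coarsen_germ overlap_subset)

lemma edge_germ_fibre:
  assumes e: "e \<in> arcs T" and h: "h \<in> H"
  shows "{x \<in> points. edge_germ x = (e, germ (overlap e) h)} =
    {e} \<times> germ (B (tail T e)) ` germ (overlap e) h \<times> {..<orbit_multiple div num_orbs \<Gamma>\<^sub>1 (B (tail T e))}"
    (is "?L = ?R")
proof (intro equalityI subsetI)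
  fix x assume x: "x \<in> ?L"
  then obtain k i where k: "x = (e, germ (B (tail T e)) k, i)" "k \<in> H"
    "i < orbit_multiple div num_orbs \<Gamma>\<^sub>1 (B (tail T e))" "germ (overlap e) k = germ (overlap e) h"
    by (auto elim!: points_cases)
  then have "k \<in> germ (overlap e) h" by (metis mem_germ_iff)
  then show "x \<in> ?R" using k by auto
next
  fix x assume "x \<in> ?R"
  then obtain k i where k: "x = (e, germ (B (tail T e)) k, i)" "k \<in> germ (overlap e) h"
    "i < orbit_multiple div num_orbs \<Gamma>\<^sub>1 (B (tail T e))"
    by auto
  then have kH: "k \<in> H" "germ (overlap e) k = germ (overlap e) h"
    using h by (auto simp: germ_eq_iff mem_germ_iff)
  then show "x \<in> ?L"
    using k e by (simp add: points_def fibre_def edge_germ_def coarsen_germ overlap_subset)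
qed

text \<open>
  The number of labelled extensions at the tail of \<open>e\<close> involves only the overlap, which \<open>e\<close> and
  its inverse share. So it is also the number of labelled extensions at the head.
\<close>

lemma card_edge_germ_fibre:
  assumes e: "e \<in> arcs T" and h: "h \<in> H"
  shows "finite {x \<in> points. edge_germ x = (e, germ (overlap e) h)}"
    and "card {x \<in> points. edge_germ x = (e, germ (overlap e) h)} = orbit_multiple div num_orbs \<Gamma>\<^sub>1 (overlap e)"
proof -
  let ?N = "num_orbs \<Gamma>\<^sub>1 (B (tail T e))" and ?M = "num_orbs \<Gamma>\<^sub>1 (overlap e)"
  let ?E = "germ (B (tail T e)) ` germ (overlap e) h"
  have t: "tail T e \<in> verts T" using e by simp
  have N: "?N = card ?E * ?M"
    by (rule num_orbs_extensions[OF L1.\<Gamma> \<Gamma>\<^sub>1_H L1.free overlap_subset(1) B_verts _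
          finite_orbs_B[OF t] finite_orbs_overlap[OF e] h]) (use ends_in_overlap[OF e] in auto)
  have pos: "0 < ?N" "0 < ?M"
    using num_orbs_pos finite_orbs_B[OF t] finite_orbs_overlap[OF e] by auto
  have "0 < card ?E" using N pos by (metis mult_0 not_gr_zero)
  then have fin: "finite ?E" using card_gt_0_iff by blast
  then show "finite {x \<in> points. edge_germ x = (e, germ (overlap e) h)}"
    unfolding edge_germ_fibre[OF assms] by simp
  obtain k where k: "orbit_multiple = ?N * k" using orbit_multiple(2)[OF t] by (auto simp: dvd_def)
  have "card {x \<in> points. edge_germ x = (e, germ (overlap e) h)} = card ?E * (orbit_multiple div ?N)"
    unfolding edge_germ_fibre[OF assms] by (simp add: card_cartesian_product)
  also have "\<dots> = card ?E * k" using k pos by simp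
  also have "\<dots> = orbit_multiple div ?M"
  proof -
    have "orbit_multiple = ?M * (card ?E * k)" using k unfolding N by (simp only: ac_simps)
    then show ?thesis using pos(2) by simp
  qed
  finally show "card {x \<in> points. edge_germ x = (e, germ (overlap e) h)} = orbit_multiple div ?M" .
qed

text \<open>
  A pair \<open>(\<gamma>, \<delta>)\<close> that fixes a germ at an arc \<open>e\<close> is trivial, as required for an equivariant
  labelling: \<open>\<gamma>\<close> fixes the tail of \<open>e\<close>, and then \<open>\<delta>\<close> fixes its image under the germ.
\<close>

lemma point_labels:
  obtains \<beta> :: "'e \<times> ('v, 'e) aut set \<times> nat \<Rightarrow> nat" where
    "\<And>\<gamma> \<delta> e s. \<gamma> \<in> \<Gamma>\<^sub>1 \<Longrightarrow> \<delta> \<in> \<Gamma>\<^sub>2 \<Longrightarrow> e \<in> arcs T \<Longrightarrow> s \<in> fibre (tail T e) \<Longrightarrow>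
       \<beta> (snd \<gamma> e, move \<gamma> \<delta> (fst s), snd s) = \<beta> (e, s)"
    "\<And>e h. e \<in> arcs T \<Longrightarrow> h \<in> H \<Longrightarrow> bij_betw \<beta> {x \<in> points. edge_germ x = (e, germ (overlap e) h)}
       {..<orbit_multiple div num_orbs \<Gamma>\<^sub>1 (overlap e)}"
proof -
  define \<G> where "\<G> = G\<lparr>carrier := \<Gamma>\<^sub>1\<rparr> \<times>\<times> G\<lparr>carrier := \<Gamma>\<^sub>2\<rparr>"
  have grp: "group \<G>"
    unfolding \<G>_def by (intro DirProd_group L1.\<Gamma>.subgroup_is_group L2.\<Gamma>.subgroup_is_group group_axioms)
  have \<G>_carrier: "fst g \<in> \<Gamma>\<^sub>1 \<and> snd g \<in> \<Gamma>\<^sub>2" if "g \<in> carrier \<G>" for g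
    using that by (simp add: \<G>_def mem_Times_iff)
  have \<G>_one: "\<one>\<^bsub>\<G>\<^esub> = (\<one>\<^bsub>G\<^esub>, \<one>\<^bsub>G\<^esub>)" by (simp add: \<G>_def)
  have \<G>_mult: "g \<otimes>\<^bsub>\<G>\<^esub> h = (fst g \<otimes>\<^bsub>G\<^esub> fst h, snd g \<otimes>\<^bsub>G\<^esub> snd h)" for g h
    by (simp add: \<G>_def mult_DirProd')
  define a where "a g x = (snd (fst g) (fst x), move (fst g) (snd g) (fst (snd x)), snd (snd x))"
    for g and x :: "'e \<times> ('v, 'e) aut set \<times> nat"
  define b where "b g p = (snd (fst g) (fst p), move (fst g) (snd g) (snd p))"
    for g and p :: "'e \<times> ('v, 'e) aut set"
  have points_D: "fst x \<in> arcs T" "snd x \<in> fibre (tail T (fst x))" "fst (snd x) \<subseteq> H" if x: "x \<in> points" for x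
  proof -
    show "fst x \<in> arcs T" "snd x \<in> fibre (tail T (fst x))" using x by (auto simp: points_def)
    then obtain h where "fst (snd x) = germ (B (tail T (fst x))) h" by (auto simp: fibre_def)
    then show "fst (snd x) \<subseteq> H" using germ_subset by simp
  qed
  have edge_germs_D: "fst p \<in> arcs T" "\<exists>h \<in> H. snd p = germ (overlap (fst p)) h" "snd p \<subseteq> H"
    if p: "p \<in> edge_germs" for p
  proof -
    show "fst p \<in> arcs T" and *: "\<exists>h \<in> H. snd p = germ (overlap (fst p)) h"
      using p by (auto simp: edge_germs_def)
    then show "snd p \<subseteq> H" using germ_subset by metis
  qed
  have pts: "(e, s) \<in> points" if "e \<in> arcs T" "s \<in> fibre (tail T e)" for e s
    using that by (simp add: points_def)
  obtain \<beta> where \<beta>: "\<And>g x. g \<in> carrier \<G> \<Longrightarrow> x \<in> points \<Longrightarrow> \<beta> (a g x) = \<beta> x"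
    "\<And>p. p \<in> edge_germs \<Longrightarrow> bij_betw \<beta> {x \<in> points. edge_germ x = p} {..<card {x \<in> points. edge_germ x = p}}"
  proof (rule equivariant_labelling[OF grp, where a = a and b = b and X = points and P = edge_germs and \<pi> = edge_germ])
    fix g x assume g: "g \<in> carrier \<G>" and x: "x \<in> points"
    show "a g x \<in> points"
      using fibre_move[of "fst g" "snd g" "tail T (fst x)" "snd x"] \<G>_carrier[OF g] points_D[OF x]
      by (simp add: a_def points_def)
    obtain e h i where x': "x = (e, germ (B (tail T e)) h, i)" "e \<in> arcs T" "h \<in> H"
      "edge_germ x = (e, germ (overlap e) h)" using x by (rule points_cases)
    then show "edge_germ (a g x) = b g (edge_germ x)"
      using \<G>_carrier[OF g] overlap_subset(1)[of "snd (fst g) e"] move_in_H[of "fst g" "snd g" h]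
      by (simp add: a_def b_def edge_germ_def coarsen_germ overlap_subset move_germ_B move_germ_overlap)
  next
    fix x assume x: "x \<in> points"
    show "a \<one>\<^bsub>\<G>\<^esub> x = x" using points_D[OF x] by (simp add: a_def \<G>_one move_one)
    show "edge_germ x \<in> edge_germs"
      using x by (rule points_cases) (simp add: edge_germs_def)
  next
    fix g h x assume "g \<in> carrier \<G>" "h \<in> carrier \<G>" "x \<in> points"
    then show "a (g \<otimes>\<^bsub>\<G>\<^esub> h) x = a g (a h x)"
      using \<G>_carrier[of g] \<G>_carrier[of h] points_D[of x] by (simp add: a_def \<G>_mult move_move)
  next
    fix g p assume g: "g \<in> carrier \<G>" and p: "p \<in> edge_germs"
    obtain h where h: "h \<in> H" "snd p = germ (overlap (fst p)) h" using edge_germs_D[OF p] by blast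
    have e: "fst p \<in> arcs T" using edge_germs_D[OF p] by simp
    have m: "move (fst g) (snd g) (snd p) =
        germ (overlap (snd (fst g) (fst p))) (snd g \<otimes>\<^bsub>G\<^esub> h \<otimes>\<^bsub>G\<^esub> inv\<^bsub>G\<^esub> (fst g))"
      using \<G>_carrier[OF g] h e by (simp add: move_germ_overlap)
    then show "b g p \<in> edge_germs"
      using \<G>_carrier[OF g] h e move_in_H by (simp add: b_def edge_germs_def)
    assume bg: "b g p = p"
    then have "snd (fst g) (fst p) = fst p" by (metis b_def fst_conv)
    then have fix1: "fst (fst g) (tail T (fst p)) = tail T (fst p)"
      using aut_arc(1)[of "fst g" "fst p"] \<G>_carrier[OF g] e by simp
    then have g1: "fst g = \<one>\<^bsub>G\<^esub>" using L1.free[OF _ tail_in_verts[OF e] fix1] \<G>_carrier[OF g] by blast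
    have "move (fst g) (snd g) (snd p) = snd p" using bg by (metis b_def snd_conv)
    then have "germ (overlap (fst p)) (snd g \<otimes>\<^bsub>G\<^esub> h) = germ (overlap (fst p)) h"
      using m g1 h e \<G>_carrier[OF g] by simp
    then have "fst (snd g \<otimes>\<^bsub>G\<^esub> h) (tail T (fst p)) = fst h (tail T (fst p))"
      using germ_eq_iff[of "snd g \<otimes>\<^bsub>G\<^esub> h" h] h \<G>_carrier[OF g] ends_in_overlap(1)[OF e] by simp
    then have fix2: "fst (snd g) (fst h (tail T (fst p))) = fst h (tail T (fst p))"
      using h \<G>_carrier[OF g] e by simp
    have "fst h (tail T (fst p)) \<in> verts T" using h e by simp
    then have "snd g = \<one>\<^bsub>G\<^esub>" using L2.free[OF _ _ fix2] \<G>_carrier[OF g] by blast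
    then show "g = \<one>\<^bsub>\<G>\<^esub>" using g1 \<G>_one by (metis prod.collapse)
  next
    fix p assume p: "p \<in> edge_germs"
    show "b \<one>\<^bsub>\<G>\<^esub> p = p" using edge_germs_D[OF p] by (simp add: b_def \<G>_one move_one)
    obtain h where "h \<in> H" "snd p = germ (overlap (fst p)) h" using edge_germs_D[OF p] by blast
    then show "finite {x \<in> points. edge_germ x = p}"
      using card_edge_germ_fibre(1)[of "fst p" h] edge_germs_D[OF p] by (metis prod.collapse)
  next
    fix g h p assume "g \<in> carrier \<G>" "h \<in> carrier \<G>" "p \<in> edge_germs"
    then show "b (g \<otimes>\<^bsub>\<G>\<^esub> h) p = b g (b h p)"
      using \<G>_carrier[of g] \<G>_carrier[of h] edge_germs_D[of p] by (simp add: b_def \<G>_mult move_move)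
  qed blast
  show thesis
  proof
    fix \<gamma> \<delta> e s assume "\<gamma> \<in> \<Gamma>\<^sub>1" "\<delta> \<in> \<Gamma>\<^sub>2" "e \<in> arcs T" "s \<in> fibre (tail T e)"
    then show "\<beta> (snd \<gamma> e, move \<gamma> \<delta> (fst s), snd s) = \<beta> (e, s)"
      using \<beta>(1)[of "(\<gamma>, \<delta>)" "(e, s)"] pts by (simp add: a_def \<G>_def)
  next
    fix e h assume e: "e \<in> arcs T" "h \<in> H"
    then show "bij_betw \<beta> {x \<in> points. edge_germ x = (e, germ (overlap e) h)}
       {..<orbit_multiple div num_orbs \<Gamma>\<^sub>1 (overlap e)}"
      using \<beta>(2)[of "(e, germ (overlap e) h)"] card_edge_germ_fibre(2)[OF e] by (simp add: edge_germs_def)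
  qed
qed

text \<open>
  A labelled germ at the tail of \<open>e\<close> is linked to the one at its head that has the same
  restriction to the overlap and the same number in the labelling of the extensions of this
  restriction.
\<close>

lemma linking:
  obtains link :: "'e \<Rightarrow> ('v, 'e) aut set \<times> nat \<Rightarrow> ('v, 'e) aut set \<times> nat \<Rightarrow> bool"
  where "\<And>e s. e \<in> arcs T \<Longrightarrow> s \<in> fibre (tail T e) \<Longrightarrow> \<exists>t \<in> fibre (head T e). link e s t"
    and "\<And>e s t t'. e \<in> arcs T \<Longrightarrow> s \<in> fibre (tail T e) \<Longrightarrow> t \<in> fibre (head T e) \<Longrightarrow> t' \<in> fibre (head T e) \<Longrightarrow>
      link e s t \<Longrightarrow> link e s t' \<Longrightarrow> t = t'"
    and "\<And>e s t. e \<in> arcs T \<Longrightarrow> link e s t \<Longrightarrow> link (bar e) t s"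
    and "\<And>e s t. link e s t \<Longrightarrow> coarsen (overlap e) (fst s) = coarsen (overlap e) (fst t)"
    and "\<And>\<gamma> \<delta> e s t. \<gamma> \<in> \<Gamma>\<^sub>1 \<Longrightarrow> \<delta> \<in> \<Gamma>\<^sub>2 \<Longrightarrow> e \<in> arcs T \<Longrightarrow> s \<in> fibre (tail T e) \<Longrightarrow> t \<in> fibre (head T e) \<Longrightarrow>
      link e s t \<Longrightarrow> link (snd \<gamma> e) (move \<gamma> \<delta> (fst s), snd s) (move \<gamma> \<delta> (fst t), snd t)"
proof -
  obtain \<beta> :: "'e \<times> ('v, 'e) aut set \<times> nat \<Rightarrow> nat" where
    \<beta>: "\<And>\<gamma> \<delta> e s. \<gamma> \<in> \<Gamma>\<^sub>1 \<Longrightarrow> \<delta> \<in> \<Gamma>\<^sub>2 \<Longrightarrow> e \<in> arcs T \<Longrightarrow> s \<in> fibre (tail T e) \<Longrightarrow>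
       \<beta> (snd \<gamma> e, move \<gamma> \<delta> (fst s), snd s) = \<beta> (e, s)"
    and bij: "\<And>e h. e \<in> arcs T \<Longrightarrow> h \<in> H \<Longrightarrow> bij_betw \<beta> {x \<in> points. edge_germ x = (e, germ (overlap e) h)}
       {..<orbit_multiple div num_orbs \<Gamma>\<^sub>1 (overlap e)}"
    by (rule point_labels) blast
  define link where "link e s t \<longleftrightarrow> coarsen (overlap e) (fst s) = coarsen (overlap e) (fst t) \<and> \<beta> (e, s) = \<beta> (bar e, t)"
    for e s t
  have fib: "\<exists>h \<in> H. fst s = germ (B v) h" if "s \<in> fibre v" for v s
    using that by (auto simp: fibre_def)
  have pt: "(e, s) \<in> {x \<in> points. edge_germ x = (e, germ (overlap e) h)} \<longleftrightarrow>
      s \<in> fibre (tail T e) \<and> coarsen (overlap e) (fst s) = germ (overlap e) h" if "e \<in> arcs T" for e s h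
    using that by (simp add: points_def edge_germ_def)
  show thesis
  proof
    fix e s assume e: "e \<in> arcs T" and s: "s \<in> fibre (tail T e)"
    obtain h where h: "h \<in> H" "fst s = germ (B (tail T e)) h" using fib[OF s] by blast
    then have x: "coarsen (overlap e) (fst s) = germ (overlap e) h" by (simp add: coarsen_germ overlap_subset)
    have "(e, s) \<in> {x \<in> points. edge_germ x = (e, germ (overlap e) h)}"
      using pt[OF e] s x by blast
    then have "\<beta> (e, s) \<in> {..<orbit_multiple div num_orbs \<Gamma>\<^sub>1 (overlap e)}"
      using bij_betwE[OF bij[OF e h(1)]] by blast
    then have "\<beta> (e, s) \<in> \<beta> ` {x \<in> points. edge_germ x = (bar e, germ (overlap (bar e)) h)}"
      using bij_betw_imp_surj_on[OF bij[OF arev_in_arcs[OF e] h(1)]] e by (simp add: overlap_bar)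
    then obtain y where y: "y \<in> {x \<in> points. edge_germ x = (bar e, germ (overlap (bar e)) h)}"
      "\<beta> (e, s) = \<beta> y" by blast
    then have "y = (bar e, snd y)" by (simp add: edge_germ_def prod_eq_iff)
    then have "snd y \<in> fibre (tail T (bar e)) \<and> coarsen (overlap (bar e)) (fst (snd y)) = germ (overlap (bar e)) h"
      "\<beta> (e, s) = \<beta> (bar e, snd y)"
      using y pt[of "bar e" "snd y" h] e by auto
    then show "\<exists>t \<in> fibre (head T e). link e s t"
      unfolding link_def using x e by (intro bexI[of _ "snd y"]) (auto simp: overlap_bar)
  next
    fix e s t t' assume e: "e \<in> arcs T" and s: "s \<in> fibre (tail T e)" and t: "t \<in> fibre (head T e)" "t' \<in> fibre (head T e)"
      and l: "link e s t" "link e s t'"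
    obtain h where h: "h \<in> H" "fst s = germ (B (tail T e)) h" using fib[OF s] by blast
    then have x: "coarsen (overlap e) (fst s) = germ (overlap e) h" by (simp add: coarsen_germ overlap_subset)
    have "(bar e, t) \<in> {x \<in> points. edge_germ x = (bar e, germ (overlap (bar e)) h)}"
      "(bar e, t') \<in> {x \<in> points. edge_germ x = (bar e, germ (overlap (bar e)) h)}"
      using pt[OF arev_in_arcs[OF e], of _ h] t l x e unfolding link_def by (simp_all add: overlap_bar)
    moreover have "\<beta> (bar e, t) = \<beta> (bar e, t')" using l by (simp add: link_def)
    ultimately have "(bar e, t) = (bar e, t')"
      using inj_onD[OF bij_betw_imp_inj_on[OF bij[OF arev_in_arcs[OF e] h(1)]]] by blast
    then show "t = t'" by simp
  next
    fix e s t assume "e \<in> arcs T" "link e s t"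
    then show "link (bar e) t s" by (simp add: link_def overlap_bar)
  next
    fix e s t assume "link e s t"
    then show "coarsen (overlap e) (fst s) = coarsen (overlap e) (fst t)" by (simp add: link_def)
  next
    fix \<gamma> \<delta> e s t assume \<gamma>: "\<gamma> \<in> \<Gamma>\<^sub>1" "\<delta> \<in> \<Gamma>\<^sub>2" and e: "e \<in> arcs T"
      and s: "s \<in> fibre (tail T e)" and t: "t \<in> fibre (head T e)" and l: "link e s t"
    have mv: "coarsen (overlap (snd \<gamma> e)) (move \<gamma> \<delta> (fst s)) = move \<gamma> \<delta> (coarsen (overlap e) (fst s))"
      if sv: "s \<in> fibre v" and v: "v \<in> {tail T e, head T e}" for s v
    proof -
      obtain h where h: "h \<in> H" "fst s = germ (B v) h" using fib[OF sv] by blast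
      have B: "overlap e \<subseteq> B v" "overlap (snd \<gamma> e) \<subseteq> B (fst \<gamma> v)" "v \<in> verts T"
        using v e \<gamma> overlap_subset[of e] overlap_subset[of "snd \<gamma> e"] by auto
      have \<gamma>H: "\<gamma> \<in> H" "\<delta> \<in> H" using \<gamma> by auto
      show ?thesis
        unfolding h(2) move_germ_B[OF \<gamma>H h(1) B(3)] coarsen_germ[OF B(1) h(1)]
          coarsen_germ[OF B(2) move_in_H[OF \<gamma>H h(1)]] move_germ_overlap[OF \<gamma>H h(1) e] ..
    qed
    have "\<beta> (bar (snd \<gamma> e), move \<gamma> \<delta> (fst t), snd t) = \<beta> (bar e, t)"
      using \<beta>[OF \<gamma>, of "bar e" t] e t \<gamma> by simp
    then show "link (snd \<gamma> e) (move \<gamma> \<delta> (fst s), snd s) (move \<gamma> \<delta> (fst t), snd t)"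
      using l mv[OF s] mv[OF t] \<beta>[OF \<gamma> e s] unfolding link_def by simp
  qed
qed

end

section \<open>Commensurating two lattices\<close>

text \<open>
  A function on \<open>L\<close> that separates the cosets of \<open>K\<close> has at least as many values as there are
  cosets.
\<close>

lemma (in group) has_finite_indexI:
  assumes L: "subgroup L G" and K: "subgroup K G"
    and fin: "finite (f ` L)"
    and f: "\<And>x y. x \<in> L \<Longrightarrow> y \<in> L \<Longrightarrow> f x = f y \<Longrightarrow> y \<otimes> inv x \<in> K"
  shows "has_finite_index G K L"
proof -
  interpret L: subgroup L G by fact
  interpret K: subgroup K G by fact
  have "K #> x = K #> y" if "x \<in> L" "y \<in> L" "f x = f y" for x y
    using coset_join3 repr_independence f[OF that] that
    by (metis K coset_mult_inv1 coset_join2 inv_closed K.subset L.mem_carrier m_closed)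
  then have "finite ((\<lambda>x. K #> x) ` L)"
    using finite_image_if_factors[OF fin] by blast
  moreover have "rcosets\<^bsub>G\<lparr>carrier := L\<rparr>\<^esub> K = (\<lambda>x. K #> x) ` L"
    unfolding RCOSETS_def r_coset_def by auto
  ultimately show ?thesis by (simp add: has_finite_index_def)
qed

lemma (in group) conjugate_eq:
  "conjugate G K g = (\<lambda>k. g \<otimes> k \<otimes> inv g) ` K"
  unfolding conjugate_def l_coset_def r_coset_def by auto

lemma (in group) subgroup_conjugate:
  assumes K: "subgroup K G" and g: "g \<in> carrier G"
  shows "subgroup (conjugate G K g) G"
proof -
  have "group_hom G G (\<lambda>k. g \<otimes> k \<otimes> inv g)"
  proof (unfold_locales, rule homI)
    fix x y assume xy: "x \<in> carrier G" "y \<in> carrier G"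
    have "inv g \<otimes> (g \<otimes> (y \<otimes> inv g)) = y \<otimes> inv g"
      using xy g by (simp flip: m_assoc)
    then show "g \<otimes> (x \<otimes> y) \<otimes> inv g = g \<otimes> x \<otimes> inv g \<otimes> (g \<otimes> y \<otimes> inv g)"
      using xy g by (simp add: m_assoc)
  qed (use g in simp)
  then show ?thesis
    unfolding conjugate_eq using group_hom.subgroup_img_is_subgroup[OF _ K] by blast
qed

context lattice_pair
begin

text \<open>
  The source of a germ can be moved into a finite set by \<open>\<Gamma>\<^sub>1\<close> and its target by \<open>\<Gamma>\<^sub>2\<close>. The
  function \<open>key\<close> records the labelled germ that results; its values form a finite set, and
  labelled germs with the same value lie in the same orbit of \<open>\<Gamma>\<^sub>1 \<times> \<Gamma>\<^sub>2\<close>.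
\<close>

lemma finite_fibre_reps:
  obtains key :: "'v \<Rightarrow> ('v, 'e) aut set \<times> nat \<Rightarrow> 'v \<times> ('v, 'e) aut set \<times> nat"
    and K where "finite K" "\<And>v s. v \<in> verts T \<Longrightarrow> s \<in> fibre v \<Longrightarrow> key v s \<in> K"
    "\<And>v s v' s'. v \<in> verts T \<Longrightarrow> s \<in> fibre v \<Longrightarrow> v' \<in> verts T \<Longrightarrow> s' \<in> fibre v' \<Longrightarrow> key v s = key v' s' \<Longrightarrow>
      \<exists>\<gamma> \<in> \<Gamma>\<^sub>1. \<exists>\<delta> \<in> \<Gamma>\<^sub>2. fst \<gamma> v = v' \<and> s' = (move \<gamma> \<delta> (fst s), snd s)"
proof -
  obtain W1 where W1: "finite W1" "W1 \<subseteq> verts T" "\<And>v. v \<in> verts T \<Longrightarrow> \<exists>\<gamma> \<in> \<Gamma>\<^sub>1. fst \<gamma> v \<in> W1"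
    using L1.orbit_reps by metis
  obtain W2 where W2: "finite W2" "W2 \<subseteq> verts T" "\<And>v. v \<in> verts T \<Longrightarrow> \<exists>\<gamma> \<in> \<Gamma>\<^sub>2. fst \<gamma> v \<in> W2"
    using L2.orbit_reps by metis
  let ?K = "Sigma W1 (\<lambda>w. germ (B w) ` {h \<in> H. fst h w \<in> W2} \<times> {..orbit_multiple})"
  have reps: "\<exists>\<gamma> \<in> \<Gamma>\<^sub>1. \<exists>\<delta> \<in> \<Gamma>\<^sub>2. (fst \<gamma> v, move \<gamma> \<delta> (fst s), snd s) \<in> ?K" if v: "v \<in> verts T" and s: "s \<in> fibre v" for v s
  proof -
    obtain h where h: "h \<in> H" "fst s = germ (B v) h" using s by (auto simp: fibre_def)
    have "snd s < orbit_multiple div num_orbs \<Gamma>\<^sub>1 (B v)" using s by (auto simp: fibre_def)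
    then have s_le: "snd s \<le> orbit_multiple" by (meson div_le_dividend less_imp_le order.trans)
    obtain \<gamma> where \<gamma>: "\<gamma> \<in> \<Gamma>\<^sub>1" "fst \<gamma> v \<in> W1" using W1(3) v by blast
    have "fst h v \<in> verts T" using h v by simp
    then obtain \<delta> where \<delta>: "\<delta> \<in> \<Gamma>\<^sub>2" "fst \<delta> (fst h v) \<in> W2" using W2(3) by blast
    let ?k = "\<delta> \<otimes>\<^bsub>G\<^esub> h \<otimes>\<^bsub>G\<^esub> inv\<^bsub>G\<^esub> \<gamma>"
    have \<gamma>\<delta>H: "\<gamma> \<in> H" "\<delta> \<in> H" using \<gamma> \<delta> by auto
    have "?k \<in> H" "fst ?k (fst \<gamma> v) \<in> W2"
      using move_in_H[OF \<gamma>\<delta>H h(1)] fst_move[OF \<gamma>\<delta>H h(1) v] \<delta>(2) by simp_all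
    then have "move \<gamma> \<delta> (fst s) \<in> germ (B (fst \<gamma> v)) ` {h \<in> H. fst h (fst \<gamma> v) \<in> W2}"
      unfolding h(2) move_germ_B[OF \<gamma>\<delta>H h(1) v] by blast
    then have "(fst \<gamma> v, move \<gamma> \<delta> (fst s), snd s) \<in> ?K" using \<gamma>(2) s_le by simp
    then show ?thesis using \<gamma>(1) \<delta>(1) by blast
  qed
  have ex: "\<exists>q. fst q \<in> \<Gamma>\<^sub>1 \<and> snd q \<in> \<Gamma>\<^sub>2 \<and> (fst (fst q) v, move (fst q) (snd q) (fst s), snd s) \<in> ?K"
    if vs: "v \<in> verts T" "s \<in> fibre v" for v s
  proof -
    obtain \<gamma> \<delta> where "\<gamma> \<in> \<Gamma>\<^sub>1" "\<delta> \<in> \<Gamma>\<^sub>2" "(fst \<gamma> v, move \<gamma> \<delta> (fst s), snd s) \<in> ?K"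
      using reps[OF vs] by blast
    then show ?thesis by (intro exI[of _ "(\<gamma>, \<delta>)"]) (simp only: fst_conv snd_conv simp_thms)
  qed
  define q where "q v s = (SOME q. fst q \<in> \<Gamma>\<^sub>1 \<and> snd q \<in> \<Gamma>\<^sub>2 \<and>
      (fst (fst q) v, move (fst q) (snd q) (fst s), snd s) \<in> ?K)" for v s
  define c where "c v s = fst (q v s)" for v s
  define d where "d v s = snd (q v s)" for v s
  have cd: "c v s \<in> \<Gamma>\<^sub>1 \<and> d v s \<in> \<Gamma>\<^sub>2 \<and> (fst (c v s) v, move (c v s) (d v s) (fst s), snd s) \<in> ?K"
    if "v \<in> verts T" "s \<in> fibre v" for v s
    unfolding c_def d_def q_def by (rule someI_ex[OF ex[OF that]])
  define key where "key v s = (fst (c v s) v, move (c v s) (d v s) (fst s), snd s)" for v s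
  show thesis
  proof (rule that[of ?K key])
    show "finite ?K"
      using W1(1,2) finite_germs[OF L1.finite_balls B_verts center_in_ball W2(1)]
      by (intro finite_SigmaI finite_cartesian_product) auto
    show "key v s \<in> ?K" if "v \<in> verts T" "s \<in> fibre v" for v s
      using cd[OF that] unfolding key_def by blast
  next
    fix v s v' s' assume v: "v \<in> verts T" "s \<in> fibre v" and v': "v' \<in> verts T" "s' \<in> fibre v'"
      and "key v s = key v' s'"
    then have eq: "fst (c v s) v = fst (c v' s') v'" "move (c v s) (d v s) (fst s) = move (c v' s') (d v' s') (fst s')"
      "snd s = snd s'" by (simp_all add: key_def)
    let ?c = "c v s" and ?c' = "c v' s'" and ?d = "d v s" and ?d' = "d v' s'"
    have 1: "?c \<in> \<Gamma>\<^sub>1" "?c' \<in> \<Gamma>\<^sub>1" "?d \<in> \<Gamma>\<^sub>2" "?d' \<in> \<Gamma>\<^sub>2" using cd[OF v] cd[OF v'] by auto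
    then have 2: "?c \<in> H" "?c' \<in> H" "?d \<in> H" "?d' \<in> H" by auto
    have sub: "fst s \<subseteq> H" "fst s' \<subseteq> H"
      using v(2) v'(2) germ_subset unfolding fibre_def by (metis imageE mem_Times_iff)+
    have "fst (inv\<^bsub>G\<^esub> ?c' \<otimes>\<^bsub>G\<^esub> ?c) v = fst (inv\<^bsub>G\<^esub> ?c') (fst ?c' v')"
      using 2 v(1) eq(1) by simp
    then have "fst (inv\<^bsub>G\<^esub> ?c' \<otimes>\<^bsub>G\<^esub> ?c) v = v'" using 2 v'(1) by simp
    moreover have "fst s' = move (inv\<^bsub>G\<^esub> ?c' \<otimes>\<^bsub>G\<^esub> ?c) (inv\<^bsub>G\<^esub> ?d' \<otimes>\<^bsub>G\<^esub> ?d) (fst s)"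
    proof -
      have "fst s' = move (inv\<^bsub>G\<^esub> ?c') (inv\<^bsub>G\<^esub> ?d') (move ?c' ?d' (fst s'))"
        using 2 sub(2) by (subst move_move) (auto simp: move_one)
      also have "move ?c' ?d' (fst s') = move ?c ?d (fst s)" by (rule eq(2)[symmetric])
      also have "move (inv\<^bsub>G\<^esub> ?c') (inv\<^bsub>G\<^esub> ?d') \<dots> = move (inv\<^bsub>G\<^esub> ?c' \<otimes>\<^bsub>G\<^esub> ?c) (inv\<^bsub>G\<^esub> ?d' \<otimes>\<^bsub>G\<^esub> ?d) (fst s)"
        using 2 sub(1) by (intro move_move) auto
      finally show ?thesis .
    qed
    moreover have "inv\<^bsub>G\<^esub> ?c' \<otimes>\<^bsub>G\<^esub> ?c \<in> \<Gamma>\<^sub>1" "inv\<^bsub>G\<^esub> ?d' \<otimes>\<^bsub>G\<^esub> ?d \<in> \<Gamma>\<^sub>2"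
      using 1 by (auto intro: L1.\<Gamma>.m_closed L2.\<Gamma>.m_closed)
    moreover have "snd s' = snd s" by (rule eq(3)[symmetric])
    ultimately show "\<exists>\<gamma> \<in> \<Gamma>\<^sub>1. \<exists>\<delta> \<in> \<Gamma>\<^sub>2. fst \<gamma> v = v' \<and> s' = (move \<gamma> \<delta> (fst s), snd s)"
      by (metis prod.collapse)
  qed
qed

text \<open>
  The automorphism comes from a flat section of the labelled germs. The pairs \<open>(\<gamma>, \<delta>)\<close> with \<open>g
  \<gamma> = \<delta> g\<close> then have only finitely many orbits on vertices, via \<open>\<gamma>\<close>.
\<close>

lemma commensurating_automorphism:
  obtains g h and key :: "'v \<Rightarrow> 'v \<times> ('v, 'e) aut set \<times> nat" where "g \<in> carrier G"
    "\<And>v. v \<in> verts T \<Longrightarrow> h v \<in> H"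
    "\<And>v u. v \<in> verts T \<Longrightarrow> u \<in> B v \<Longrightarrow> fst g u = fst (h v) u"
    "finite (key ` verts T)"
    "\<And>v v'. v \<in> verts T \<Longrightarrow> v' \<in> verts T \<Longrightarrow> key v = key v' \<Longrightarrow>
       \<exists>\<gamma> \<in> \<Gamma>\<^sub>1. \<exists>\<delta> \<in> \<Gamma>\<^sub>2. fst \<gamma> v = v' \<and> g \<otimes>\<^bsub>G\<^esub> \<gamma> = \<delta> \<otimes>\<^bsub>G\<^esub> g"
proof -
  obtain link where link:
    "\<And>e s. e \<in> arcs T \<Longrightarrow> s \<in> fibre (tail T e) \<Longrightarrow> \<exists>t \<in> fibre (head T e). link e s t"
    "\<And>e s t t'. e \<in> arcs T \<Longrightarrow> s \<in> fibre (tail T e) \<Longrightarrow> t \<in> fibre (head T e) \<Longrightarrow> t' \<in> fibre (head T e) \<Longrightarrow>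
      link e s t \<Longrightarrow> link e s t' \<Longrightarrow> t = t'"
    "\<And>e s t. e \<in> arcs T \<Longrightarrow> link e s t \<Longrightarrow> link (bar e) t s"
    "\<And>e s t. link e s t \<Longrightarrow> coarsen (overlap e) (fst s) = coarsen (overlap e) (fst t)"
    "\<And>\<gamma> \<delta> e s t. \<gamma> \<in> \<Gamma>\<^sub>1 \<Longrightarrow> \<delta> \<in> \<Gamma>\<^sub>2 \<Longrightarrow> e \<in> arcs T \<Longrightarrow> s \<in> fibre (tail T e) \<Longrightarrow> t \<in> fibre (head T e) \<Longrightarrow>
      link e s t \<Longrightarrow> link (snd \<gamma> e) (move \<gamma> \<delta> (fst s), snd s) (move \<gamma> \<delta> (fst t), snd t)"
    by (rule linking) blast
  obtain r where r: "r \<in> verts T" using nonempty by blast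
  have "0 < orbit_multiple div num_orbs \<Gamma>\<^sub>1 (B r)"
    using orbit_multiple(1) orbit_multiple(2)[OF r] by (simp add: div_greater_zero_iff dvd_imp_le num_orbs_pos finite_orbs_B r)
  then have s0: "(germ (B r) \<one>\<^bsub>G\<^esub>, 0) \<in> fibre r" by (simp add: fibre_def)
  obtain \<sigma> where "\<sigma> r = (germ (B r) \<one>\<^bsub>G\<^esub>, 0)" and \<sigma>: "\<And>v. v \<in> verts T \<Longrightarrow> \<sigma> v \<in> fibre v"
    "\<And>e. e \<in> arcs T \<Longrightarrow> link e (\<sigma> (tail T e)) (\<sigma> (head T e))"
  proof (rule flat_section_exists[where F = fibre and link = link, OF _ _ r s0])
    fix \<tau> assume "\<tau> r = (germ (B r) \<one>\<^bsub>G\<^esub>, 0)" "\<And>v. v \<in> verts T \<Longrightarrow> \<tau> v \<in> fibre v"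
      "\<And>e. e \<in> arcs T \<Longrightarrow> link e (\<tau> (tail T e)) (\<tau> (head T e))"
    then show thesis by (rule that)
  qed (rule link(1) link(3); assumption)+
  define h where "h v = (SOME h. h \<in> H \<and> fst (\<sigma> v) = germ (B v) h)" for v
  have h: "h v \<in> H" "fst (\<sigma> v) = germ (B v) (h v)" if v: "v \<in> verts T" for v
  proof -
    have "\<exists>h. h \<in> H \<and> fst (\<sigma> v) = germ (B v) h"
      using \<sigma>(1)[OF v] unfolding fibre_def mem_Times_iff by (elim conjE imageE) blast
    then have "h v \<in> H \<and> fst (\<sigma> v) = germ (B v) (h v)" unfolding h_def by (rule someI_ex)
    then show "h v \<in> H" "fst (\<sigma> v) = germ (B v) (h v)" by auto
  qed
  have agree: "fst (h (tail T e)) u = fst (h (head T e)) u" if e: "e \<in> arcs T" and u: "u \<in> overlap e" for e u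
  proof -
    have v: "tail T e \<in> verts T" "head T e \<in> verts T" using e by auto
    have "germ (overlap e) (h (tail T e)) = germ (overlap e) (h (head T e))"
      using link(4)[OF \<sigma>(2)[OF e]] unfolding h(2)[OF v(1)] h(2)[OF v(2)]
        coarsen_germ[OF overlap_subset(1) h(1)[OF v(1)]] coarsen_germ[OF overlap_subset(2) h(1)[OF v(2)]] .
    then show ?thesis using germ_eq_iff[OF h(1)[OF v(1)] h(1)[OF v(2)]] u by blast
  qed
  obtain g where g: "g \<in> carrier G" "\<And>v u. v \<in> verts T \<Longrightarrow> u \<in> B v \<Longrightarrow> fst g u = fst (h v) u"
  proof (rule glue_automorphisms)
    show "h v \<in> carrier G" if "v \<in> verts T" for v using h(1)[OF that] by simp
    show "fst (h (tail T e)) u = fst (h (head T e)) u"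
      if "e \<in> arcs T" "u \<in> B (tail T e)" "u \<in> B (head T e)" for e u
      using agree that by (simp add: overlap_def)
  qed blast
  have equivariant: "g \<otimes>\<^bsub>G\<^esub> \<gamma> = \<delta> \<otimes>\<^bsub>G\<^esub> g"
    if \<gamma>: "\<gamma> \<in> \<Gamma>\<^sub>1" and \<delta>: "\<delta> \<in> \<Gamma>\<^sub>2" and v: "v \<in> verts T"
      and same: "\<sigma> (fst \<gamma> v) = (move \<gamma> \<delta> (fst (\<sigma> v)), snd (\<sigma> v))" for \<gamma> \<delta> v
  proof (rule aut_eq_on_vertsI)
    let ?i = "inv\<^bsub>G\<^esub> \<gamma>"
    have i: "?i \<in> \<Gamma>\<^sub>1" using \<gamma> by simp
    \<comment> \<open>The translate of the section by the pair is again flat, and agrees with the section at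
      one vertex.\<close>
    define \<tau> where "\<tau> u = (move \<gamma> \<delta> (fst (\<sigma> (fst ?i u))), snd (\<sigma> (fst ?i u)))" for u
    have \<tau>_eq: "\<tau> u = \<sigma> u" if u: "u \<in> verts T" for u
    proof (rule flat_section_unique[where F = fibre and link = link and r = "fst \<gamma> v" and \<sigma> = \<tau> and \<tau> = \<sigma>, OF link(2)])
      show "\<tau> w \<in> fibre w" if w: "w \<in> verts T" for w
      proof -
        have "fst ?i w \<in> verts T" using w i by simp
        then show ?thesis
          using fibre_move[OF \<gamma> \<delta> _ \<sigma>(1)] w \<gamma> unfolding \<tau>_def by fastforce
      qed
      show "link e (\<tau> (tail T e)) (\<tau> (head T e))" if e: "e \<in> arcs T" for e
      proof -
        let ?e = "snd ?i e"
        have e': "?e \<in> arcs T" "tail T ?e = fst ?i (tail T e)" "head T ?e = fst ?i (head T e)" "snd \<gamma> ?e = e"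
          using e \<gamma> by simp_all
        have "link (snd \<gamma> ?e) (move \<gamma> \<delta> (fst (\<sigma> (tail T ?e))), snd (\<sigma> (tail T ?e)))
            (move \<gamma> \<delta> (fst (\<sigma> (head T ?e))), snd (\<sigma> (head T ?e)))"
          by (rule link(5)[OF \<gamma> \<delta> e'(1) \<sigma>(1) \<sigma>(1) \<sigma>(2)[OF e'(1)]]) (use e'(1) in auto)
        then show ?thesis unfolding \<tau>_def e' .
      qed
      show "\<tau> (fst \<gamma> v) = \<sigma> (fst \<gamma> v)" using same \<gamma> v by (simp add: \<tau>_def)
      show "fst \<gamma> v \<in> verts T" using \<gamma> v by simp
    qed (use \<sigma> u in auto)
    fix u assume u: "u \<in> verts T"
    have \<gamma>u: "fst \<gamma> u \<in> verts T" using \<gamma> u by simp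
    have \<gamma>\<delta>H: "\<gamma> \<in> H" "\<delta> \<in> H" using \<gamma> \<delta> by auto
    have "fst (\<sigma> (fst \<gamma> u)) = move \<gamma> \<delta> (fst (\<sigma> u))"
      unfolding \<tau>_eq[OF \<gamma>u, symmetric] using \<gamma> u by (simp add: \<tau>_def)
    then have "germ (B (fst \<gamma> u)) (h (fst \<gamma> u)) = germ (B (fst \<gamma> u)) (\<delta> \<otimes>\<^bsub>G\<^esub> h u \<otimes>\<^bsub>G\<^esub> ?i)"
      unfolding h(2)[OF u] h(2)[OF \<gamma>u] move_germ_B[OF \<gamma>\<delta>H h(1)[OF u] u] .
    then have "fst (h (fst \<gamma> u)) (fst \<gamma> u) = fst (\<delta> \<otimes>\<^bsub>G\<^esub> h u \<otimes>\<^bsub>G\<^esub> ?i) (fst \<gamma> u)"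
      using germ_eq_iff[OF h(1)[OF \<gamma>u] move_in_H[OF \<gamma>\<delta>H h(1)[OF u]]] center_in_ball[OF \<gamma>u] by blast
    also have "\<dots> = fst \<delta> (fst (h u) u)" by (rule fst_move[OF \<gamma>\<delta>H h(1)[OF u] u])
    finally show "fst (g \<otimes>\<^bsub>G\<^esub> \<gamma>) u = fst (\<delta> \<otimes>\<^bsub>G\<^esub> g) u"
      using g(1) g(2)[OF u center_in_ball[OF u]] g(2)[OF \<gamma>u center_in_ball[OF \<gamma>u]] u \<gamma> \<delta> by simp
  qed (use g \<gamma> \<delta> in auto)
  obtain key :: "'v \<Rightarrow> ('v, 'e) aut set \<times> nat \<Rightarrow> 'v \<times> ('v, 'e) aut set \<times> nat"
    and K where key: "finite K" "\<And>v s. v \<in> verts T \<Longrightarrow> s \<in> fibre v \<Longrightarrow> key v s \<in> K"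
    "\<And>v s v' s'. v \<in> verts T \<Longrightarrow> s \<in> fibre v \<Longrightarrow> v' \<in> verts T \<Longrightarrow> s' \<in> fibre v' \<Longrightarrow> key v s = key v' s' \<Longrightarrow>
      \<exists>\<gamma> \<in> \<Gamma>\<^sub>1. \<exists>\<delta> \<in> \<Gamma>\<^sub>2. fst \<gamma> v = v' \<and> s' = (move \<gamma> \<delta> (fst s), snd s)"
    by (rule finite_fibre_reps) (rule that)
  show thesis
  proof (rule that[of g h "\<lambda>v. key v (\<sigma> v)"])
    show "finite ((\<lambda>v. key v (\<sigma> v)) ` verts T)"
      by (rule finite_subset[OF image_subsetI key(1)]) (rule key(2)[OF _ \<sigma>(1)])
    show "\<exists>\<gamma> \<in> \<Gamma>\<^sub>1. \<exists>\<delta> \<in> \<Gamma>\<^sub>2. fst \<gamma> v = v' \<and> g \<otimes>\<^bsub>G\<^esub> \<gamma> = \<delta> \<otimes>\<^bsub>G\<^esub> g"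
      if v: "v \<in> verts T" "v' \<in> verts T" and eq: "key v (\<sigma> v) = key v' (\<sigma> v')" for v v'
    proof -
      obtain \<gamma> \<delta> where *: "\<gamma> \<in> \<Gamma>\<^sub>1" "\<delta> \<in> \<Gamma>\<^sub>2" "fst \<gamma> v = v'" "\<sigma> v' = (move \<gamma> \<delta> (fst (\<sigma> v)), snd (\<sigma> v))"
        using key(3)[OF v(1) \<sigma>(1)[OF v(1)] v(2) \<sigma>(1)[OF v(2)] eq] by blast
      then have "g \<otimes>\<^bsub>G\<^esub> \<gamma> = \<delta> \<otimes>\<^bsub>G\<^esub> g" using equivariant[OF *(1,2) v(1)] by simp
      then show ?thesis using * by blast
    qed
  qed (use g h in auto)
qed

text \<open>
  One function separates the cosets in both groups. It sends \<open>x\<close> to the key of \<open>g\<inverse> x g r\<close>. If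
  \<open>x\<close> and \<open>y\<close> have the same key, there is a pair \<open>(\<gamma>, \<delta>)\<close> with \<open>g \<gamma> g\<inverse> = \<delta>\<close> such that \<open>\<delta> x\<close> and
  \<open>y\<close> agree at the vertex \<open>g r\<close>. Both groups act freely on vertices, so \<open>\<delta> x = y\<close> whenever \<open>x\<close>
  and \<open>y\<close> are in one of them.
\<close>

lemma commensurable_conjugateI:
  assumes g: "g \<in> carrier G" and fin: "finite (key ` verts T)"
    and key: "\<And>v v'. v \<in> verts T \<Longrightarrow> v' \<in> verts T \<Longrightarrow> key v = key v' \<Longrightarrow>
       \<exists>\<gamma> \<in> \<Gamma>\<^sub>1. \<exists>\<delta> \<in> \<Gamma>\<^sub>2. fst \<gamma> v = v' \<and> g \<otimes>\<^bsub>G\<^esub> \<gamma> = \<delta> \<otimes>\<^bsub>G\<^esub> g"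
  shows "commensurable G (conjugate G \<Gamma>\<^sub>1 g) \<Gamma>\<^sub>2"
proof -
  let ?K = "conjugate G \<Gamma>\<^sub>1 g"
  obtain r where r: "r \<in> verts T" using nonempty by blast
  have K: "subgroup ?K G" by (rule subgroup_conjugate[OF L1.\<Gamma> g])
  interpret K: subgroup ?K G by (rule K)
  define f where "f x = key (fst (inv\<^bsub>G\<^esub> g \<otimes>\<^bsub>G\<^esub> x \<otimes>\<^bsub>G\<^esub> g) r)" for x
  have fin_f: "finite (f ` L)" if "L \<subseteq> carrier G" for L
  proof (rule finite_subset[OF _ fin])
    show "f ` L \<subseteq> key ` verts T"
    proof (rule image_subsetI)
      fix x assume "x \<in> L"
      then have "inv\<^bsub>G\<^esub> g \<otimes>\<^bsub>G\<^esub> x \<otimes>\<^bsub>G\<^esub> g \<in> carrier G" using that g by auto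
      then show "f x \<in> key ` verts T" unfolding f_def using vert_closed[OF _ r] by blast
    qed
  qed
  have diff: "\<exists>\<gamma> \<in> \<Gamma>\<^sub>1. \<exists>\<delta> \<in> \<Gamma>\<^sub>2. g \<otimes>\<^bsub>G\<^esub> \<gamma> \<otimes>\<^bsub>G\<^esub> inv\<^bsub>G\<^esub> g = \<delta> \<and> fst (\<delta> \<otimes>\<^bsub>G\<^esub> x) (fst g r) = fst y (fst g r)"
    if x: "x \<in> carrier G" and y: "y \<in> carrier G" and eq: "f x = f y" for x y
  proof -
    let ?u = "fst (inv\<^bsub>G\<^esub> g) (fst x (fst g r))" and ?v = "fst (inv\<^bsub>G\<^esub> g) (fst y (fst g r))"
    have uv: "?u \<in> verts T" "?v \<in> verts T" using g x y r by auto
    have "key ?u = key ?v" using eq g x y r by (simp add: f_def)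
    then obtain \<gamma> \<delta> where *: "\<gamma> \<in> \<Gamma>\<^sub>1" "\<delta> \<in> \<Gamma>\<^sub>2" "fst \<gamma> ?u = ?v" "g \<otimes>\<^bsub>G\<^esub> \<gamma> = \<delta> \<otimes>\<^bsub>G\<^esub> g"
      using key[OF uv] by blast
    have c: "\<gamma> \<in> carrier G" "\<delta> \<in> carrier G" using * by auto
    have "g \<otimes>\<^bsub>G\<^esub> \<gamma> \<otimes>\<^bsub>G\<^esub> inv\<^bsub>G\<^esub> g = \<delta>" unfolding *(4) using g c by (simp add: m_assoc)
    moreover have "fst (\<delta> \<otimes>\<^bsub>G\<^esub> x) (fst g r) = fst y (fst g r)"
    proof -
      have "fst (\<delta> \<otimes>\<^bsub>G\<^esub> x) (fst g r) = fst \<delta> (fst g ?u)" using c g x r by simp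
      also have "\<dots> = fst (\<delta> \<otimes>\<^bsub>G\<^esub> g) ?u" using c g uv by simp
      also have "\<dots> = fst g (fst \<gamma> ?u)" unfolding *(4)[symmetric] using c g uv by simp
      also have "\<dots> = fst y (fst g r)" unfolding *(3) using g y r by simp
      finally show ?thesis .
    qed
    ultimately show ?thesis using * by blast
  qed
  have gr: "fst g r \<in> verts T" using g r by simp
  have freeK: "x = \<one>\<^bsub>G\<^esub>" if x: "x \<in> ?K" and fix_x: "fst x (fst g r) = fst g r" for x
  proof -
    obtain \<gamma> where \<gamma>: "\<gamma> \<in> \<Gamma>\<^sub>1" "x = g \<otimes>\<^bsub>G\<^esub> \<gamma> \<otimes>\<^bsub>G\<^esub> inv\<^bsub>G\<^esub> g" using x unfolding conjugate_eq by blast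
    have "fst g (fst \<gamma> r) = fst g r" using fix_x \<gamma> g r by simp
    then have "fst \<gamma> r = r" using g r \<gamma>(1) by simp
    then have "\<gamma> = \<one>\<^bsub>G\<^esub>" by (rule L1.free[OF \<gamma>(1) r])
    then show ?thesis using \<gamma>(2) g by simp
  qed
  have sub: "subgroup (?K \<inter> \<Gamma>\<^sub>2) G" using subgroups_Inter_pair[OF K L2.\<Gamma>] .
  have index: "has_finite_index G (?K \<inter> \<Gamma>\<^sub>2) L"
    if L: "subgroup L G" and D: "?K \<inter> \<Gamma>\<^sub>2 \<subseteq> L"
      and freeL: "\<And>x. x \<in> L \<Longrightarrow> fst x (fst g r) = fst g r \<Longrightarrow> x = \<one>\<^bsub>G\<^esub>" for L
  proof (rule has_finite_indexI[OF L sub, where f = f])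
    interpret L: subgroup L G by fact
    show "finite (f ` L)" by (rule fin_f[OF L.subset])
    fix x y assume x: "x \<in> L" and y: "y \<in> L" and eq: "f x = f y"
    have xy: "x \<in> carrier G" "y \<in> carrier G" using x y by auto
    obtain \<gamma> \<delta> where *: "\<gamma> \<in> \<Gamma>\<^sub>1" "\<delta> \<in> \<Gamma>\<^sub>2" "g \<otimes>\<^bsub>G\<^esub> \<gamma> \<otimes>\<^bsub>G\<^esub> inv\<^bsub>G\<^esub> g = \<delta>"
      "fst (\<delta> \<otimes>\<^bsub>G\<^esub> x) (fst g r) = fst y (fst g r)"
      using diff[OF xy eq] by blast
    have D\<delta>: "\<delta> \<in> ?K \<inter> \<Gamma>\<^sub>2" using *(1-3) unfolding conjugate_eq by blast
    then have \<delta>L: "\<delta> \<in> L" "\<delta> \<in> carrier G" using D by auto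
    have "inv\<^bsub>G\<^esub> y \<otimes>\<^bsub>G\<^esub> (\<delta> \<otimes>\<^bsub>G\<^esub> x) \<in> L" using x y \<delta>L by auto
    moreover have "fst (inv\<^bsub>G\<^esub> y \<otimes>\<^bsub>G\<^esub> (\<delta> \<otimes>\<^bsub>G\<^esub> x)) (fst g r) = fst g r"
    proof -
      have "fst (inv\<^bsub>G\<^esub> y \<otimes>\<^bsub>G\<^esub> (\<delta> \<otimes>\<^bsub>G\<^esub> x)) (fst g r) = fst (inv\<^bsub>G\<^esub> y) (fst (\<delta> \<otimes>\<^bsub>G\<^esub> x) (fst g r))"
        using xy \<delta>L gr by (intro fst_mult) auto
      then show ?thesis unfolding *(4) using xy gr by simp
    qed
    ultimately have one: "inv\<^bsub>G\<^esub> y \<otimes>\<^bsub>G\<^esub> (\<delta> \<otimes>\<^bsub>G\<^esub> x) = \<one>\<^bsub>G\<^esub>" by (rule freeL)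
    have "y = y \<otimes>\<^bsub>G\<^esub> (inv\<^bsub>G\<^esub> y \<otimes>\<^bsub>G\<^esub> (\<delta> \<otimes>\<^bsub>G\<^esub> x))" unfolding one using xy by simp
    also have "\<dots> = \<delta> \<otimes>\<^bsub>G\<^esub> x" using xy \<delta>L by (simp add: inv_cancel)
    finally have "y \<otimes>\<^bsub>G\<^esub> inv\<^bsub>G\<^esub> x = \<delta>" using xy \<delta>L by (simp add: m_assoc)
    then show "y \<otimes>\<^bsub>G\<^esub> inv\<^bsub>G\<^esub> x \<in> ?K \<inter> \<Gamma>\<^sub>2" using D\<delta> by simp
  qed
  show ?thesis
    unfolding commensurable_def
    using K L2.\<Gamma> index[OF K _ freeK] index[OF L2.\<Gamma> _ L2.free[OF _ gr]] by blast
qed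

end

theorem theorem1p2:
  fixes T :: "('v, 'e) pre_digraph" and bar :: "'e \<Rightarrow> 'e"
    and H \<Gamma>\<^sub>1 \<Gamma>\<^sub>2 :: "(('v \<Rightarrow> 'v) \<times> ('e \<Rightarrow> 'e)) set"
  assumes "is_tree T bar"
    and "subgroup H (AutG T bar)"
    and "free_uniform_lattice T bar \<Gamma>\<^sub>1" and "\<Gamma>\<^sub>1 \<subseteq> H"
    and "free_uniform_lattice T bar \<Gamma>\<^sub>2" and "\<Gamma>\<^sub>2 \<subseteq> H"
  shows "\<forall>R :: nat. \<exists>g \<in> symmetry_restricted_closure T bar R H.
           commensurable (AutG T bar) (conjugate (AutG T bar) \<Gamma>\<^sub>1 g) \<Gamma>\<^sub>2"
proof
  fix R :: nat
  have bd: "bidirected_digraph T bar" and sc: "simply_connected_space (realisation T bar)"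
    using assms(1) by (auto simp: is_tree_def)
  interpret bidirected_digraph T bar by (rule bd)
  have tree: "arc_tree T bar"
  proof
    have "topspace (cell_space T) \<noteq> {}"
      using sc unfolding simply_connected_space_def topspace_realisation by blast
    then show "verts T \<noteq> {}" using tail_in_verts by (fastforce simp: topspace_cell_space)
    show "\<exists>p. awalk u p v" if "u \<in> verts T" "v \<in> verts T" for u v
      using connected_if_realisation_connected[OF bd _ that] sc by (simp add: simply_connected_space_def)
    show "e \<in> set p \<or> bar e \<in> set p" if "e \<in> arcs T" "awalk (head T e) p (tail T e)" for e p
      by (rule bridge_if_simply_connected[OF bd sc that])
  qed
  interpret arc_tree T bar by (rule tree)
  have lattice: "free_cocompact T bar \<Gamma>" if "free_uniform_lattice T bar \<Gamma>" for \<Gamma>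
  proof (intro free_cocompact.intro free_cocompact_axioms.intro tree)
    show \<Gamma>: "subgroup \<Gamma> (AutG T bar)" using that by (simp add: free_uniform_lattice_def)
    show "\<gamma> = \<one>\<^bsub>AutG T bar\<^esub>" if "\<gamma> \<in> \<Gamma>" "v \<in> verts T" "fst \<gamma> v = v" for \<gamma> v
      using free_on_vertices[OF subgroup.subset[OF \<Gamma>] _ that] \<open>free_uniform_lattice T bar \<Gamma>\<close>
      by (simp add: free_uniform_lattice_def)
    show "finite ((\<lambda>e. (\<lambda>\<gamma>. snd \<gamma> e) ` \<Gamma>) ` arcs T)"
      using finite_arc_orbits[OF \<Gamma>] that by (simp add: free_uniform_lattice_def)
  qed
  interpret lattice_pair T bar H \<Gamma>\<^sub>1 \<Gamma>\<^sub>2 R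
    by (intro lattice_pair.intro lattice_pair_axioms.intro tree_group.intro tree_group_axioms.intro
        tree lattice assms)
  obtain g h and key :: "'v \<Rightarrow> 'v \<times> (('v \<Rightarrow> 'v) \<times> ('e \<Rightarrow> 'e)) set \<times> nat" where g: "g \<in> carrier G"
    and h: "\<And>v. v \<in> verts T \<Longrightarrow> h v \<in> H"
    and gh: "\<And>v u. v \<in> verts T \<Longrightarrow> u \<in> B v \<Longrightarrow> fst g u = fst (h v) u"
    and fin: "finite (key ` verts T)"
    and key: "\<And>v v'. v \<in> verts T \<Longrightarrow> v' \<in> verts T \<Longrightarrow> key v = key v' \<Longrightarrow>
       \<exists>\<gamma> \<in> \<Gamma>\<^sub>1. \<exists>\<delta> \<in> \<Gamma>\<^sub>2. fst \<gamma> v = v' \<and> g \<otimes>\<^bsub>G\<^esub> \<gamma> = \<delta> \<otimes>\<^bsub>G\<^esub> g"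
    by (rule commensurating_automorphism) (rule that)
  have "ball_restrict T R v (h v) = ball_restrict T R v g" if v: "v \<in> verts T" for v
  proof -
    have eq: "fst (h v) u = fst g u" if "u \<in> ball_verts T R v" for u
      using gh[OF v, of u] ball_verts_mono[of R "Suc R" v] that by auto
    have "snd (h v) e = snd g e" if "e \<in> ball_arcs T R v" for e
      using that eq h[OF v] g by (intro aut_eq_on_arc) (auto simp: ball_arcs_def)
    then show ?thesis using eq by (simp add: ball_restrict_def restrict_def fun_eq_iff)
  qed
  then have "g \<in> symmetry_restricted_closure T bar R H"
    unfolding symmetry_restricted_closure_def using g h by blast
  then show "\<exists>g \<in> symmetry_restricted_closure T bar R H.
           commensurable (AutG T bar) (conjugate (AutG T bar) \<Gamma>\<^sub>1 g) \<Gamma>\<^sub>2"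
    using commensurable_conjugateI[OF g fin key] by blast
qed

end
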